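(* Let $K$ be a finite extension of $\mathbb{Q}_p$, $p$ odd, and let $(\Sigma,X,d)$ be a cluster picture with $p>|X|$. Then $\Sigma$ is of polynomial type over $K$ if and only if $\Sigma$ satisfies Hypothesis H.
   Context: A cluster picture $(\Sigma,X,d)$ consists of a finite set $X$, a collection $\Sigma$ of nonempty subsets of $X$ (clusters), and a depth $d_{\mathfrak{s}}\in\mathbb{Q}$ for each $\mathfrak{s}\in\Sigma$ with $|\mathfrak{s}|>1$ (proper clusters), such that every singleton and $X$ are clusters, two clusters are disjoint or nested, and $d_{\mathfrak{t}}>d_{\mathfrak{s}}$ whenever $\mathfrak{t}\subsetneq\mathfrak{s}$. Isomorphism of cluster pictures: a bijection $X\to X'$ inducing a bijection $\Sigma\to\Sigma'$ preserving depths. For squarefree $f\in K[x]$ with roots $\mathcal{R}\subset\overline{K}$, $\Sigma_f$ is the cluster picture on $X=\mathcal{R}$ whose clusters are the nonempty sets $\mathcal{R}\cap\{x:v(x-z)\ge \delta\}$ ($z\in\overline K$, $\delta\in\mathbb{Q}$), with depth $\min_{r,r'\in\mathfrak{s}}v(r-r')$, where $v$ is the valuation on $\overline{K}$ with $v(K^\times)=\mathbb{Z}$. $\Sigma$ is of polynomial type over $K$ if $\Sigma\cong\Sigma_f$ for some squarefree $f\in K[x]$. A child of $\mathfrak{s}$ is a maximal cluster properly contained in $\mathfrak{s}$. $\operatorname{denom}(a/b)=b$ for $\gcd(a,b)=1$, $b>0$. Hypothesis H: there is $c\in\operatorname{Sym}(X)$ inducing an automorphism of $\Sigma$ such that, with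 $C=\langle c\rangle$ and calling a child of $\mathfrak{s}$ an orphan of $\mathfrak{s}$ if it is the unique child of $\mathfrak{s}$ fixed by $\operatorname{Stab}_C(\mathfrak{s})$: (1) for every proper cluster $\mathfrak{s}$, the orbits of the non-orphan children of $\mathfrak{s}$ under $\operatorname{Stab}_C(\mathfrak{s})$ all have length $\operatorname{denom}(d_{\mathfrak{s}}[C:\operatorname{Stab}_C(\mathfrak{s})])$; (2) for every $\mathfrak{s}\in\Sigma$, $[C:\operatorname{Stab}_C(\mathfrak{s})]=\operatorname{lcm}_{\mathfrak{s}\subsetneq\mathfrak{s}'}\operatorname{denom} d^*_{\mathfrak{s}'}$, where $d^*_{\mathfrak{s}'}=1$ if the child of $\mathfrak{s}'$ containing $\mathfrak{s}$ is an orphan of $\mathfrak{s}'$ and $d^*_{\mathfrak{s}'}=d_{\mathfrak{s}'}$ otherwise (empty $\operatorname{lcm}=1$). *)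

theory Defs
  imports
    "HOL-Algebra.Algebraic_Closure_Type"
    "HOL-Algebra.Embedded_Algebras"
    "HOL-Algebra.QuotRing"
    "HOL-Algebra.Group_Action"
    "HOL-Computational_Algebra.Squarefree"
begin

section \<open>Finite extensions of the p-adic numbers\<close>

definition padic_abs :: "nat \<Rightarrow> rat \<Rightarrow> real" where
  "padic_abs p x = (if x = 0 then 0 else
     case quotient_of x of (a, b) \<Rightarrow>
       real p powi (int (multiplicity (int p) b) - int (multiplicity (int p) a)))"

definition padic_Cauchy :: "nat \<Rightarrow> (nat \<Rightarrow> rat) \<Rightarrow> bool" where
  "padic_Cauchy p a \<longleftrightarrow> (\<forall>e>0. \<exists>N. \<forall>m\<ge>N. \<forall>n\<ge>N. padic_abs p (a m - a n) < e)"

definition padic_null :: "nat \<Rightarrow> (nat \<Rightarrow> rat) \<Rightarrow> bool" where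
  "padic_null p a \<longleftrightarrow> (\<lambda>n. padic_abs p (a n)) \<longlonglongrightarrow> 0"

definition padic_Cauchy_ring :: "nat \<Rightarrow> (nat \<Rightarrow> rat) ring" where
  "padic_Cauchy_ring p =
     \<lparr>carrier = {a. padic_Cauchy p a},
      monoid.mult = (\<lambda>a b n. a n * b n), one = (\<lambda>n. 1),
      ring.zero = (\<lambda>n. 0), add = (\<lambda>a b n. a n + b n)\<rparr>"

text \<open>The completion of the rationals with respect to the p-adic absolute value:
  Cauchy sequences modulo null sequences.\<close>

definition Qp :: "nat \<Rightarrow> (nat \<Rightarrow> rat) set ring" where
  "Qp p = padic_Cauchy_ring p Quot {a. padic_null p a}"

definition finite_extension_of_Qp :: "nat \<Rightarrow> 'k::field itself \<Rightarrow> bool" where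
  "finite_extension_of_Qp p _ \<longleftrightarrow>
     (\<exists>h \<in> ring_hom (Qp p) (ring_of_type_algebra :: 'k ring).
        ring.finite_dimension (ring_of_type_algebra :: 'k ring) (h ` carrier (Qp p)) UNIV)"

text \<open>A rank one valuation with values in the rationals (enough for an algebraic closure of a
  discretely valued field). The value at 0 should be infinite; it is left unspecified here and
  never used.\<close>

definition valuation :: "('a::field \<Rightarrow> rat) \<Rightarrow> bool" where
  "valuation v \<longleftrightarrow>
     (\<forall>x y. x \<noteq> 0 \<longrightarrow> y \<noteq> 0 \<longrightarrow> v (x * y) = v x + v y) \<and>
     (\<forall>x y. x \<noteq> 0 \<longrightarrow> y \<noteq> 0 \<longrightarrow> x + y \<noteq> 0 \<longrightarrow> min (v x) (v y) \<le> v (x + y))"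

definition normalised_valuation :: "('k::field alg_closure \<Rightarrow> rat) \<Rightarrow> bool" where
  "normalised_valuation v \<longleftrightarrow> valuation v \<and> (\<lambda>x. v (to_ac x)) ` (UNIV - {0}) = \<int>"


section \<open>Cluster pictures\<close>

locale cluster_picture =
  fixes \<X> :: "'x set" and \<Sigma> :: "'x set set" and d :: "'x set \<Rightarrow> rat"
    \<comment> \<open>\<open>d\<close> is only meaningful on proper clusters\<close>
  assumes finite_X: "finite \<X>"
    and clusters_subset: "s \<in> \<Sigma> \<Longrightarrow> s \<subseteq> \<X>"
    and clusters_nonempty: "s \<in> \<Sigma> \<Longrightarrow> s \<noteq> {}"
    and singletons: "x \<in> \<X> \<Longrightarrow> {x} \<in> \<Sigma>"
    and X_cluster: "\<X> \<in> \<Sigma>"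
    and disjoint_or_nested: "s \<in> \<Sigma> \<Longrightarrow> t \<in> \<Sigma> \<Longrightarrow> s \<inter> t = {} \<or> s \<subseteq> t \<or> t \<subseteq> s"
    and depth_less: "s \<in> \<Sigma> \<Longrightarrow> t \<in> \<Sigma> \<Longrightarrow> card t > 1 \<Longrightarrow> t \<subset> s \<Longrightarrow> d s < d t"

definition cluster_iso_by ::
  "('x \<Rightarrow> 'y) \<Rightarrow> 'x set \<Rightarrow> 'x set set \<Rightarrow> ('x set \<Rightarrow> rat) \<Rightarrow>
   'y set \<Rightarrow> 'y set set \<Rightarrow> ('y set \<Rightarrow> rat) \<Rightarrow> bool" where
  "cluster_iso_by \<phi> \<X> \<Sigma> d \<X>' \<Sigma>' d' \<longleftrightarrow>
     bij_betw \<phi> \<X> \<X>' \<and> bij_betw (image \<phi>) \<Sigma> \<Sigma>' \<and>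
     (\<forall>s\<in>\<Sigma>. card s > 1 \<longrightarrow> d' (\<phi> ` s) = d s)"

definition cluster_iso ::
  "'x set \<Rightarrow> 'x set set \<Rightarrow> ('x set \<Rightarrow> rat) \<Rightarrow>
   'y set \<Rightarrow> 'y set set \<Rightarrow> ('y set \<Rightarrow> rat) \<Rightarrow> bool" where
  "cluster_iso \<X> \<Sigma> d \<X>' \<Sigma>' d' \<longleftrightarrow> (\<exists>\<phi>. cluster_iso_by \<phi> \<X> \<Sigma> d \<X>' \<Sigma>' d')"

definition roots_ac :: "'k::field poly \<Rightarrow> 'k alg_closure set" where
  "roots_ac f = {x. poly (map_poly to_ac f) x = 0}"

text \<open>The disjunct \<open>x = z\<close> accounts for the value of \<open>v\<close> at 0 being infinite.\<close>

definition clusters_of :: "('a::field \<Rightarrow> rat) \<Rightarrow> 'a set \<Rightarrow> 'a set set" where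
  "clusters_of v R = {s. s \<noteq> {} \<and> (\<exists>z \<delta>. s = R \<inter> {x. x = z \<or> v (x - z) \<ge> \<delta>})}"

definition depth_of :: "('a::field \<Rightarrow> rat) \<Rightarrow> 'a set \<Rightarrow> rat" where
  "depth_of v s = Min {v (r - r') | r r'. r \<in> s \<and> r' \<in> s \<and> r \<noteq> r'}"

definition polynomial_type ::
  "('k::field alg_closure \<Rightarrow> rat) \<Rightarrow> 'x set \<Rightarrow> 'x set set \<Rightarrow> ('x set \<Rightarrow> rat) \<Rightarrow> bool" where
  "polynomial_type v \<X> \<Sigma> d \<longleftrightarrow>
     (\<exists>f :: 'k poly. squarefree f \<and>
        cluster_iso \<X> \<Sigma> d (roots_ac f) (clusters_of v (roots_ac f)) (depth_of v))"


section \<open>Hypothesis H\<close>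

definition denom :: "rat \<Rightarrow> nat" where
  "denom q = nat (snd (quotient_of q))"

definition is_child :: "'x set set \<Rightarrow> 'x set \<Rightarrow> 'x set \<Rightarrow> bool" where
  "is_child \<Sigma> t s \<longleftrightarrow> t \<in> \<Sigma> \<and> t \<subset> s \<and> \<not> (\<exists>u\<in>\<Sigma>. t \<subset> u \<and> u \<subset> s)"

definition cyclic_group :: "'x set \<Rightarrow> ('x \<Rightarrow> 'x) \<Rightarrow> ('x \<Rightarrow> 'x) monoid" where
  "cyclic_group \<X> c = (BijGroup \<X>)\<lparr>carrier := generate (BijGroup \<X>) {c}\<rparr>"

text \<open>In the following, \<open>C\<close> is a group of permutations of \<open>\<X>\<close>; it acts on subsets of \<open>\<X>\<close> by
  taking images.\<close>

definition cluster_stab :: "('x \<Rightarrow> 'x) monoid \<Rightarrow> 'x set \<Rightarrow> ('x \<Rightarrow> 'x) set" where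
  "cluster_stab C s = stabilizer C image s"

definition stab_index :: "('x \<Rightarrow> 'x) monoid \<Rightarrow> 'x set \<Rightarrow> nat" where
  "stab_index C s = card (rcosets\<^bsub>C\<^esub> (cluster_stab C s))"

definition is_orphan :: "('x \<Rightarrow> 'x) monoid \<Rightarrow> 'x set set \<Rightarrow> 'x set \<Rightarrow> 'x set \<Rightarrow> bool" where
  "is_orphan C \<Sigma> t s \<longleftrightarrow>
     {u. is_child \<Sigma> u s \<and> (\<forall>g\<in>cluster_stab C s. g ` u = u)} = {t}"

definition depth_star ::
  "('x \<Rightarrow> 'x) monoid \<Rightarrow> 'x set set \<Rightarrow> ('x set \<Rightarrow> rat) \<Rightarrow> 'x set \<Rightarrow> 'x set \<Rightarrow> rat" where
  "depth_star C \<Sigma> d s s' =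
     (if is_orphan C \<Sigma> (THE t. is_child \<Sigma> t s' \<and> s \<subseteq> t) s' then 1 else d s')"

definition hypothesis_H :: "'x set \<Rightarrow> 'x set set \<Rightarrow> ('x set \<Rightarrow> rat) \<Rightarrow> bool" where
  "hypothesis_H \<X> \<Sigma> d \<longleftrightarrow>
     (\<exists>c \<in> carrier (BijGroup \<X>). cluster_iso_by c \<X> \<Sigma> d \<X> \<Sigma> d \<and>
        (let C = cyclic_group \<X> c in
          (\<forall>s\<in>\<Sigma>. card s > 1 \<longrightarrow>
             (\<forall>t. is_child \<Sigma> t s \<and> \<not> is_orphan C \<Sigma> t s \<longrightarrow>
                card (orbit (C\<lparr>carrier := cluster_stab C s\<rparr>) image t)
                  = denom (d s * of_nat (stab_index C s)))) \<and>
          (\<forall>s\<in>\<Sigma>. stab_index C s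
             = Lcm {denom (depth_star C \<Sigma> d s s') | s'. s' \<in> \<Sigma> \<and> s \<subset> s'})))"

end

theory Submission
  imports Defs "HOL-Number_Theory.Residue_Primitive_Roots"
begin

text \<open>Let \<open>\<Omega>\<close> be the algebraic closure of \<open>K\<close>. Compactness of the p-adic integers shows that
  conjugates over \<open>K\<close> have equal values. In \<open>\<Omega>\<close> choose a maximal subring \<open>F\<close> containing \<open>K\<close> whose
  values are integers; its residue field is algebraically closed, and an element of degree less
  than \<open>p\<close> lies in \<open>F(\<theta>)\<close> for some \<open>\<theta> ^ N = \<pi>\<close> with \<open>p\<close> not dividing \<open>N\<close>, because a nonzero element of
  trace zero cannot be congruent to all its conjugates. The substitution \<open>\<theta> \<mapsto> \<zeta> * \<theta>\<close> permutes the
  roots of a polynomial of degree less than \<open>p\<close>; measuring the roots in a cluster from their centre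
  of mass gives the orbit lengths in Hypothesis H, and the index formula is a formal consequence.

  Conversely, given \<open>c\<close>, attach to \<open>x\<close> the root
  \<open>\<Sum>s. b (child of s containing x) * (\<zeta> ^ k x * \<omega>) ^ (N * d s)\<close>, summed over the proper clusters
  \<open>s\<close> containing \<open>x\<close>, where \<open>\<omega> ^ N = \<pi>\<close>, the integers \<open>b\<close> are constant on \<open>c\<close>-orbits and vanish on
  orphans, and \<open>k\<close> is a clock advanced by \<open>c\<close>. The roots attached to one \<open>c\<close>-orbit are the values of a single
  polynomial over \<open>K\<close> at roots of \<open>\<pi>\<close>, hence the roots of a polynomial over \<open>K\<close>.\<close>

section \<open>Valuations\<close>

text \<open>The valuation is known only through its values on \<open>K\<close>, which are exactly
  the integers; neither its relation to \<open>p\<close> nor its invariance under conjugation is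
  given. Both come from completeness: a one-unit has \<open>m\<close>-th roots for all
  \<open>m\<close> prime to \<open>p\<close>, and a primitive integral polynomial of degree below
  that of \<alpha> has bounded value at \<alpha>. Invariance then stands in for Hensel's lemma:
  roots of unity of order prime to \<open>p\<close> lie in \<open>F\<close> because a second
  conjugate is impossible.

  The bound \<open>card \<X> < p\<close> enters in several ways. It makes the degrees in the trace
  argument and the cluster sizes in the centres of mass units; it makes \<open>(p - 1)!\<close> a
  root index prime to \<open>p\<close> that every orbit length divides; and it leaves enough labels.
  Children of a cluster in different orbits are compared up to an \<open>n\<close>-th root of unity,
  so their labels need distinct \<open>n\<close>-th powers modulo \<open>p\<close>. Powers of a
  primitive root have them as long as \<open>n\<close> times the number of orbits is at most
  \<open>p - 1\<close>.\<close>

locale valued_field =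
  fixes v :: "'a::field \<Rightarrow> rat"
  assumes val: "valuation v"
begin

text \<open>Comparisons with the convention that the value of \<open>0\<close> is infinite.\<close>

definition vge :: "rat \<Rightarrow> 'a \<Rightarrow> bool" where "vge q x \<longleftrightarrow> x = 0 \<or> q \<le> v x"
definition vgt :: "rat \<Rightarrow> 'a \<Rightarrow> bool" where "vgt q x \<longleftrightarrow> x = 0 \<or> q < v x"

lemma v_mult: "x \<noteq> 0 \<Longrightarrow> y \<noteq> 0 \<Longrightarrow> v (x * y) = v x + v y"
  using val by (simp add: valuation_def)

lemma v_add: "x \<noteq> 0 \<Longrightarrow> y \<noteq> 0 \<Longrightarrow> x + y \<noteq> 0 \<Longrightarrow> min (v x) (v y) \<le> v (x + y)"
  using val by (simp add: valuation_def)

lemma v_one [simp]: "v 1 = 0"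
  using v_mult[of 1 1] by simp

lemma v_neg_one [simp]: "v (- 1) = 0"
  using v_mult[of "-1" "-1"] by simp

lemma v_minus [simp]: "v (- x) = v x"
proof (cases "x = 0")
  case False
  then show ?thesis using v_mult[of "-1" x] by simp
qed simp

lemma v_diff_commute: "v (x - y) = v (y - x)"
  using v_minus[of "x - y"] by simp

lemma v_inverse: "x \<noteq> 0 \<Longrightarrow> v (inverse x) = - v x"
  using v_mult[of x "inverse x"] by simp

lemma v_divide: "x \<noteq> 0 \<Longrightarrow> y \<noteq> 0 \<Longrightarrow> v (x / y) = v x - v y"
  using v_mult[of x "inverse y"] v_inverse[of y] by (simp add: divide_inverse)

lemma v_power: "x \<noteq> 0 \<Longrightarrow> v (x ^ n) = of_nat n * v x"
  by (induction n) (auto simp: v_mult algebra_simps)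

lemma v_powi: "x \<noteq> 0 \<Longrightarrow> v (x powi n) = of_int n * v x"
  by (auto simp: power_int_def v_power v_inverse power_inverse)

lemma vge_0 [simp]: "vge q 0" and vgt_0 [simp]: "vgt q 0"
  by (auto simp: vge_def vgt_def)

lemma vge_1 [simp]: "vge 0 1"
  by (auto simp: vge_def)

lemma vge_mono: "vge q x \<Longrightarrow> q' \<le> q \<Longrightarrow> vge q' x"
  by (auto simp: vge_def)

lemma vgt_imp_vge: "vgt q x \<Longrightarrow> vge q x"
  by (auto simp: vge_def vgt_def)

lemma vge_imp_vgt: "vge q x \<Longrightarrow> q' < q \<Longrightarrow> vgt q' x"
  by (auto simp: vge_def vgt_def)

lemma vge_minus [simp]: "vge q (- x) = vge q x" and vgt_minus [simp]: "vgt q (- x) = vgt q x"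
  by (auto simp: vge_def vgt_def)

lemma vge_add: "vge q x \<Longrightarrow> vge q y \<Longrightarrow> vge q (x + y)"
  unfolding vge_def using v_add[of x y] by (metis add_0 add.right_neutral min_le_iff_disj order_trans)

lemma vgt_add: "vgt q x \<Longrightarrow> vgt q y \<Longrightarrow> vgt q (x + y)"
  unfolding vgt_def using v_add[of x y] by (metis add_0 add.right_neutral min_def order_less_le_trans)

lemma vge_diff: "vge q x \<Longrightarrow> vge q y \<Longrightarrow> vge q (x - y)"
  using vge_add[of q x "- y"] by simp

lemma vgt_diff: "vgt q x \<Longrightarrow> vgt q y \<Longrightarrow> vgt q (x - y)"
  using vgt_add[of q x "- y"] by simp

lemma vgt_diff_commute: "vgt q (x - y) = vgt q (y - x)"
  using vgt_minus[of q "x - y"] by simp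

lemma vge_sum: "(\<And>i. i \<in> A \<Longrightarrow> vge q (x i)) \<Longrightarrow> vge q (\<Sum>i\<in>A. x i)"
  by (induction A rule: infinite_finite_induct) (auto intro: vge_add)

lemma vgt_sum: "(\<And>i. i \<in> A \<Longrightarrow> vgt q (x i)) \<Longrightarrow> vgt q (\<Sum>i\<in>A. x i)"
  by (induction A rule: infinite_finite_induct) (auto intro: vgt_add)

lemma vge_mult: "vge q x \<Longrightarrow> vge r y \<Longrightarrow> vge (q + r) (x * y)"
  unfolding vge_def using v_mult[of x y] by (cases "x = 0"; cases "y = 0") auto

lemma vgt_mult: "vge q x \<Longrightarrow> vgt r y \<Longrightarrow> vgt (q + r) (x * y)"
  unfolding vge_def vgt_def using v_mult[of x y] by (cases "x = 0"; cases "y = 0") auto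

lemma vge_mult_0: "vge 0 x \<Longrightarrow> vge q y \<Longrightarrow> vge q (x * y)"
  using vge_mult[of 0 x q y] by simp

lemma vgt_mult_0: "vge 0 x \<Longrightarrow> vgt q y \<Longrightarrow> vgt q (x * y)"
  using vgt_mult[of 0 x q y] by simp

lemma vge_power: "vge 0 x \<Longrightarrow> vge 0 (x ^ n)"
  by (induction n) (auto intro: vge_mult_0)

lemma vge_of_nat: "vge 0 (of_nat n)"
  by (induction n) (auto intro: vge_add)

lemma vge_self [simp]: "vge (v x) x"
  by (simp add: vge_def)

lemma not_vgt_self: "x \<noteq> 0 \<Longrightarrow> \<not> vgt (v x) x"
  by (simp add: vgt_def)

text \<open>If \<open>x + y\<close> had value above \<open>v x\<close>, subtracting \<open>y\<close>
  would give \<open>x\<close> itself a value above \<open>v x\<close>.\<close>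

lemma dominant_add:
  assumes "x \<noteq> 0" "vgt (v x) y"
  shows "x + y \<noteq> 0" "v (x + y) = v x"
proof -
  show *: "x + y \<noteq> 0"
    using assms by (auto simp: vgt_def add_eq_0_iff)
  have "vge (v x) (x + y)"
    by (rule vge_add) (use assms vgt_imp_vge in auto)
  moreover have "\<not> vgt (v x) (x + y)"
    using vgt_diff[of "v x" "x + y" y] assms not_vgt_self by auto
  ultimately show "v (x + y) = v x"
    using * by (auto simp: vge_def vgt_def)
qed

lemma dominant_sum:
  assumes "finite A" "i \<in> A" "x i \<noteq> 0" "\<And>j. j \<in> A \<Longrightarrow> j \<noteq> i \<Longrightarrow> vgt (v (x i)) (x j)"
  shows "(\<Sum>j\<in>A. x j) \<noteq> 0" "v (\<Sum>j\<in>A. x j) = v (x i)"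
proof -
  have "(\<Sum>j\<in>A. x j) = x i + (\<Sum>j\<in>A-{i}. x j)"
    using assms by (simp add: sum.remove)
  moreover have "vgt (v (x i)) (\<Sum>j\<in>A-{i}. x j)"
    by (rule vgt_sum) (use assms in auto)
  ultimately show "(\<Sum>j\<in>A. x j) \<noteq> 0" "v (\<Sum>j\<in>A. x j) = v (x i)"
    using dominant_add[of "x i"] assms by auto
qed

text \<open>The smallest value occurs only once, so that term dominates all others. This gives the
  independence of powers of a ramified element, and later a contradiction from an algebraic relation
  whose terms all have different values.\<close>

lemma distinct_sum:
  assumes "finite A" "i \<in> A" "x i \<noteq> 0"
    and "inj_on (\<lambda>i. v (x i)) {i\<in>A. x i \<noteq> 0}"
  shows "(\<Sum>j\<in>A. x j) \<noteq> 0"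
    and "\<exists>i\<in>A. x i \<noteq> 0 \<and> v (\<Sum>j\<in>A. x j) = v (x i) \<and> (\<forall>j\<in>A. vge (v (x i)) (x j))"
proof -
  let ?B = "{i\<in>A. x i \<noteq> 0}"
  have "finite ?B" "?B \<noteq> {}" using assms by auto
  then obtain m where m: "m \<in> ?B" "\<And>j. j \<in> ?B \<Longrightarrow> v (x m) \<le> v (x j)"
    using arg_min_if_finite(1)[of ?B "\<lambda>i. v (x i)"] arg_min_least[of ?B _ "\<lambda>i. v (x i)"] by blast
  have *: "vgt (v (x m)) (x j)" if "j \<in> A" "j \<noteq> m" for j
  proof (cases "x j = 0")
    case False
    then have "v (x m) \<le> v (x j)" "v (x m) \<noteq> v (x j)"
      using m that inj_onD[OF assms(4), of m j] by auto
    then show ?thesis by (simp add: vgt_def)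
  qed simp
  show "(\<Sum>j\<in>A. x j) \<noteq> 0"
    using dominant_sum(1)[OF assms(1), of m x] m * by auto
  have "v (\<Sum>j\<in>A. x j) = v (x m)"
    using dominant_sum(2)[OF assms(1), of m x] m * by auto
  then show "\<exists>i\<in>A. x i \<noteq> 0 \<and> v (\<Sum>j\<in>A. x j) = v (x i) \<and> (\<forall>j\<in>A. vge (v (x i)) (x j))"
    using m by (auto simp: vge_def)
qed

lemma vge_poly:
  assumes "\<And>i. vge 0 (coeff P i)" "vge 0 x"
  shows "vge 0 (poly P x)"
  unfolding poly_altdef by (intro vge_sum vge_mult_0 vge_power assms)

lemma vgt_poly:
  assumes "\<And>i. vgt 0 (coeff P i)" "vge 0 x"
  shows "vgt 0 (poly P x)"
  unfolding poly_altdef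
  by (intro vgt_sum) (metis assms vge_power vgt_mult_0 mult.commute)

end

section \<open>Polynomials over subrings\<close>

text \<open>All fields in the argument are subsets of one ambient field. Polynomials stay over the
  ambient type, with \<open>cf\<close> restricting their coefficients, so that roots and values over
  different fields are compared without embeddings.\<close>

definition sub_ring :: "'a::field set \<Rightarrow> bool" where
  "sub_ring S \<longleftrightarrow> 1 \<in> S \<and> (\<forall>x\<in>S. \<forall>y\<in>S. x - y \<in> S \<and> x * y \<in> S)"

definition sub_field :: "'a::field set \<Rightarrow> bool" where
  "sub_field S \<longleftrightarrow> sub_ring S \<and> (\<forall>x\<in>S. inverse x \<in> S)"

definition cf :: "'a::field set \<Rightarrow> 'a poly \<Rightarrow> bool" where
  "cf S P \<longleftrightarrow> (\<forall>i. coeff P i \<in> S)"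

lemma sub_field_imp_sub_ring: "sub_field S \<Longrightarrow> sub_ring S"
  by (simp add: sub_field_def)

lemma sub_ringD:
  assumes "sub_ring S"
  shows "1 \<in> S" "0 \<in> S" "x \<in> S \<Longrightarrow> y \<in> S \<Longrightarrow> x - y \<in> S" "x \<in> S \<Longrightarrow> y \<in> S \<Longrightarrow> x * y \<in> S"
    "x \<in> S \<Longrightarrow> - x \<in> S" "x \<in> S \<Longrightarrow> y \<in> S \<Longrightarrow> x + y \<in> S"
proof -
  have 1: "1 \<in> S" and d: "\<And>x y. x \<in> S \<Longrightarrow> y \<in> S \<Longrightarrow> x - y \<in> S"
    using assms by (auto simp: sub_ring_def)
  then have 0: "0 \<in> S" using d[of 1 1] by simp
  have m: "\<And>x. x \<in> S \<Longrightarrow> - x \<in> S" using d[OF 0] by simp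
  have a: "\<And>x y. x \<in> S \<Longrightarrow> y \<in> S \<Longrightarrow> x + y \<in> S"
    using d m by (metis diff_minus_eq_add)
  show "1 \<in> S" "0 \<in> S" "x \<in> S \<Longrightarrow> y \<in> S \<Longrightarrow> x - y \<in> S" "x \<in> S \<Longrightarrow> y \<in> S \<Longrightarrow> x * y \<in> S"
    "x \<in> S \<Longrightarrow> - x \<in> S" "x \<in> S \<Longrightarrow> y \<in> S \<Longrightarrow> x + y \<in> S"
    using 1 d 0 m a assms by (auto simp: sub_ring_def)
qed

lemma sub_ring_sum: "sub_ring S \<Longrightarrow> (\<And>i. i \<in> A \<Longrightarrow> f i \<in> S) \<Longrightarrow> (\<Sum>i\<in>A. f i) \<in> S"
  by (induction A rule: infinite_finite_induct) (auto intro: sub_ringD)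

lemma sub_ring_power: "sub_ring S \<Longrightarrow> x \<in> S \<Longrightarrow> x ^ n \<in> S"
  by (induction n) (auto intro: sub_ringD)

lemma sub_ring_of_nat: "sub_ring S \<Longrightarrow> of_nat n \<in> S"
  by (induction n) (auto intro: sub_ringD)

lemma sub_ring_of_int: "sub_ring S \<Longrightarrow> of_int n \<in> S"
  by (cases n) (auto intro: sub_ring_of_nat sub_ringD simp del: of_nat_Suc)

lemma sub_field_divide: "sub_field S \<Longrightarrow> x \<in> S \<Longrightarrow> y \<in> S \<Longrightarrow> x / y \<in> S"
  by (auto simp: sub_field_def divide_inverse intro: sub_ringD)

lemma sub_field_powi: "sub_field S \<Longrightarrow> x \<in> S \<Longrightarrow> x powi n \<in> S"
  by (auto simp: power_int_def sub_field_def intro: sub_ring_power)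

lemma cf_subset: "S \<subseteq> T \<Longrightarrow> cf S P \<Longrightarrow> cf T P"
  by (auto simp: cf_def)

lemma poly_in: "sub_ring S \<Longrightarrow> cf S P \<Longrightarrow> x \<in> S \<Longrightarrow> poly P x \<in> S"
  unfolding poly_altdef cf_def by (intro sub_ring_sum sub_ringD sub_ring_power) auto

context
  fixes S :: "'a::field set"
  assumes S: "sub_ring S"
begin

lemma cf_0 [simp]: "cf S 0" using S by (auto simp: cf_def intro: sub_ringD)
lemma cf_1 [simp]: "cf S 1" using S by (auto simp: cf_def intro: sub_ringD)
lemma cf_add: "cf S P \<Longrightarrow> cf S Q \<Longrightarrow> cf S (P + Q)" using S by (auto simp: cf_def intro: sub_ringD)
lemma cf_diff: "cf S P \<Longrightarrow> cf S Q \<Longrightarrow> cf S (P - Q)" using S by (auto simp: cf_def intro: sub_ringD)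
lemma cf_smult: "c \<in> S \<Longrightarrow> cf S Q \<Longrightarrow> cf S (smult c Q)" using S by (auto simp: cf_def intro: sub_ringD)
lemma cf_monom: "c \<in> S \<Longrightarrow> cf S (monom c n)" using S by (auto simp: cf_def intro: sub_ringD)
lemma cf_pCons: "c \<in> S \<Longrightarrow> cf S P \<Longrightarrow> cf S (pCons c P)"
  using S by (auto simp: cf_def coeff_pCons split: nat.splits)
lemma cf_mult: "cf S P \<Longrightarrow> cf S Q \<Longrightarrow> cf S (P * Q)"
  using S by (auto simp: cf_def coeff_mult intro!: sub_ringD sub_ring_sum)
lemma cf_sum: "(\<And>i. i \<in> A \<Longrightarrow> cf S (P i)) \<Longrightarrow> cf S (\<Sum>i\<in>A. P i)"
  by (induction A rule: infinite_finite_induct) (auto intro: cf_add)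
lemma cf_power: "cf S P \<Longrightarrow> cf S (P ^ n)"
  by (induction n) (auto intro: cf_mult)
lemma cf_pderiv: "cf S P \<Longrightarrow> cf S (pderiv P)"
  using S sub_ring_of_nat[OF S] by (auto simp: cf_def coeff_pderiv simp del: of_nat_Suc intro!: sub_ringD)
lemma cf_pcompose: "cf S P \<Longrightarrow> cf S Q \<Longrightarrow> cf S (pcompose P Q)"
proof (induction P)
  case (pCons a P)
  have "a \<in> S" "cf S P"
    using pCons.prems(1) by (auto simp: cf_def coeff_pCons split: nat.splits)
  then show ?case
    using pCons by (auto simp: pcompose_pCons intro!: cf_add cf_mult cf_pCons)
qed auto

text \<open>Long division by a monic divisor never divides by a coefficient, so quotient and
  remainder stay over \<open>S\<close>.\<close>

lemma monic_division:
  assumes g: "cf S g" "lead_coeff g = 1" "degree g > 0" and P: "cf S P"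
  shows "\<exists>q r. cf S q \<and> cf S r \<and> P = q * g + r \<and> degree r < degree g"
  using P
proof (induction "degree P" arbitrary: P rule: less_induct)
  case less
  show ?case
  proof (cases "degree P < degree g")
    case True
    then show ?thesis
      using less.prems by (intro exI[of _ 0] exI[of _ P]) auto
  next
    case False
    define h where "h = monom (lead_coeff P) (degree P - degree g)"
    have cfh: "cf S h" unfolding h_def
      using less.prems by (intro cf_monom) (auto simp: cf_def)
    have P0: "P \<noteq> 0" "g \<noteq> 0" using False g by auto
    have degh: "degree (h * g) = degree P"
      using P0 False by (simp add: h_def degree_mult_eq degree_monom_eq monom_eq_0_iff)
    have lc: "lead_coeff (h * g) = lead_coeff P"
      using g P0 unfolding lead_coeff_mult h_def by (simp add: degree_monom_eq)
    have "degree (P - h * g) < degree P"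
    proof (rule le_neq_implies_less)
      show "degree (P - h * g) \<le> degree P"
        using degh by (intro degree_diff_le) auto
      show "degree (P - h * g) \<noteq> degree P"
      proof
        assume a: "degree (P - h * g) = degree P"
        have "coeff (P - h * g) (degree P) = 0" using lc degh by simp
        then have "P - h * g = 0" using a by (metis leading_coeff_0_iff)
        then show False using a False g by simp
      qed
    qed
    moreover have "cf S (P - h * g)" using less.prems g cfh by (intro cf_diff cf_mult)
    ultimately obtain q r where "cf S q" "cf S r" "P - h * g = q * g + r" "degree r < degree g"
      using less.hyps by blast
    then show ?thesis
      using cfh by (intro exI[of _ "q + h"] exI[of _ r]) (auto intro: cf_add simp: algebra_simps)
  qed
qed

end

lemma adjoin_sub_ring:
  assumes "sub_ring F"
  shows "sub_ring {poly P x | P. cf F P}" "F \<subseteq> {poly P x | P. cf F P}" "x \<in> {poly P x | P. cf F P}"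
proof -
  show "sub_ring {poly P x | P. cf F P}"
    unfolding sub_ring_def
  proof (intro conjI ballI)
    show "1 \<in> {poly P x | P. cf F P}" using cf_1[OF assms] by (intro CollectI exI[of _ 1]) auto
  next
    fix a b assume "a \<in> {poly P x | P. cf F P}" "b \<in> {poly P x | P. cf F P}"
    then obtain P Q where "a = poly P x" "b = poly Q x" "cf F P" "cf F Q" by blast
    then show "a - b \<in> {poly P x | P. cf F P}" "a * b \<in> {poly P x | P. cf F P}"
      using cf_diff[OF assms, of P Q] cf_mult[OF assms, of P Q]
      by (metis (mono_tags, lifting) mem_Collect_eq poly_diff, metis (mono_tags, lifting) mem_Collect_eq poly_mult)
  qed
  show "F \<subseteq> {poly P x | P. cf F P}"
  proof
    fix a assume "a \<in> F"
    then show "a \<in> {poly P x | P. cf F P}"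
      using assms by (intro CollectI exI[of _ "[:a:]"]) (auto intro!: cf_pCons)
  qed
  show "x \<in> {poly P x | P. cf F P}"
    using assms by (intro CollectI exI[of _ "[:0, 1:]"]) (auto intro!: cf_pCons sub_ringD)
qed

text \<open>Minimality is expressed by degrees instead of irreducibility; with
  \<open>monic_division\<close> this directly yields that \<open>g\<close> divides every polynomial
  over \<open>S\<close> vanishing at \<open>r\<close>.\<close>

definition min_poly :: "'a::field set \<Rightarrow> 'a \<Rightarrow> 'a poly \<Rightarrow> bool" where
  "min_poly S r g \<longleftrightarrow> cf S g \<and> lead_coeff g = 1 \<and> poly g r = 0 \<and>
     (\<forall>P. cf S P \<longrightarrow> P \<noteq> 0 \<longrightarrow> poly P r = 0 \<longrightarrow> degree g \<le> degree P)"

definition algebraic_in :: "'a::field set \<Rightarrow> 'a \<Rightarrow> bool" where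
  "algebraic_in S r \<longleftrightarrow> (\<exists>P. cf S P \<and> P \<noteq> 0 \<and> poly P r = 0)"

lemma algebraic_in_mono: "S \<subseteq> T \<Longrightarrow> algebraic_in S r \<Longrightarrow> algebraic_in T r"
  unfolding algebraic_in_def by (meson cf_subset)

lemma min_poly_exists:
  assumes S: "sub_field S" and r: "algebraic_in S r"
  shows "\<exists>g. min_poly S r g"
proof -
  obtain P where P: "cf S P \<and> P \<noteq> 0 \<and> poly P r = 0"
    using r by (auto simp: algebraic_in_def)
  define g where "g = arg_min degree (\<lambda>P. cf S P \<and> P \<noteq> 0 \<and> poly P r = 0)"
  have g: "cf S g \<and> g \<noteq> 0 \<and> poly g r = 0"
    unfolding g_def by (rule arg_min_natI) (rule P)
  have min: "degree g \<le> degree P" if "cf S P" "P \<noteq> 0" "poly P r = 0" for P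
    unfolding g_def by (rule arg_min_nat_le) (use that in auto)
  have "min_poly S r (smult (inverse (lead_coeff g)) g)"
    unfolding min_poly_def
  proof (intro conjI allI impI)
    show "cf S (smult (inverse (lead_coeff g)) g)"
      using S g by (intro cf_smult) (auto simp: sub_field_def cf_def)
  qed (use g min in auto)
  then show ?thesis by blast
qed

lemma min_poly_degree_pos: "min_poly S r g \<Longrightarrow> degree g > 0"
proof (rule ccontr)
  assume g: "min_poly S r g" and "\<not> degree g > 0"
  then obtain c where "g = [:c:]" by (auto elim: degree_eq_zeroE)
  then show False using g by (auto simp: min_poly_def)
qed

lemma min_poly_dvd:
  assumes S: "sub_ring S" and g: "min_poly S r g" and P: "cf S P" "poly P r = 0"
  shows "g dvd P"
proof -
  obtain q s where qs: "cf S q" "cf S s" "P = q * g + s" "degree s < degree g"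
    using monic_division[OF S, of g P] g P min_poly_degree_pos[OF g] by (auto simp: min_poly_def)
  have "poly s r = 0" using qs g P by (simp add: min_poly_def)
  then have "s = 0" using qs g by (auto simp: min_poly_def)
  then show ?thesis using qs by simp
qed

lemma min_poly_root:
  assumes "sub_ring S" "min_poly S r g" "cf S P" "poly P r = 0" "poly g s = 0"
  shows "poly P s = 0"
  using min_poly_dvd[OF assms(1-4)] assms(5) by (auto elim!: dvdE)

text \<open>A relation of least degree for a nonzero \<open>x\<close> has a nonzero constant term
  \<open>a\<close>, so \<open>a + x * poly h x = 0\<close> shows the inverse of \<open>x\<close> as
  a polynomial in \<open>x\<close>. Adjoining an element therefore needs polynomials only, no
  fractions.\<close>

lemma algebraic_sub_ring_is_sub_field:
  assumes K: "\<And>x. algebraic_in K x" and S: "sub_ring S" "K \<subseteq> S" and K': "sub_field K"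
  shows "sub_field S"
  unfolding sub_field_def
proof (intro conjI ballI)
  fix x assume x: "x \<in> S"
  show "inverse x \<in> S"
  proof (cases "x = 0")
    case False
    obtain g where g: "min_poly K x g"
      using min_poly_exists[OF K' K] by blast
    obtain a h where gh: "g = pCons a h" by (cases g)
    have "a \<noteq> 0"
    proof
      assume a: "a = 0"
      then have h: "poly h x = 0" "h \<noteq> 0" "cf K h"
        using g gh False by (auto simp: min_poly_def cf_def coeff_pCons split: nat.splits)
      then have "degree g \<le> degree h" using g by (simp add: min_poly_def)
      then show False using gh h by simp
    qed
    have a: "a \<in> K" and h: "cf K h"
      using g unfolding min_poly_def cf_def gh by (auto simp: coeff_pCons split: nat.splits)
    have "a + x * poly h x = 0" using g gh by (simp add: min_poly_def)
    then have "inverse x = - poly h x / a"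
      using \<open>a \<noteq> 0\<close> False by (simp add: field_simps add_eq_0_iff)
    moreover have "poly h x \<in> S" using poly_in[OF S(1) cf_subset[OF S(2) h] x] .
    moreover have "inverse a \<in> S" using K' a S by (auto simp: sub_field_def)
    ultimately show ?thesis using S by (simp add: divide_inverse sub_ringD)
  qed (use S in \<open>auto intro: sub_ringD\<close>)
qed (fact S)

text \<open>Gaussian elimination by induction on the coordinates: a vector \<open>k\<close> with
  nonzero coordinate \<open>l\<close> clears \<open>l\<close> from all the others, which lowers both
  counts by one and keeps the coefficients in \<open>S\<close>.\<close>

lemma linear_dependence:
  fixes a :: "'i \<Rightarrow> 'j \<Rightarrow> 'a::field"
  assumes S: "sub_field S"
  shows "finite J \<Longrightarrow> finite I \<Longrightarrow> card J < card I \<Longrightarrow> (\<And>i j. a i j \<in> S) \<Longrightarrow>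
    \<exists>c. (\<forall>i. c i \<in> S) \<and> (\<exists>i\<in>I. c i \<noteq> 0) \<and> (\<forall>j\<in>J. (\<Sum>i\<in>I. c i * a i j) = 0)"
proof (induction J arbitrary: I a rule: finite_induct)
  case empty
  then have "I \<noteq> {}" by auto
  then show ?case using S by (intro exI[of _ "\<lambda>_. 1"]) (auto simp: sub_field_def sub_ring_def)
next
  case (insert l J)
  have Sr: "sub_ring S" using S by (simp add: sub_field_def)
  show ?case
  proof (cases "\<forall>i\<in>I. a i l = 0")
    case True
    have "card J < card I" using insert by auto
    from insert.IH[of I a, OF insert.prems(1) this insert.prems(3)]
    obtain c where "(\<forall>i. c i \<in> S) \<and> (\<exists>i\<in>I. c i \<noteq> 0) \<and> (\<forall>j\<in>J. (\<Sum>i\<in>I. c i * a i j) = 0)" by blast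
    then show ?thesis using True by (intro exI[of _ c]) auto
  next
    case False
    then obtain k where k: "k \<in> I" "a k l \<noteq> 0" by blast
    define b where "b = (\<lambda>i j. a i j - a i l / a k l * a k j)"
    have "card J < card (I - {k})" "finite (I - {k})" using insert k by auto
    moreover have "b i j \<in> S" for i j
      unfolding b_def using insert.prems S Sr by (intro sub_ringD sub_field_divide) auto
    ultimately obtain c where c: "\<forall>i. c i \<in> S" "\<exists>i\<in>I-{k}. c i \<noteq> 0"
      "\<forall>j\<in>J. (\<Sum>i\<in>I-{k}. c i * b i j) = 0"
      using insert.IH[of "I - {k}" b] by blast
    \<comment> \<open>The pivot gets the coefficient that turns the combination of the rows
      \<open>a i\<close> into the combination of the cleared rows \<open>b i\<close>, whose
      coordinate \<open>l\<close> vanishes.\<close>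
    define t where "t = - (\<Sum>i\<in>I-{k}. c i * a i l / a k l)"
    have tS: "t \<in> S" unfolding t_def using c insert.prems S Sr
      by (intro sub_ringD sub_ring_sum sub_field_divide) auto
    have sumI: "(\<Sum>i\<in>I. (c(k := t)) i * a i j) = t * a k j + (\<Sum>i\<in>I-{k}. c i * a i j)" for j
      using k insert.prems by (subst sum.remove[of I k]) (auto intro!: sum.cong)
    have "(\<Sum>i\<in>I. (c(k := t)) i * a i j) = (\<Sum>i\<in>I-{k}. c i * b i j)" for j
      unfolding sumI unfolding t_def b_def
      by (simp add: algebra_simps sum_subtractf sum_distrib_left sum_distrib_right sum_divide_distrib)
    moreover have "(\<Sum>i\<in>I-{k}. c i * b i l) = 0"
      using k by (simp add: b_def)
    ultimately show ?thesis using c tS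
      by (intro exI[of _ "c(k := t)"]) auto
  qed
qed

section \<open>Tamely ramified extensions\<close>

lemma coeff_prod_linear_factors:
  "A \<noteq> {#} \<Longrightarrow> coeff (\<Prod>x\<in>#A. [:- x, 1::'a::field:]) (size A - 1) = - sum_mset A"
proof (induction A)
  case (add x A)
  have lc: "coeff (\<Prod>x\<in>#B. [:- x, 1::'a:]) (size B) = 1" for B
  proof -
    have "degree (\<Prod>x\<in>#B. [:- x, 1::'a:]) = size B \<and> lead_coeff (\<Prod>x\<in>#B. [:- x, 1::'a:]) = 1"
    proof (induction B)
      case (add y B)
      let ?Q = "\<Prod>x\<in>#B. [:- x, 1::'a:]"
      have "?Q \<noteq> 0" using add by auto
      then have "degree ([:- y, 1:] * ?Q) = 1 + degree ?Q" by (subst degree_mult_eq) auto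
      moreover have "lead_coeff ([:- y, 1:] * ?Q) = lead_coeff ?Q" by (subst lead_coeff_mult) simp
      moreover have "degree ?Q = size B" "coeff ?Q (size B) = 1" using add by auto
      ultimately show ?case by (simp del: mult_pCons_left)
    qed simp
    then show ?thesis by metis
  qed
  show ?case
  proof (cases "A = {#}")
    case False
    then obtain n where n: "size A = Suc n" by (metis gr0_implies_Suc nonempty_has_size)
    then show ?thesis
      using add.IH[OF False] lc[of A] by (simp add: coeff_pCons)
  qed simp
qed simp

text \<open>Induction on \<open>N\<close>, splitting off a prime \<open>l\<close> with
  \<open>N = l * M\<close>. If \<open>l\<close> divides \<open>M\<close>, an \<open>l\<close>-th
  root of a primitive \<open>M\<close>-th root works. Otherwise a primitive \<open>M\<close>-th root
  is multiplied by a root of \<open>1 + Y + ... + Y ^ (l - 1)\<close>, which differs from 1 because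
  that sum at 1 is \<open>l\<close>, nonzero in characteristic zero.\<close>

lemma primitive_root_of_unity:
  assumes char0: "\<And>n. n > 0 \<Longrightarrow> of_nat n \<noteq> (0::'a::alg_closed_field)" and "N > 0"
  shows "\<exists>\<zeta>::'a. \<forall>j. \<zeta> ^ j = 1 \<longleftrightarrow> N dvd j"
  using assms(2)
proof (induction N rule: less_induct)
  case (less N)
  show ?case
  proof (cases "N = 1")
    case False
    then obtain l where l: "prime l" "l dvd N" using prime_factor_nat by blast
    then obtain M where M: "N = l * M" by (auto elim: dvdE)
    have "M < N" "M > 0" using M less.prems l prime_gt_1_nat[of l] by auto
    then obtain \<omega> :: 'a where \<omega>: "\<And>j. \<omega> ^ j = 1 \<longleftrightarrow> M dvd j" using less.IH by blast
    show ?thesis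
    proof (cases "l dvd M")
      case True
      obtain \<theta> where \<theta>: "\<theta> ^ l = \<omega>" using nth_root_exists[of l \<omega>] l prime_gt_0_nat by blast
      have "\<theta> ^ j = 1 \<longleftrightarrow> N dvd j" for j
      proof
        assume a: "\<theta> ^ j = 1"
        then have "\<omega> ^ j = 1" unfolding \<theta>[symmetric] by (metis mult.commute power_mult power_one)
        then have "l dvd j" using \<omega> True by (meson dvd_trans)
        then obtain i where i: "j = l * i" by (auto elim: dvdE)
        have "\<omega> ^ i = 1" using a \<theta> i by (simp add: power_mult)
        then show "N dvd j" using \<omega> i M by simp
      next
        assume "N dvd j"
        then obtain i where "j = l * (M * i)" using M by (metis dvdE mult.assoc)
        moreover have "\<omega> ^ (M * i) = 1" using \<omega> by simp
        ultimately show "\<theta> ^ j = 1" using \<theta> by (simp add: power_mult)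
      qed
      then show ?thesis by blast
    next
      case False
      define P where "P = (\<Sum>i<l. monom (1::'a) i)"
      have cP: "coeff P i = (if i < l then 1 else 0)" for i
        by (simp add: P_def coeff_sum)
      have dP: "degree P = l - 1"
      proof (rule antisym)
        show "degree P \<le> l - 1" by (rule degree_le) (use cP in auto)
        show "l - 1 \<le> degree P" by (rule le_degree) (use cP l prime_gt_0_nat in auto)
      qed
      have "degree P > 0" using dP prime_gt_1_nat[OF l(1)] by simp
      then obtain \<eta> where "poly P \<eta> = 0" using alg_closed_imp_poly_has_root by blast
      then have \<eta>: "(\<Sum>i<l. \<eta> ^ i) = 0" by (simp add: P_def poly_sum poly_monom)
      then have \<eta>l: "\<eta> ^ l = 1"
        using power_diff_1_eq[of \<eta> l] by simp
      have \<eta>1: "\<eta> \<noteq> 1"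
      proof
        assume "\<eta> = 1"
        then show False using \<eta> char0[of l] l prime_gt_0_nat by simp
      qed
      have \<eta>j: "\<eta> ^ j = 1 \<longleftrightarrow> l dvd j" for j
      proof
        assume a: "\<eta> ^ j = 1"
        show "l dvd j"
        proof (rule ccontr)
          assume "\<not> l dvd j"
          then have co: "coprime j l" using l prime_imp_coprime coprime_commute by blast
          then have "j \<noteq> 0" using l by (intro notI) auto
          then obtain x y where "j * x = l * y + gcd j l" using bezout_nat by blast
          then have "j * x = l * y + 1" using co by simp
          then have "\<eta> ^ (j * x) = \<eta> ^ (l * y) * \<eta>" by simp
          then show False using a \<eta>l \<eta>1 by (simp add: power_mult)
        qed
      qed (use \<eta>l in \<open>auto elim!: dvdE simp: power_mult\<close>)
      have coMl: "coprime M l" using False l prime_imp_coprime coprime_commute by blast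
      have "(\<omega> * \<eta>) ^ j = 1 \<longleftrightarrow> N dvd j" for j
      proof
        assume a: "(\<omega> * \<eta>) ^ j = 1"
        have "(\<omega> * \<eta>) ^ (j * l) = 1" using a by (simp add: power_mult)
        moreover have "\<eta> ^ (j * l) = 1" by (simp add: \<eta>j)
        ultimately have "\<omega> ^ (j * l) = 1" by (simp add: power_mult_distrib)
        then have "M dvd j" using \<omega> coMl by (simp add: coprime_dvd_mult_left_iff)
        moreover from this have "\<omega> ^ j = 1" using \<omega> by simp
        then have "l dvd j" using a \<eta>j by (simp add: power_mult_distrib)
        ultimately show "N dvd j" using coMl M by (simp add: divides_mult mult.commute)
      next
        assume "N dvd j"
        then have "M dvd j" "l dvd j" using M dvd_mult_left dvd_mult_right by blast+
        then have "\<omega> ^ j = 1" "\<eta> ^ j = 1" using \<omega> \<eta>j by blast+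
        then show "(\<omega> * \<eta>) ^ j = 1" by (simp add: power_mult_distrib)
      qed
      then show ?thesis by blast
    qed
  qed (auto intro: exI[of _ 1])
qed

text \<open>The interface between the p-adic part and the tame theory. What completeness contributes
  is \<open>v_conj\<close> and \<open>v_of_nat\<close>; conjugacy is phrased as \<open>y\<close>
  satisfying every polynomial relation of \<open>x\<close> over \<open>K\<close>.\<close>

locale local_closure = valued_field v for v :: "'a::alg_closed_field \<Rightarrow> rat" +
  fixes K :: "'a set" and p :: nat
  assumes prime_p: "prime p"
    and K: "sub_field K"
    and alg: "algebraic_in K x"
    and v_K: "v ` (K - {0}) = \<int>"
    and char0: "n > 0 \<Longrightarrow> of_nat n \<noteq> (0::'a)"
    and v_of_nat: "\<not> p dvd n \<Longrightarrow> v (of_nat n) = 0"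
    and v_conj: "x \<noteq> 0 \<Longrightarrow> y \<noteq> 0 \<Longrightarrow> (\<And>P. cf K P \<Longrightarrow> poly P x = 0 \<Longrightarrow> poly P y = 0) \<Longrightarrow> v x = v y"
begin

lemma not_vgt_of_nat: "\<not> p dvd n \<Longrightarrow> \<not> vgt 0 (of_nat n)"
  using v_of_nat[of n] char0[of n] by (cases "n = 0") (auto simp: vgt_def)

lemma v_of_int:
  assumes "\<not> int p dvd n"
  shows "of_int n \<noteq> (0::'a)" "v (of_int n) = 0"
proof -
  obtain m where m: "n = int m \<or> n = - int m" by (metis int_cases2)
  then have "\<not> p dvd m" using assms by auto
  then have "m > 0" "v (of_nat m) = 0" "of_nat m \<noteq> (0::'a)"
    using v_of_nat[of m] char0[of m] by (cases "m = 0"; simp)+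
  then show "of_int n \<noteq> (0::'a)" "v (of_int n) = 0" using m by auto
qed

lemma vgt_power_diff:
  assumes "vge 0 x" "vge 0 y" "vgt q (x - y)"
  shows "vgt q (x ^ n - y ^ n)"
proof (induction n)
  case (Suc n)
  have "x ^ Suc n - y ^ Suc n = x * (x ^ n - y ^ n) + y ^ n * (x - y)"
    by (simp add: algebra_simps)
  then show ?case using assms Suc by (auto intro!: vgt_add vgt_mult_0 vge_power)
qed simp

lemma vgt_poly_diff:
  assumes "\<And>i. vge 0 (coeff P i)" "vge 0 x" "vge 0 y" "vgt q (x - y)"
  shows "vgt q (poly P x - poly P y)"
proof -
  have "poly P x - poly P y = (\<Sum>i\<le>degree P. coeff P i * (x ^ i - y ^ i))"
    by (simp add: poly_altdef sum_subtractf algebra_simps)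
  then show ?thesis
    using assms by (auto intro!: vgt_sum vgt_mult_0 vgt_power_diff)
qed

lemma v_root_of_unity: "x ^ N = 1 \<Longrightarrow> N > 0 \<Longrightarrow> v x = 0"
  using v_power[of x N] by (cases "x = 0") (auto simp: zero_power)

text \<open>From \<open>1 + x + ... + x ^ (N - 1) = 0\<close>, an \<open>x\<close> close to 1 would
  make \<open>N\<close> small, but \<open>N\<close> is a unit. So distinct roots of unity of order
  prime to \<open>p\<close> lie in distinct residue classes.\<close>

lemma root_of_unity_separated:
  assumes "x ^ N = 1" "\<not> p dvd N" "x \<noteq> 1"
  shows "v (x - 1) = 0"
proof -
  have N: "N > 0" using assms by (intro Nat.gr0I) auto
  have x: "vge 0 x" "x \<noteq> 0" using v_root_of_unity[OF assms(1) N] assms N by (auto simp: vge_def power_0_left)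
  have "(\<Sum>i<N. x ^ i) = 0"
    using power_diff_1_eq[of x N] assms by simp
  then have "of_nat N = - (\<Sum>i<N. x ^ i - 1 ^ i)"
    by (simp add: sum_subtractf)
  moreover have "vgt 0 (\<Sum>i<N. x ^ i - 1 ^ i)" if "vgt 0 (x - 1)"
    by (intro vgt_sum vgt_power_diff) (use that x in auto)
  ultimately have "\<not> vgt 0 (x - 1)"
    using not_vgt_of_nat[OF assms(2)] by (metis vgt_minus)
  moreover have "vge 0 (x - 1)" using x by (intro vge_diff) auto
  ultimately show ?thesis by (auto simp: vge_def vgt_def)
qed

lemma min_poly_exists': "sub_field S \<Longrightarrow> K \<subseteq> S \<Longrightarrow> \<exists>g. min_poly S x g"
  using min_poly_exists[of S x] algebraic_in_mono[OF _ alg] by auto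

lemma sub_ring_imp_sub_field: "sub_ring S \<Longrightarrow> K \<subseteq> S \<Longrightarrow> sub_field S"
  using algebraic_sub_ring_is_sub_field[OF alg _ _ K] by blast

text \<open>Substituting \<open>Y - a\<close> turns a relation of \<open>r - a\<close> over
  \<open>K\<close> into one of \<open>r\<close> over \<open>E\<close>, which \<open>s\<close>
  inherits. Hence all conjugates over \<open>E\<close> have the same distance to a point of
  \<open>E\<close>.\<close>

lemma v_conj_shift:
  assumes E: "sub_ring E" "K \<subseteq> E" and g: "min_poly E r g" "poly g s = 0" and a: "a \<in> E"
  shows "r = a \<longleftrightarrow> s = a" "v (r - a) = v (s - a)"
proof -
  have root: "poly P s = 0" if "cf E P" "poly P r = 0" for P
    using min_poly_root[OF E(1) g(1) that g(2)] .
  have c: "cf E [:- a, 1:]" using E a by (intro cf_pCons cf_0 sub_ringD)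
  show iff: "r = a \<longleftrightarrow> s = a"
  proof
    assume "r = a" then show "s = a" using root[OF c] by simp
  next
    \<comment> \<open>With a root in \<open>E\<close>, the minimal polynomial splits off
      \<open>Y - a\<close> with a quotient over \<open>E\<close>; if \<open>r\<close> were different
      from \<open>a\<close>, the quotient would be a relation of smaller degree for
      \<open>r\<close>.\<close>
    assume s: "s = a"
    then have "[:- a, 1:] dvd g" using g by (simp add: poly_eq_0_iff_dvd)
    then obtain h where h: "g = [:- a, 1:] * h" by (auto elim: dvdE)
    obtain q t where qt: "cf E q" "cf E t" "g = q * [:- a, 1:] + t" "degree t < degree [:- a, 1:]"
      using monic_division[OF E(1) c, of g] g by (auto simp: min_poly_def)
    have "poly t a = 0" using qt(3) h by (metis add_cancel_right_left mult.commute poly_add poly_mult mult_eq_0_iff poly_eq_0_iff_dvd dvd_triv_left)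
    moreover have "degree t = 0" using qt by simp
    ultimately have "t = 0" by (auto elim!: degree_eq_zeroE)
    then have gq: "g = q * [:- a, 1:]" using qt by simp
    show "r = a"
    proof (rule ccontr)
      assume "r \<noteq> a"
      then have "poly q r = 0" using gq g by (simp add: min_poly_def)
      moreover have "q \<noteq> 0" using gq g by (auto simp: min_poly_def)
      ultimately have "degree g \<le> degree q" using qt g by (simp add: min_poly_def)
      moreover have "degree g = degree q + 1"
        unfolding gq using \<open>q \<noteq> 0\<close> by (subst degree_mult_eq) auto
      ultimately show False by simp
    qed
  qed
  show "v (r - a) = v (s - a)"
  proof (cases "r = a")
    case False
    show ?thesis
    proof (rule v_conj)
      fix P assume P: "cf K P" "poly P (r - a) = 0"
      have "cf E (pcompose P [:- a, 1:])"
        using cf_subset[OF E(2) P(1)] c by (intro cf_pcompose E)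
      from root[OF this] show "poly P (s - a) = 0"
        using P by (simp add: poly_pcompose)
    qed (use False iff in auto)
  qed (use iff in auto)
qed

text \<open>The multiset \<open>A\<close> lists the conjugates with multiplicity, so its sum is
  minus the second coefficient of \<open>g\<close>, the trace, and lies in \<open>E\<close>.\<close>

lemma min_poly_factorization:
  fixes E :: "'a set"
  assumes E: "sub_ring E" and g: "min_poly E r g"
  obtains A where "size A = degree g" "\<And>x. x \<in># A \<Longrightarrow> poly g x = 0"
    "\<And>t. poly g t = (\<Prod>x\<in>#A. t - x)" "sum_mset A \<in> E"
proof -
  have g0: "g \<noteq> 0" "lead_coeff g = 1" using g by (auto simp: min_poly_def)
  obtain A where A: "size A = degree g" "g = smult (lead_coeff g) (\<Prod>x\<in>#A. [:- x, 1:])"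
    using alg_closed_imp_factorization[OF g0(1)] by blast
  then have gA: "g = (\<Prod>x\<in>#A. [:- x, 1:])" using g0 by simp
  have val: "poly g t = (\<Prod>x\<in>#A. t - x)" for t
    unfolding gA by (simp add: poly_prod_mset image_mset.compositionality o_def)
  have "A \<noteq> {#}" using A(1) min_poly_degree_pos[OF g] by auto
  then have "coeff g (size A - 1) = - sum_mset A"
    unfolding gA by (rule coeff_prod_linear_factors)
  moreover have "coeff g (size A - 1) \<in> E" using g by (auto simp: min_poly_def cf_def)
  ultimately have "sum_mset A \<in> E" using sub_ringD(5)[OF E] by (metis minus_minus)
  moreover have "poly g x = 0" if "x \<in># A" for x
    using val[of x] that by (auto simp: prod_mset_zero_iff)
  ultimately show ?thesis using that A val by blast
qed

text \<open>The trace equals the degree times \<open>r\<close>, and the degree is invertible in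
  characteristic zero.\<close>

lemma single_conjugate:
  fixes E :: "'a set"
  assumes E: "sub_field E" and g: "min_poly E r g" and only: "\<And>s. poly g s = 0 \<Longrightarrow> s = r"
  shows "r \<in> E"
proof -
  have Er: "sub_ring E" using E by (simp add: sub_field_def)
  obtain A where A: "size A = degree g" "\<And>x. x \<in># A \<Longrightarrow> poly g x = 0" "sum_mset A \<in> E"
    using min_poly_factorization[OF Er g] by metis
  have "A = replicate_mset (size A) r"
    using A(2) only by (metis set_mset_subset_singletonD subsetI singletonI)
  then have "sum_mset A = of_nat (size A) * r"
    by (metis sum_mset_replicate_mset)
  moreover have "of_nat (size A) \<noteq> (0::'a)" using A(1) min_poly_degree_pos[OF g] char0 by simp
  ultimately have "r = sum_mset A / of_nat (size A)" by simp
  then show ?thesis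
    using sub_field_divide[OF E A(3) sub_ring_of_nat[OF Er]] by metis
qed

lemma min_coeff:
  assumes "P \<noteq> 0"
  obtains i where "coeff P i \<noteq> 0" "\<And>j. vge (v (coeff P i)) (coeff P j)"
proof -
  let ?B = "{i. coeff P i \<noteq> 0}"
  have "?B \<subseteq> {..degree P}" by (auto intro: le_degree)
  then have "finite ?B" by (rule finite_subset) simp
  moreover have "?B \<noteq> {}" using assms by (auto simp: poly_eq_iff)
  ultimately have "arg_min_on (\<lambda>i. v (coeff P i)) ?B \<in> ?B"
    "\<And>j. j \<in> ?B \<Longrightarrow> v (coeff P (arg_min_on (\<lambda>i. v (coeff P i)) ?B)) \<le> v (coeff P j)"
    using arg_min_if_finite(1)[of ?B "\<lambda>i. v (coeff P i)"] arg_min_least[of ?B _ "\<lambda>i. v (coeff P i)"]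
    by blast+
  then show ?thesis using that by (auto simp: vge_def)
qed

text \<open>Coefficients above the last unit coefficient are small, so cutting them off changes the
  value at the integral point \<open>w\<close> only by something small; dividing by that unit then
  makes the polynomial monic.\<close>

lemma monic_reduct:
  assumes F: "sub_field F" and P: "cf F P" "\<And>i. vge 0 (coeff P i)" "\<not> vgt 0 (coeff P k)"
    and w: "vge 0 w" "vgt 0 (poly P w)"
  shows "\<exists>g. cf F g \<and> (\<forall>i. vge 0 (coeff g i)) \<and> lead_coeff g = 1 \<and> vgt 0 (poly g w) \<and> degree g \<le> degree P"
proof -
  define m where "m = (GREATEST i. \<not> vgt 0 (coeff P i))"
  have bound: "\<And>i. \<not> vgt 0 (coeff P i) \<Longrightarrow> i \<le> degree P"
    by (metis le_degree vgt_0)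
  have m: "\<not> vgt 0 (coeff P m)"
    unfolding m_def using GreatestI_nat[of "\<lambda>i. \<not> vgt 0 (coeff P i)" k "degree P"] P(3) bound by blast
  have above: "vgt 0 (coeff P i)" if "i > m" for i
    using Greatest_le_nat[of "\<lambda>i. \<not> vgt 0 (coeff P i)" i "degree P"] bound that m_def by fastforce
  define c where "c = coeff P m"
  have c: "c \<noteq> 0" "v c = 0" "c \<in> F" using m P by (auto simp: c_def vgt_def vge_def cf_def order_le_less)
  define h where "h = poly_cutoff (Suc m) P"
  have ch: "coeff h i = (if i \<le> m then coeff P i else 0)" for i
    by (auto simp: h_def coeff_poly_cutoff)
  have dh: "degree h = m"
    by (rule antisym[OF degree_le le_degree]) (use ch c in \<open>auto simp: c_def\<close>)
  have Fr: "sub_ring F" using F by (simp add: sub_field_def)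
  have "vgt 0 (poly (P - h) w)"
    by (rule vgt_poly) (use above w in \<open>auto simp: ch\<close>)
  then have hw: "vgt 0 (poly h w)"
    using vgt_diff[OF w(2), of "poly (P - h) w"] by simp
  have inv: "vge 0 (inverse c)" using c by (simp add: vge_def v_inverse)
  show ?thesis
  proof (intro exI[of _ "smult (inverse c) h"] conjI allI)
    have "cf F h" using P(1) sub_ringD(2)[OF Fr] by (auto simp: cf_def ch)
    then show "cf F (smult (inverse c) h)"
      using c F by (intro cf_smult Fr) (auto simp: sub_field_def)
    show "vge 0 (coeff (smult (inverse c) h) i)" for i
      using P(2) inv by (auto simp: ch intro: vge_mult_0)
    show "lead_coeff (smult (inverse c) h) = 1" using c dh ch by (simp add: c_def)
    show "vgt 0 (poly (smult (inverse c) h) w)" using hw inv by (simp add: vgt_mult_0)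
    show "degree (smult (inverse c) h) \<le> degree P" using dh bound[OF m] by simp
  qed
qed

section \<open>Subrings with integral values and their residue classes\<close>

definition integral_values :: "'a set \<Rightarrow> bool" where
  "integral_values F \<longleftrightarrow> sub_ring F \<and> K \<subseteq> F \<and> (\<forall>x\<in>F. x \<noteq> 0 \<longrightarrow> v x \<in> \<int>)"

text \<open>Zorn's lemma: closure and integrality involve at most two elements at a time, and these
  lie in a common member of a chain.\<close>

lemma maximal_integral_values:
  "\<exists>F. integral_values F \<and> (\<forall>F'. integral_values F' \<longrightarrow> F \<subseteq> F' \<longrightarrow> F' = F)"
proof -
  define I where "I = Collect integral_values"
  have KA: "K \<in> I" using K v_K by (auto simp: I_def integral_values_def sub_field_def)
  have "\<exists>M \<in> I. \<forall>Y\<in>I. M \<subseteq> Y \<longrightarrow> Y = M"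
  proof (rule subset_Zorn_nonempty)
    show "I \<noteq> {}" using KA by blast
  next
    fix C assume C: "C \<noteq> {}" "subset.chain I C"
    have sub: "\<And>F. F \<in> C \<Longrightarrow> integral_values F" using C(2) by (auto simp: I_def subset.chain_def)
    have "x - y \<in> \<Union> C \<and> x * y \<in> \<Union> C" if xy: "x \<in> \<Union> C" "y \<in> \<Union> C" for x y
    proof -
      obtain F G where "F \<in> C" "G \<in> C" "x \<in> F" "y \<in> G" using xy by blast
      moreover have "F \<subseteq> G \<or> G \<subseteq> F" using C(2) \<open>F \<in> C\<close> \<open>G \<in> C\<close> by (auto simp: subset_chain_def)
      ultimately obtain H where "H \<in> C" "x \<in> H" "y \<in> H" by blast
      then have "x - y \<in> H" "x * y \<in> H" using sub[of H] sub_ringD(3,4)[of H] by (auto simp: integral_values_def)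
      then show ?thesis using \<open>H \<in> C\<close> by blast
    qed
    moreover have "1 \<in> \<Union> C" "K \<subseteq> \<Union> C"
      using C(1) sub sub_ringD(1) by (fastforce simp: integral_values_def)+
    ultimately show "\<Union> C \<in> I"
      using sub by (auto simp: I_def integral_values_def sub_ring_def)
  qed
  then show ?thesis by (auto simp: I_def)
qed

text \<open>A maximal subring with integral values has algebraically closed residue field: otherwise
  adjoin a lift of a residue class of minimal degree; no new values appear.\<close>

lemma maximal_residue:
  assumes F: "integral_values F" "\<And>F'. integral_values F' \<Longrightarrow> F \<subseteq> F' \<Longrightarrow> F' = F"
    and w: "vge 0 w"
  shows "\<exists>a\<in>F. vgt 0 (w - a)"
proof (rule ccontr)
  assume no: "\<not> (\<exists>a\<in>F. vgt 0 (w - a))"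
  have Fr: "sub_ring F" and KF: "K \<subseteq> F" using F by (auto simp: integral_values_def)
  have Ff: "sub_field F" using sub_ring_imp_sub_field[OF Fr KF] .
  \<comment> \<open>Monic integral polynomials over \<open>F\<close> whose reduction vanishes at the
    residue class of \<open>w\<close>; one of least degree plays the minimal polynomial of that
    class.\<close>
  define Q where "Q = (\<lambda>g. cf F g \<and> (\<forall>i. vge 0 (coeff g i)) \<and> lead_coeff g = 1 \<and> vgt 0 (poly g w))"
  have prim: "\<exists>h. Q h \<and> degree h \<le> degree P"
    if P: "P \<noteq> 0" "cf F P" "coeff P i \<noteq> 0" "\<And>j. vge (v (coeff P i)) (coeff P j)"
      "vgt (v (coeff P i)) (poly P w)" for P i
  proof -
    let ?c = "inverse (coeff P i)"
    have c: "?c \<in> F" "v ?c = - v (coeff P i)" using P Ff by (auto simp: sub_field_def cf_def v_inverse)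
    have "vge 0 (coeff (smult ?c P) j)" for j
      using vge_mult[of "- v (coeff P i)" ?c "v (coeff P i)" "coeff P j"] P c by (simp add: vge_def)
    moreover have "\<not> vgt 0 (coeff (smult ?c P) i)" using P by (simp add: vgt_def)
    moreover have "vgt 0 (poly (smult ?c P) w)"
      using vgt_mult[of "- v (coeff P i)" ?c "v (coeff P i)" "poly P w"] P c by (simp add: vge_def)
    moreover have "cf F (smult ?c P)" using c P by (intro cf_smult Fr) auto
    ultimately have "\<exists>g. cf F g \<and> (\<forall>i. vge 0 (coeff g i)) \<and> lead_coeff g = 1 \<and> vgt 0 (poly g w)
        \<and> degree g \<le> degree (smult ?c P)"
      by (intro monic_reduct[OF Ff _ _ _ w]) auto
    then show ?thesis unfolding Q_def using P by auto
  qed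
  obtain P where P: "cf F P" "P \<noteq> 0" "poly P w = 0"
    using algebraic_in_mono[OF KF alg, of w] by (auto simp: algebraic_in_def)
  obtain g0 where "Q g0" using min_coeff[OF P(2)] prim[OF P(2,1)] P(3) by (metis vgt_0)
  define g where "g = arg_min degree Q"
  have g: "Q g" unfolding g_def by (rule arg_min_natI) fact
  have min: "degree g \<le> degree h" if "Q h" for h
    unfolding g_def by (rule arg_min_nat_le) fact
  have g0: "g \<noteq> 0" "lead_coeff g = 1" using g by (auto simp: Q_def)
  obtain A where A: "size A = degree g" "g = smult (lead_coeff g) (\<Prod>x\<in>#A. [:- x, 1:])"
    using alg_closed_imp_factorization[OF g0(1)] by blast
  then have gA: "g = (\<Prod>x\<in>#A. [:- x, 1:])" using g0 by simp
  \<comment> \<open>The product of \<open>w - x\<close> over the roots of \<open>g\<close> is small,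
    so some root lies in the class of \<open>w\<close>. That root is adjoined in place of
    \<open>w\<close>, because \<open>g\<close> vanishes at it exactly and allows reduction modulo
    \<open>g\<close>.\<close>
  have "\<exists>x. x \<in># A \<and> vgt 0 (w - x)"
  proof (rule ccontr)
    assume n: "\<not> (\<exists>x. x \<in># A \<and> vgt 0 (w - x))"
    have "\<not> vgt 0 (\<Prod>x\<in>#B. w - x)" if "B \<subseteq># A" for B
      using that
    proof (induction B)
      case empty then show ?case by (simp add: vgt_def)
    next
      case (add x B)
      have "B \<subseteq># add_mset x B" by simp
      then have "B \<subseteq># A" using add.prems by (rule subset_mset.order_trans)
      moreover have "x \<in># A" using add.prems by (meson mset_subset_eqD union_single_eq_member)
      ultimately have "\<not> vgt 0 (w - x)" "\<not> vgt 0 (\<Prod>x\<in>#B. w - x)"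
        using n add.IH by auto
      then show ?case by (auto simp: vgt_def v_mult)
    qed
    from this[of A] g show False
      unfolding Q_def gA by (simp add: poly_prod_mset image_mset.compositionality o_def)
  qed
  then obtain x where x: "x \<in># A" "vgt 0 (w - x)" by blast
  have gx: "poly g x = 0" unfolding gA using x by (auto simp: poly_prod_mset prod_mset_zero_iff)
  have x0: "vge 0 x" using vge_diff[OF w vgt_imp_vge[OF x(2)]] by simp
  have dg: "degree g > 0"
  proof (rule Nat.gr0I)
    assume "degree g = 0" then show False using A x by simp
  qed
  define F' where "F' = {poly P x | P. cf F P}"
  have "v y \<in> \<int>" if yF: "y \<in> F'" "y \<noteq> 0" for y
  proof -
    obtain P where P: "y = poly P x" "cf F P" using yF by (auto simp: F'_def)
    obtain q r where qr: "cf F q" "cf F r" "P = q * g + r" "degree r < degree g"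
      using monic_division[OF Fr, of g P] g P dg by (auto simp: Q_def)
    have y: "y = poly r x" using P qr gx by simp
    then have r0: "r \<noteq> 0" using yF by auto
    obtain i where i: "coeff r i \<noteq> 0" "\<And>j. vge (v (coeff r i)) (coeff r j)"
      using min_coeff[OF r0] by blast
    \<comment> \<open>A value beyond that of the coefficients would make the normalised remainder
      small at \<open>w\<close> too, and thus produce a member of \<open>Q\<close> of degree below
      \<open>g\<close>.\<close>
    have "v y = v (coeff r i)"
    proof (rule ccontr)
      assume ne: "v y \<noteq> v (coeff r i)"
      let ?c = "coeff r i"
      let ?r = "smult (inverse ?c) r"
      have co: "vge 0 (coeff ?r j)" for j
        using vge_mult[of "- v ?c" "inverse ?c" "v ?c" "coeff r j"] i v_inverse[OF i(1)] by (simp add: vge_def)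
      have "vge 0 (poly ?r x)" by (rule vge_poly[OF co x0])
      moreover have vr: "v (poly ?r x) = v y - v ?c"
        using y yF i by (simp add: v_mult v_inverse)
      ultimately have "vgt 0 (poly ?r x)" using ne by (auto simp: vge_def vgt_def)
      moreover have "vgt 0 (poly ?r w - poly ?r x)" by (rule vgt_poly_diff[OF co w x0 x(2)])
      ultimately have "vgt 0 (poly ?r w)" by (metis diff_add_cancel vgt_add)
      then have "vgt (v ?c + 0) (?c * poly ?r w)" by (intro vgt_mult) simp
      moreover have "?c * poly ?r w = poly r w" using i by simp
      ultimately have "vgt (v ?c) (poly r w)" by (metis add.right_neutral)
      then obtain h where "Q h" "degree h \<le> degree r" using prim[OF r0 qr(2) i] by blast
      then show False using min[of h] qr(4) by simp
    qed
    moreover have "coeff r i \<in> F" using qr by (simp add: cf_def)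
    ultimately show ?thesis using F i by (simp add: integral_values_def)
  qed
  then have "integral_values F'" "F \<subseteq> F'"
    using adjoin_sub_ring[OF Fr, of x] KF by (auto simp: integral_values_def F'_def)
  then have "F' = F" by (rule F(2))
  then have "x \<in> F" using adjoin_sub_ring(3)[OF Fr, of x] F'_def by simp
  then show False using no x by blast
qed

end

lemma v_prod_mset_const:
  assumes "valued_field v" "\<And>x. x \<in># A \<Longrightarrow> f x \<noteq> 0 \<and> v (f x) = q"
  shows "(\<Prod>x\<in>#A. f x) \<noteq> 0 \<and> v (\<Prod>x\<in>#A. f x) = of_nat (size A) * q"
  using assms(2)
  by (induction A) (auto simp: valued_field.v_mult[OF assms(1)] valued_field.v_one[OF assms(1)] algebra_simps)

section \<open>Radical extensions of a ring with closed residue field\<close>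

locale maximal_unramified = local_closure v K p for v :: "'a::alg_closed_field \<Rightarrow> rat" and K p +
  fixes F :: "'a set" and \<pi> :: 'a
  assumes F: "sub_ring F" and K_F: "K \<subseteq> F"
    and v_F: "x \<in> F \<Longrightarrow> x \<noteq> 0 \<Longrightarrow> v x \<in> \<int>"
    and residue_F: "vge 0 w \<Longrightarrow> \<exists>a\<in>F. vgt 0 (w - a)"
    and \<pi>: "\<pi> \<in> K" "\<pi> \<noteq> 0" "v \<pi> = 1"
begin

lemma F_field: "sub_field F"
  using sub_ring_imp_sub_field[OF F K_F] .

text \<open>Takes the place of Hensel's lemma. Each conjugate of \<open>\<zeta>\<close> over
  \<open>F\<close> is an \<open>N\<close>-th root of unity and as close to the representative
  \<open>a\<close> as \<open>\<zeta>\<close> is; being in the same residue class, it equals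
  \<open>\<zeta>\<close>.\<close>

lemma root_of_unity_in_F:
  assumes z: "\<zeta> ^ N = 1" and N: "\<not> p dvd N"
  shows "\<zeta> \<in> F"
proof -
  have N0: "N > 0" using N by (intro Nat.gr0I) auto
  have z0: "vge 0 \<zeta>" "\<zeta> \<noteq> 0" using v_root_of_unity[OF z N0] z N0 by (auto simp: vge_def zero_power)
  obtain a where a: "a \<in> F" "vgt 0 (\<zeta> - a)" using residue_F z0 by blast
  obtain g where g: "min_poly F \<zeta> g" using min_poly_exists'[OF F_field K_F] by blast
  show ?thesis
  proof (rule single_conjugate[OF F_field g])
    fix s assume s: "poly g s = 0"
    have c: "cf F (monom 1 N - 1)" using F by (intro cf_diff cf_monom cf_1 sub_ringD)
    have sN: "s ^ N = 1"
      using min_poly_root[OF F g c _ s] z by (simp add: poly_monom)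
    have "vgt 0 (s - a)"
      using v_conj_shift[OF F K_F g s a(1)] a(2) by (auto simp: vgt_def)
    then have "vgt 0 ((s - a) - (\<zeta> - a))" using a(2) by (rule vgt_diff)
    then have d: "vgt 0 (s - \<zeta>)" by simp
    have "(s / \<zeta>) ^ N = 1" using sN z by (simp add: power_divide)
    moreover have "vgt 0 (s / \<zeta> - 1)"
      using vgt_mult_0[of "inverse \<zeta>" 0 "s - \<zeta>"] d z0 v_root_of_unity[OF z N0]
      by (simp add: divide_inverse algebra_simps vge_def v_inverse)
    ultimately have "s / \<zeta> = 1"
      using root_of_unity_separated[of "s / \<zeta>" N] N by (force simp: vgt_def)
    then show "s = \<zeta>" using z0 by simp
  qed
qed

text \<open>Here \<open>\<theta>\<close> is meant to be an \<open>N\<close>-th root of the uniformiser.\<close>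

definition adj :: "'a \<Rightarrow> 'a set" where
  "adj \<theta> = {poly P \<theta> | P. cf F P}"

lemma adj_ring: "sub_ring (adj \<theta>)" "F \<subseteq> adj \<theta>" "\<theta> \<in> adj \<theta>"
  using adjoin_sub_ring[OF F] by (auto simp: adj_def)

lemma adj_field: "sub_field (adj \<theta>)"
  using sub_ring_imp_sub_field[of "adj \<theta>"] adj_ring K_F by blast

context
  fixes N :: nat and \<theta> :: 'a
  assumes N: "N > 0" and \<theta>: "\<theta> ^ N = \<pi>"
begin

lemma \<theta>_nonzero: "\<theta> \<noteq> 0"
  using \<theta> \<pi> N by (auto simp: zero_power)

lemma v_\<theta>: "v \<theta> = 1 / of_nat N"
  using v_power[OF \<theta>_nonzero, of N] \<theta> \<pi> N by (simp add: field_simps)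

text \<open>The nonzero term of index \<open>i\<close> has value congruent to \<open>i / N\<close>
  modulo the integers, so no two terms have the same value. Thus \<open>\<theta>\<close> is totally
  ramified of degree \<open>N\<close> over \<open>F\<close>, and the dominant term determines the
  value.\<close>

lemma low_degree_nonzero:
  assumes R: "cf F R" "degree R < N" "R \<noteq> 0"
  shows "poly R \<theta> \<noteq> 0"
    and "\<exists>i<N. coeff R i \<noteq> 0 \<and> v (poly R \<theta>) = v (coeff R i) + of_nat i / of_nat N \<and>
      (\<forall>j<N. j \<noteq> i \<longrightarrow> vgt (v (poly R \<theta>)) (coeff R j * \<theta> ^ j))"
proof -
  let ?x = "\<lambda>i. coeff R i * \<theta> ^ i"
  have vx: "v (?x i) = v (coeff R i) + of_nat i / of_nat N" if "coeff R i \<noteq> 0" for i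
    using that \<theta>_nonzero v_\<theta> by (simp add: v_mult v_power)
  have sum: "poly R \<theta> = (\<Sum>i<N. ?x i)"
    unfolding poly_altdef using R(2) by (intro sum.mono_neutral_left) (auto simp: coeff_eq_0)
  have inj: "inj_on (\<lambda>i. v (?x i)) {i\<in>{..<N}. ?x i \<noteq> 0}"
  proof (rule inj_onI)
    fix i j assume ij: "i \<in> {i\<in>{..<N}. ?x i \<noteq> 0}" "j \<in> {i\<in>{..<N}. ?x i \<noteq> 0}" "v (?x i) = v (?x j)"
    then have nz: "coeff R i \<noteq> 0" "coeff R j \<noteq> 0" by auto
    obtain a b where ab: "v (coeff R i) = of_int a" "v (coeff R j) = of_int b"
      using v_F R(1) nz unfolding cf_def by (metis Ints_cases)
    have "of_int a + of_nat i / of_nat N = (of_int b + of_nat j / of_nat N :: rat)"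
      using ij(3) vx[OF nz(1)] vx[OF nz(2)] ab by simp
    then have "of_nat N * (of_int a + of_nat i / of_nat N) = (of_nat N * (of_int b + of_nat j / of_nat N) :: rat)"
      by simp
    then have "of_int (a * int N + int i) = (of_int (b * int N + int j) :: rat)"
      using N by (simp add: distrib_left mult.commute)
    then have "a * int N + int i = b * int N + int j" by (simp only: of_int_eq_iff)
    then have "(a * int N + int i) mod int N = (b * int N + int j) mod int N" by simp
    then have "int i mod int N = int j mod int N" by simp
    then show "i = j" using ij by simp
  qed
  obtain k where k: "coeff R k \<noteq> 0" "k < N"
    using R by (metis leading_coeff_neq_0)
  note ds = distinct_sum[of "{..<N}" k ?x, OF _ _ _ inj]
  show "poly R \<theta> \<noteq> 0" unfolding sum by (rule ds(1)) (use k \<theta>_nonzero in auto)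
  have "\<exists>i\<in>{..<N}. ?x i \<noteq> 0 \<and> v (\<Sum>j<N. ?x j) = v (?x i) \<and> (\<forall>j\<in>{..<N}. vge (v (?x i)) (?x j))"
    by (rule ds(2)) (use k \<theta>_nonzero in auto)
  then obtain i where i: "i < N" "?x i \<noteq> 0" "v (poly R \<theta>) = v (?x i)" "\<forall>j\<in>{..<N}. vge (v (?x i)) (?x j)"
    unfolding sum by blast
  have "vgt (v (poly R \<theta>)) (?x j)" if "j < N" "j \<noteq> i" for j
  proof (cases "?x j = 0")
    case False
    then have "v (?x i) \<noteq> v (?x j)" using i that inj_onD[OF inj, of i j] by blast
    moreover have "v (?x i) \<le> v (?x j)" using i(4) that False by (auto simp: vge_def)
    ultimately show ?thesis using i(3) by (simp add: vgt_def)
  next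
    case True
    then show ?thesis by (metis vgt_0)
  qed
  then show "\<exists>i<N. coeff R i \<noteq> 0 \<and> v (poly R \<theta>) = v (coeff R i) + of_nat i / of_nat N \<and>
      (\<forall>j<N. j \<noteq> i \<longrightarrow> vgt (v (poly R \<theta>)) (coeff R j * \<theta> ^ j))"
    using i vx by (intro exI[of _ i]) auto
qed

text \<open>The remainder modulo \<open>Y ^ N - \<pi>\<close>. One \<open>R\<close> serves all
  \<open>N\<close>-th roots of \<open>\<pi>\<close> at once, which makes the substitution of one
  root for another well defined.\<close>

lemma reduce:
  assumes "cf F P"
  obtains R where "cf F R" "degree R < N" "\<And>x. x ^ N = \<pi> \<Longrightarrow> poly P x = poly R x"
proof -
  let ?g = "monom 1 N - [:\<pi>:]"
  have cg: "cf F ?g" using F K_F \<pi> by (intro cf_diff cf_monom cf_pCons cf_0 sub_ringD) auto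
  have dg: "degree ?g = N"
  proof (rule antisym)
    show "degree ?g \<le> N" by (intro degree_diff_le degree_monom_le) simp
    show "N \<le> degree ?g" using N by (intro le_degree) (auto simp: coeff_pCons split: nat.splits)
  qed
  then have lg: "lead_coeff ?g = 1" using N by (auto simp: coeff_pCons split: nat.splits)
  obtain q r where qr: "cf F q" "cf F r" "P = q * ?g + r" "degree r < degree ?g"
    using monic_division[OF F cg lg _ assms] N dg by auto
  then show ?thesis using that[of r] dg by (simp add: poly_monom)
qed

lemma v_adj:
  assumes "x \<in> adj \<theta>" "x \<noteq> 0"
  shows "of_nat N * v x \<in> \<int>"
proof -
  obtain P where P: "x = poly P \<theta>" "cf F P" using assms by (auto simp: adj_def)
  obtain R where R: "cf F R" "degree R < N" "poly P \<theta> = poly R \<theta>"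
    using reduce[OF P(2)] \<theta> by metis
  have "R \<noteq> 0" using R P assms by auto
  then obtain i where i: "coeff R i \<noteq> 0" "v x = v (coeff R i) + of_nat i / of_nat N"
    using low_degree_nonzero(2)[of R] R P by auto
  then have "of_nat N * v x = of_nat N * v (coeff R i) + of_nat i"
    using N by (simp add: distrib_left)
  moreover have "v (coeff R i) \<in> \<int>" using v_F R i by (simp add: cf_def)
  ultimately show ?thesis by simp
qed

text \<open>Dividing \<open>y\<close> by a power of \<open>\<theta>\<close> of the same value leaves
  a unit, whose residue class has a representative in \<open>F\<close>.\<close>

lemma approximation:
  assumes y: "y \<noteq> 0" "of_nat N * v y \<in> \<int>"
  shows "\<exists>b\<in>adj \<theta>. b \<noteq> 0 \<and> vgt (v y) (y - b)"
proof -
  obtain k where k: "of_nat N * v y = of_int k" using y by (auto elim: Ints_cases)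
  define u where "u = \<theta> powi k"
  have u: "u \<noteq> 0" "u \<in> adj \<theta>"
    using \<theta>_nonzero sub_field_powi[OF adj_field adj_ring(3)] by (auto simp: u_def)
  have "v u = of_int k / of_nat N" using \<theta>_nonzero v_\<theta> by (simp add: u_def v_powi)
  also have "\<dots> = v y" using k[symmetric] N by simp
  finally have vu: "v u = v y" .
  have "v (y / u) = 0" using u vu y by (simp add: v_divide)
  then obtain a where a: "a \<in> F" "vgt 0 (y / u - a)" using residue_F[of "y / u"] by (auto simp: vge_def)
  have "a \<noteq> 0" using a \<open>v (y / u) = 0\<close> u y by (auto simp: vgt_def)
  moreover have "vgt (v u + 0) (u * (y / u - a))" by (intro vgt_mult a) simp
  then have "vgt (v y) (y - u * a)" using u vu by (simp add: algebra_simps)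
  moreover have "u * a \<in> adj \<theta>" using u a adj_ring by (auto intro: sub_ringD)
  ultimately show ?thesis using u by (intro bexI[of _ "u * a"]) auto
qed

end

text \<open>With \<open>M = N * L\<close>, the quotient of \<open>\<eta>\<close> by
  \<open>\<theta> ^ L\<close> is an \<open>N\<close>-th root of unity, hence in
  \<open>F\<close>.\<close>

lemma adj_subset:
  assumes N: "\<not> p dvd N" "\<eta> ^ N = \<pi>" and \<theta>: "\<theta> ^ M = \<pi>" "N dvd M" "M > 0"
  shows "adj \<eta> \<subseteq> adj \<theta>"
proof -
  obtain L where L: "M = N * L" using \<theta> by (auto elim: dvdE)
  have nz: "\<theta> \<noteq> 0" using \<theta> \<pi> by (auto simp: zero_power)
  have "(\<eta> / \<theta> ^ L) ^ N = 1"
    using N \<theta> L \<pi> by (simp add: power_divide power_mult[symmetric] mult.commute)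
  then have z: "\<eta> / \<theta> ^ L \<in> F" using N by (intro root_of_unity_in_F)
  have "\<eta> = (\<eta> / \<theta> ^ L) * \<theta> ^ L" using nz by simp
  also have "\<dots> \<in> adj \<theta>" using z adj_ring by (intro sub_ringD(4) sub_ring_power) auto
  finally have "\<eta> \<in> adj \<theta>" .
  then show ?thesis
    unfolding adj_def[of \<eta>] using poly_in[OF adj_ring(1) cf_subset[OF adj_ring(2)]] by blast
qed

definition tame_closure :: "'a set" where
  "tame_closure = \<Union> {adj \<theta> | \<theta> N. \<not> p dvd N \<and> \<theta> ^ N = \<pi>}"

lemma pos_if_not_dvd: "\<not> p dvd N \<Longrightarrow> N > 0"
  by (intro Nat.gr0I) auto

text \<open>A root of \<open>\<pi>\<close> whose index is the product of two given indices contains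
  both stages. So finitely many tame elements, such as all roots of a polynomial, share a single
  \<open>\<theta>\<close>.\<close>

lemma tame_closure_directed:
  assumes "finite S" "S \<subseteq> tame_closure"
  shows "\<exists>\<theta> N. \<not> p dvd N \<and> \<theta> ^ N = \<pi> \<and> S \<subseteq> adj \<theta>"
  using assms
proof (induction S rule: finite_induct)
  case empty
  show ?case using prime_p not_prime_1 by (intro exI[of _ \<pi>] exI[of _ 1]) auto
next
  case (insert x S)
  then obtain \<theta> N where 1: "\<not> p dvd N" "\<theta> ^ N = \<pi>" "S \<subseteq> adj \<theta>" by auto
  obtain \<eta> M where 2: "\<not> p dvd M" "\<eta> ^ M = \<pi>" "x \<in> adj \<eta>"
    using insert.prems by (auto simp: tame_closure_def)
  have pos: "N * M > 0" using 1 2 pos_if_not_dvd by simp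
  obtain \<xi> where \<xi>: "\<xi> ^ (N * M) = \<pi>" using nth_root_exists[OF pos] by blast
  have "adj \<theta> \<subseteq> adj \<xi>" "adj \<eta> \<subseteq> adj \<xi>"
    using adj_subset[OF 1(1,2) \<xi>] adj_subset[OF 2(1,2) \<xi>] pos by auto
  moreover have "\<not> p dvd N * M" using 1 2 prime_p by (simp add: prime_dvd_mult_iff)
  ultimately show ?case using 1 2 \<xi> by blast
qed

lemma tame_closure_ring: "sub_ring tame_closure" "F \<subseteq> tame_closure"
proof -
  show sub: "F \<subseteq> tame_closure"
  proof -
    obtain \<theta> N where "\<not> p dvd N" "\<theta> ^ N = \<pi>" using tame_closure_directed[of "{}"] by auto
    then show ?thesis using adj_ring(2)[of \<theta>] by (auto simp: tame_closure_def)
  qed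
  have "x - y \<in> tame_closure \<and> x * y \<in> tame_closure" if xy: "x \<in> tame_closure" "y \<in> tame_closure" for x y
  proof -
    obtain \<theta> N where "\<not> p dvd N" "\<theta> ^ N = \<pi>" "{x, y} \<subseteq> adj \<theta>"
      using tame_closure_directed[of "{x, y}"] xy by auto
    then have "adj \<theta> \<subseteq> tame_closure" "x - y \<in> adj \<theta>" "x * y \<in> adj \<theta>"
      using sub_ringD[OF adj_ring(1)] by (auto simp: tame_closure_def)
    then show ?thesis by blast
  qed
  then show "sub_ring tame_closure"
    using sub sub_ringD(1)[OF F] by (auto simp: sub_ring_def)
qed

text \<open>The conjugates of a trace zero element of degree \<open>m < p\<close> would all have the same leading
  term, whose multiple by the unit \<open>m\<close> does not vanish.\<close>

lemma low_degree_in_tame_closure: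
  assumes P: "cf K P" "P \<noteq> 0" "poly P r = 0" "degree P < p"
  shows "r \<in> tame_closure"
proof -
  define E where "E = tame_closure"
  have E: "sub_ring E" "K \<subseteq> E" using tame_closure_ring K_F by (auto simp: E_def)
  have Ef: "sub_field E" using sub_ring_imp_sub_field E by blast
  obtain g where g: "min_poly E r g" using min_poly_exists'[OF Ef E(2)] by blast
  define m where "m = degree g"
  have m: "m > 0" "m < p"
    using min_poly_degree_pos[OF g] g P cf_subset[OF E(2) P(1)] by (fastforce simp: m_def min_poly_def)+
  have pm: "\<not> p dvd m" using m by (auto dest: dvd_imp_le)
  obtain A where A: "size A = m" "\<And>x. x \<in># A \<Longrightarrow> poly g x = 0"
    "\<And>t. poly g t = (\<Prod>x\<in>#A. t - x)" "sum_mset A \<in> E"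
    using min_poly_factorization[OF E(1) g] m_def by metis
  define t where "t = sum_mset A / of_nat m"
  have t: "t \<in> E" "of_nat m * t = sum_mset A"
    using sub_field_divide[OF Ef A(4)] sub_ring_of_nat[OF E(1)] char0[OF m(1)] by (auto simp: t_def)
  have "r = t"
  proof (rule ccontr)
    assume rt: "r \<noteq> t"
    define q where "q = v (r - t)"
    have At: "t - x \<noteq> 0 \<and> v (t - x) = q" if "x \<in># A" for x
      using v_conj_shift[OF E g A(2)[OF that] t(1)] rt v_diff_commute[of t x] by (auto simp: q_def)
    have "poly g t \<noteq> 0" "v (poly g t) = of_nat m * q"
      using v_prod_mset_const[of v A "\<lambda>x. t - x" q] At A valued_field_axioms by auto
    moreover have "poly g t \<in> E" using g t poly_in[OF E(1)] by (auto simp: min_poly_def)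
    ultimately obtain \<eta> N where N: "\<not> p dvd N" "\<eta> ^ N = \<pi>" "of_nat N * (of_nat m * q) \<in> \<int>"
      using v_adj[OF pos_if_not_dvd] unfolding E_def tame_closure_def by fastforce
    \<comment> \<open>The value \<open>m * q\<close> of \<open>poly g t\<close> has denominator
      dividing \<open>N\<close>, so \<open>q\<close> itself calls for the root index
      \<open>N * m\<close>, which is still prime to \<open>p\<close>.\<close>
    have Nm: "\<not> p dvd N * m" using N pm prime_p by (simp add: prime_dvd_mult_iff)
    obtain \<theta> where \<theta>: "\<theta> ^ (N * m) = \<pi>" using nth_root_exists[OF pos_if_not_dvd[OF Nm]] by blast
    obtain b where b: "b \<in> adj \<theta>" "b \<noteq> 0" "vgt q ((r - t) - b)"
      using approximation[OF pos_if_not_dvd[OF Nm] \<theta>, of "r - t"] rt N(3)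
      by (auto simp: q_def mult.assoc)
    have "b \<in> E" using b \<theta> Nm by (auto simp: E_def tame_closure_def)
    then have tb: "t + b \<in> E" using t E by (auto intro: sub_ringD)
    \<comment> \<open>Since \<open>t + b\<close> lies in \<open>E\<close>, all conjugates are as
      close to it as \<open>r\<close>. Their mean is \<open>t\<close>, so adding up leaves
      \<open>m * b\<close>, which would be smaller than its value \<open>q\<close> permits.\<close>
    have "vgt q (x - (t + b))" if "x \<in># A" for x
      using v_conj_shift[OF E g A(2)[OF that] tb] b(3) by (auto simp: vgt_def algebra_simps)
    then have "vgt q (\<Sum>x\<in>#B. x - (t + b))" if "B \<subseteq># A" for B
      using that by (induction B) (auto intro!: vgt_add dest: mset_subset_eq_insertD subset_mset.less_imp_le)
    then have "vgt q (\<Sum>x\<in>#A. x - (t + b))" by blast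
    moreover have "(\<Sum>x\<in>#B. x - (t + b)) = sum_mset B - of_nat (size B) * (t + b)" for B
      by (induction B) (auto simp: algebra_simps)
    then have "(\<Sum>x\<in>#A. x - (t + b)) = - (of_nat m * b)"
      using A(1) t(2) by (simp add: distrib_left)
    ultimately have "vgt q (of_nat m * b)" by (metis vgt_minus)
    moreover have "v b = q"
      using dominant_add(2)[of "r - t" "b - (r - t)"] rt b(3) vgt_diff_commute[of q b "r - t"]
      by (simp add: q_def)
    ultimately show False
      using b(2) m char0[of m] v_of_nat[OF pm] by (auto simp: vgt_def v_mult)
  qed
  then show ?thesis using t E_def by simp
qed

text \<open>A generator of tame inertia, given by \<open>\<theta> \<mapsto> \<zeta> * \<theta>\<close>.\<close>

lemma twist_exists:
  assumes N: "\<not> p dvd N" "\<theta> ^ N = \<pi>" and z: "\<zeta> ^ N = 1"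
  shows "\<exists>\<tau>. (\<forall>x\<in>adj \<theta>. \<tau> x \<in> adj \<theta>) \<and> (\<forall>x\<in>F. \<tau> x = x) \<and>
    (\<forall>x\<in>adj \<theta>. \<forall>y\<in>adj \<theta>. \<tau> (x + y) = \<tau> x + \<tau> y \<and> \<tau> (x * y) = \<tau> x * \<tau> y) \<and>
    (\<forall>x\<in>adj \<theta>. x \<noteq> 0 \<longrightarrow> (\<exists>k. of_nat N * v x = of_int k \<and> vgt (v x) (\<tau> x - \<zeta> powi k * x)))"
proof -
  have N0: "N > 0" using N pos_if_not_dvd by blast
  have zF: "\<zeta> \<in> F" using root_of_unity_in_F z N by blast
  have z0: "\<zeta> \<noteq> 0" using z N0 by (auto simp: zero_power)
  have vz: "v \<zeta> = 0" using v_root_of_unity[OF z N0] .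
  have zt: "(\<zeta> * \<theta>) ^ N = \<pi>" using N z by (simp add: power_mult_distrib)
  have zadj: "\<zeta> * \<theta> \<in> adj \<theta>" using zF adj_ring[of \<theta>] by (auto intro: sub_ringD)
  \<comment> \<open>The difference of two representations has a remainder of degree below
    \<open>N\<close> vanishing at \<open>\<theta>\<close>; that remainder is zero, so the difference
    also vanishes at \<open>\<zeta> * \<theta>\<close>.\<close>
  have welldef: "poly P (\<zeta> * \<theta>) = poly Q (\<zeta> * \<theta>)"
    if PQ: "cf F P" "cf F Q" "poly P \<theta> = poly Q \<theta>" for P Q
  proof -
    obtain R where R: "cf F R" "degree R < N" "\<And>x. x ^ N = \<pi> \<Longrightarrow> poly (P - Q) x = poly R x"
      using reduce[OF N0 N(2) cf_diff[OF F PQ(1,2)]] by blast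
    have "poly R \<theta> = 0" using R(3)[OF N(2)] PQ by simp
    then have "R = 0" using low_degree_nonzero(1)[OF N0 N(2) R(1,2)] by blast
    then show ?thesis using R(3)[OF zt] by simp
  qed
  define \<tau> where "\<tau> = (\<lambda>x. poly (SOME P. cf F P \<and> poly P \<theta> = x) (\<zeta> * \<theta>))"
  have \<tau>: "\<tau> (poly P \<theta>) = poly P (\<zeta> * \<theta>)" if "cf F P" for P
  proof -
    have "cf F (SOME Q. cf F Q \<and> poly Q \<theta> = poly P \<theta>) \<and> poly (SOME Q. cf F Q \<and> poly Q \<theta> = poly P \<theta>) \<theta> = poly P \<theta>"
      by (rule someI[of _ P]) (use that in simp)
    then show ?thesis unfolding \<tau>_def using that by (intro welldef) auto
  qed
  have adjE: "\<exists>P. cf F P \<and> x = poly P \<theta>" if "x \<in> adj \<theta>" for x using that by (auto simp: adj_def)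
  show ?thesis
  proof (intro exI[of _ \<tau>] conjI ballI impI)
    fix x assume "x \<in> adj \<theta>"
    then obtain P where "cf F P" "x = poly P \<theta>" using adjE by blast
    then show "\<tau> x \<in> adj \<theta>"
      using \<tau> poly_in[OF adj_ring(1) cf_subset[OF adj_ring(2)] zadj] by simp
  next
    fix x assume "x \<in> F"
    then show "\<tau> x = x" using \<tau>[of "[:x:]"] F by (simp add: cf_pCons)
  next
    fix x y assume "x \<in> adj \<theta>" "y \<in> adj \<theta>"
    then obtain P Q where "cf F P" "x = poly P \<theta>" "cf F Q" "y = poly Q \<theta>" using adjE by meson
    then show "\<tau> (x + y) = \<tau> x + \<tau> y" "\<tau> (x * y) = \<tau> x * \<tau> y"
      using \<tau>[of "P + Q"] \<tau>[of "P * Q"] \<tau>[of P] \<tau>[of Q] F by (auto simp: cf_add cf_mult)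
  next
    fix x assume x: "x \<in> adj \<theta>" "x \<noteq> 0"
    then obtain P where P: "cf F P" "x = poly P \<theta>" using adjE by blast
    obtain R where R: "cf F R" "degree R < N" "\<And>x. x ^ N = \<pi> \<Longrightarrow> poly P x = poly R x"
      using reduce[OF N0 N(2) P(1)] by blast
    have xR: "x = poly R \<theta>" using P R N by simp
    then have "R \<noteq> 0" using x by auto
    then obtain i where i: "i < N" "coeff R i \<noteq> 0" "v x = v (coeff R i) + of_nat i / of_nat N"
      "\<And>j. j < N \<Longrightarrow> j \<noteq> i \<Longrightarrow> vgt (v x) (coeff R j * \<theta> ^ j)"
      using low_degree_nonzero(2)[OF N0 N(2) R(1,2)] xR by auto
    obtain a where a: "v (coeff R i) = of_int a" using v_F R(1) i(2) unfolding cf_def by (metis Ints_cases)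
    have k: "of_nat N * v x = of_int (a * int N + int i)" using i(3) a N0 by (simp add: distrib_left mult.commute)
    have zk: "\<zeta> powi (a * int N + int i) = \<zeta> ^ i"
      using z0 z by (simp add: power_int_add power_int_mult mult.commute[of a])
    have sum: "poly R y = (\<Sum>j<N. coeff R j * y ^ j)" for y
      unfolding poly_altdef using R(2) by (intro sum.mono_neutral_left) (auto simp: coeff_eq_0)
    \<comment> \<open>The dominant index \<open>i\<close> drops out of this sum, and every other
      term already has value above \<open>v x\<close>.\<close>
    have "\<tau> x - \<zeta> ^ i * x = (\<Sum>j<N. (\<zeta> ^ j - \<zeta> ^ i) * (coeff R j * \<theta> ^ j))"
      unfolding xR \<tau>[OF R(1)] unfolding sum sum_distrib_left sum_subtractf[symmetric]
      by (intro sum.cong) (auto simp: power_mult_distrib algebra_simps)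
    moreover have "vgt (v x) ((\<zeta> ^ j - \<zeta> ^ i) * (coeff R j * \<theta> ^ j))" if "j < N" for j
    proof (cases "j = i")
      case False
      have "vge 0 \<zeta>" using vz by (simp add: vge_def)
      then show ?thesis using i(4)[OF that False] vgt_mult_0[OF vge_diff[OF vge_power vge_power]] by blast
    qed simp
    ultimately have "vgt (v x) (\<tau> x - \<zeta> ^ i * x)" by (auto intro: vgt_sum)
    then show "\<exists>k. of_nat N * v x = of_int k \<and> vgt (v x) (\<tau> x - \<zeta> powi k * x)"
      using k zk by (intro exI[of _ "a * int N + int i"]) simp
  qed
qed

end

context local_closure
begin

text \<open>Only one finite stage \<open>E\<close> is exported, without \<open>F\<close> and
  \<open>\<theta>\<close>. In the last clause \<open>k\<close> is determined by the value of
  \<open>x\<close>, so leading terms are multiplied by a character of the value group.\<close>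

theorem tame_inertia:
  assumes f: "cf K f" "f \<noteq> 0" "degree f < p"
  shows "\<exists>E \<tau> N \<zeta>. \<not> p dvd N \<and> (\<forall>j. \<zeta> ^ j = 1 \<longleftrightarrow> N dvd j) \<and>
    sub_field E \<and> K \<subseteq> E \<and> {x. poly f x = 0} \<subseteq> E \<and>
    (\<forall>x\<in>E. \<tau> x \<in> E) \<and> (\<forall>x\<in>K. \<tau> x = x) \<and>
    (\<forall>x\<in>E. \<forall>y\<in>E. \<tau> (x + y) = \<tau> x + \<tau> y \<and> \<tau> (x * y) = \<tau> x * \<tau> y) \<and>
    (\<forall>x\<in>E. x \<noteq> 0 \<longrightarrow> (\<exists>k. of_nat N * v x = of_int k \<and> vgt (v x) (\<tau> x - \<zeta> powi k * x)))"
proof -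
  obtain F where F: "integral_values F" "\<And>F'. integral_values F' \<Longrightarrow> F \<subseteq> F' \<Longrightarrow> F' = F"
    using maximal_integral_values by blast
  have "(1::rat) \<in> v ` (K - {0})" using v_K by simp
  then obtain \<pi> where \<pi>: "\<pi> \<in> K" "\<pi> \<noteq> 0" "v \<pi> = 1" by (metis DiffE imageE singletonI)
  interpret maximal_unramified v K p F \<pi>
    using F(1) maximal_residue[OF F] \<pi>
    by unfold_locales (auto simp: integral_values_def)
  have "{x. poly f x = 0} \<subseteq> tame_closure"
    using low_degree_in_tame_closure[OF f(1,2) _ f(3)] by blast
  then obtain \<theta> N where N: "\<not> p dvd N" "\<theta> ^ N = \<pi>" "{x. poly f x = 0} \<subseteq> adj \<theta>"
    using tame_closure_directed[OF poly_roots_finite[OF f(2)]] by blast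
  obtain \<zeta> :: 'a where z: "\<And>j. \<zeta> ^ j = 1 \<longleftrightarrow> N dvd j"
    using primitive_root_of_unity[OF char0 pos_if_not_dvd[OF N(1)]] by blast
  have zN: "\<zeta> ^ N = 1" using z by simp
  obtain \<tau> where \<tau>: "\<forall>x\<in>adj \<theta>. \<tau> x \<in> adj \<theta>" "\<forall>x\<in>F. \<tau> x = x"
    "\<forall>x\<in>adj \<theta>. \<forall>y\<in>adj \<theta>. \<tau> (x + y) = \<tau> x + \<tau> y \<and> \<tau> (x * y) = \<tau> x * \<tau> y"
    "\<forall>x\<in>adj \<theta>. x \<noteq> 0 \<longrightarrow> (\<exists>k. of_nat N * v x = of_int k \<and> vgt (v x) (\<tau> x - \<zeta> powi k * x))"
    using twist_exists[OF N(1,2) zN] by (elim exE conjE) (rule that)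
  have z': "\<forall>j. \<zeta> ^ j = 1 \<longleftrightarrow> N dvd j" using z by blast
  have KA: "K \<subseteq> adj \<theta>" using adj_ring(2) K_F by blast
  have fixK: "\<forall>x\<in>K. \<tau> x = x" using \<tau>(2) K_F by blast
  show ?thesis
    using N(1,3) z' \<tau>(1,3,4) fixK KA adj_field[of \<theta>]
    by (intro exI[of _ "adj \<theta>"] exI[of _ \<tau>] exI[of _ N] exI[of _ \<zeta>] conjI) assumption+
qed

end

section \<open>The p-adic numbers\<close>

context
  fixes p :: nat
  assumes p: "prime p"
begin

text \<open>Divisibility by \<open>p ^ k\<close> in the localisation of the integers at
  \<open>p\<close>, for any integer \<open>k\<close>. Comparisons of the real-valued absolute value
  become arithmetic of fractions; \<open>pdvd_iff\<close> is the dictionary.\<close>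

definition pdvd :: "int \<Rightarrow> rat \<Rightarrow> bool" where
  "pdvd k x \<longleftrightarrow> (\<exists>a b. \<not> int p dvd b \<and> x = of_int a / of_int b * of_nat p powi k)"

lemma p_rat: "(of_nat p :: rat) \<noteq> 0"
  using p by (auto simp: prime_gt_0_nat)

lemma prime_int_p: "prime (int p)"
  using p by simp

lemma pdvd_I: "\<not> int p dvd b \<Longrightarrow> x = of_int a / of_int b * of_nat p powi k \<Longrightarrow> pdvd k x"
  by (auto simp: pdvd_def)

lemma pdvd_E:
  assumes "pdvd k x"
  obtains a b where "\<not> int p dvd b" "b \<noteq> 0" "x = of_int a / of_int b * of_nat p powi k"
  using assms by (auto simp: pdvd_def)

lemma pdvd_0 [simp]: "pdvd k 0"
  using p not_prime_1 by (intro pdvd_I[of 1 _ 0]) auto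

lemma pdvd_mult:
  assumes "pdvd k x" "pdvd l y"
  shows "pdvd (k + l) (x * y)"
proof -
  obtain a b where 1: "\<not> int p dvd b" "b \<noteq> 0" "x = of_int a / of_int b * of_nat p powi k"
    using assms(1) by (rule pdvd_E)
  obtain c d where 2: "\<not> int p dvd d" "d \<noteq> 0" "y = of_int c / of_int d * of_nat p powi l"
    using assms(2) by (rule pdvd_E)
  show ?thesis
    by (rule pdvd_I[of "b * d" _ "a * c"])
      (use 1 2 prime_int_p p_rat in \<open>auto simp: prime_dvd_mult_iff power_int_add\<close>)
qed

lemma pdvd_add:
  assumes "pdvd k x" "pdvd k y"
  shows "pdvd k (x + y)"
proof -
  obtain a b where 1: "\<not> int p dvd b" "b \<noteq> 0" "x = of_int a / of_int b * of_nat p powi k"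
    using assms(1) by (rule pdvd_E)
  obtain c d where 2: "\<not> int p dvd d" "d \<noteq> 0" "y = of_int c / of_int d * of_nat p powi k"
    using assms(2) by (rule pdvd_E)
  show ?thesis
  proof (rule pdvd_I[of "b * d" _ "a * d + c * b"])
    show "\<not> int p dvd b * d" using 1 2 prime_int_p by (simp add: prime_dvd_mult_iff)
    show "x + y = of_int (a * d + c * b) / of_int (b * d) * of_nat p powi k"
      using 1 2 by (simp add: add_divide_distrib distrib_right)
  qed
qed

lemma pdvd_minus [simp]: "pdvd k (- x) \<longleftrightarrow> pdvd k x"
proof -
  have "pdvd k (- x)" if "pdvd k x" for x
    using that by (rule pdvd_E) (auto intro: pdvd_I[of _ _ "- _"])
  from this[of x] this[of "- x"] show ?thesis by auto
qed

lemma pdvd_diff: "pdvd k x \<Longrightarrow> pdvd k y \<Longrightarrow> pdvd k (x - y)"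
  using pdvd_add[of k x "- y"] by simp

lemma pdvd_int: "pdvd (int k) (of_int n) \<longleftrightarrow> int p ^ k dvd n"
proof
  assume "pdvd (int k) (of_int n)"
  then obtain a b where b: "\<not> int p dvd b" "b \<noteq> 0" "of_int n = (of_int a / of_int b * of_nat p powi int k :: rat)"
    by (rule pdvd_E)
  then have "(of_int (n * b) :: rat) = of_int (a * int p ^ k)"
    by (simp add: field_simps)
  then have "n * b = a * int p ^ k" by (simp only: of_int_eq_iff)
  moreover have "coprime (int p ^ k) b" using b prime_int_p by (simp add: prime_imp_coprime)
  ultimately show "int p ^ k dvd n" by (metis coprime_dvd_mult_left_iff dvd_triv_right)
next
  assume "int p ^ k dvd n"
  then obtain c where "n = int p ^ k * c" by (auto elim: dvdE)
  then show "pdvd (int k) (of_int n)"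
    using p not_prime_1 by (intro pdvd_I[of 1 _ c]) auto
qed

lemma pdvd_mono:
  assumes "pdvd k x" "l \<le> k"
  shows "pdvd l x"
proof -
  obtain a b where 1: "\<not> int p dvd b" "b \<noteq> 0" "x = of_int a / of_int b * of_nat p powi k"
    using assms(1) by (rule pdvd_E)
  have "of_nat p powi k = (of_nat p powi (k - l) * of_nat p powi l :: rat)"
    using p_rat by (simp flip: power_int_add)
  moreover have "of_nat p powi (k - l) = (of_int (int p ^ nat (k - l)) :: rat)"
    using assms(2) by (simp add: power_int_def)
  ultimately show ?thesis
    using 1 by (intro pdvd_I[of b _ "a * int p ^ nat (k - l)"]) auto
qed

lemma multiplicity_quotient:
  assumes "x \<noteq> 0"
  obtains a b :: int and e where "\<not> int p dvd a" "\<not> int p dvd b" "x = of_int a / of_int b * of_nat p powi e"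
    "padic_abs p x = real p powi (- e)"
proof -
  obtain c d where cd: "quotient_of x = (c, d)" by fastforce
  have d: "d \<noteq> 0" and x: "x = of_int c / of_int d"
    using cd quotient_of_denom_pos[OF cd] quotient_of_div[OF cd] by auto
  have c: "c \<noteq> 0" using x assms by auto
  have up: "\<not> is_unit (int p)" using prime_int_p not_prime_unit by blast
  obtain a where a: "c = int p ^ multiplicity (int p) c * a" "\<not> int p dvd a"
    using multiplicity_decompose'[OF c up] by blast
  obtain b where b: "d = int p ^ multiplicity (int p) d * b" "\<not> int p dvd b"
    using multiplicity_decompose'[OF d up] by blast
  define m n where "m = multiplicity (int p) c" and "n = multiplicity (int p) d"
  have "x = of_int a / of_int b * (of_nat p ^ m / of_nat p ^ n)"
    unfolding x by (subst a(1), subst b(1)) (simp add: m_def n_def mult.commute)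
  also have "of_nat p ^ m / of_nat p ^ n = (of_nat p powi (int m - int n) :: rat)"
    using p_rat by (simp add: power_int_diff)
  finally have "x = of_int a / of_int b * of_nat p powi (int m - int n)" .
  moreover have "padic_abs p x = real p powi (- (int m - int n))"
    using assms by (simp add: padic_abs_def cd m_def n_def)
  ultimately show ?thesis using that a(2) b(2) by blast
qed

lemma pdvd_iff: "pdvd k x \<longleftrightarrow> padic_abs p x \<le> real p powi (- k)"
proof (cases "x = 0")
  case False
  obtain a b :: int and e where ab: "\<not> int p dvd a" "\<not> int p dvd b" "x = of_int a / of_int b * of_nat p powi e"
    "padic_abs p x = real p powi (- e)"
    using multiplicity_quotient[OF False] by blast
  have p1: "real p > 1" using p prime_gt_1_nat by simp
  have "pdvd k x \<longleftrightarrow> k \<le> e"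
  proof
    assume "k \<le> e"
    moreover have "pdvd e x" using ab by (intro pdvd_I) auto
    ultimately show "pdvd k x" using pdvd_mono by blast
  next
    assume k: "pdvd k x"
    show "k \<le> e"
    proof (rule ccontr)
      assume "\<not> k \<le> e"
      then have "pdvd (e + 1) x" using pdvd_mono[OF k] by simp
      moreover have "pdvd (- e) (of_int b * of_nat p powi (- e))"
        using p not_prime_1 by (intro pdvd_I[of 1 _ b]) auto
      ultimately have "pdvd (e + 1 + - e) (x * (of_int b * of_nat p powi (- e)))"
        by (rule pdvd_mult)
      moreover have "b \<noteq> 0" using ab by auto
      then have "x * (of_int b * of_nat p powi (- e)) = of_int a"
        using ab(3) p_rat by (simp add: power_int_minus)
      ultimately have "pdvd (int 1) (of_int a)" by simp
      then show False using ab pdvd_int[of 1 a] by simp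
    qed
  qed
  moreover have "real p powi (- e) \<le> real p powi (- k) \<longleftrightarrow> k \<le> e"
    using power_int_increasing[of "- e" "- k" "real p"] power_int_strict_increasing[of "- k" "- e" "real p"] p1
    by (cases "k \<le> e") (auto simp: not_le)
  ultimately show ?thesis using ab by simp
qed (auto simp: padic_abs_def)

lemma small_power:
  assumes "e > 0"
  obtains k :: nat where "real p powi (- int k) < e"
proof -
  have "1 < real p" using p prime_gt_1_nat by simp
  then obtain k where "1 / e < real p ^ k" using real_arch_pow by blast
  then have "real p powi (- int k) < e"
    using assms \<open>1 < real p\<close> by (simp add: power_int_minus field_simps)
  then show ?thesis using that by blast
qed

lemma padic_Cauchy_iff:
  "padic_Cauchy p a \<longleftrightarrow> (\<forall>k::nat. \<exists>N. \<forall>m\<ge>N. \<forall>n\<ge>N. pdvd (int k) (a m - a n))"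
proof
  assume C: "padic_Cauchy p a"
  show "\<forall>k::nat. \<exists>N. \<forall>m\<ge>N. \<forall>n\<ge>N. pdvd (int k) (a m - a n)"
  proof
    fix k :: nat
    have "real p powi (- int k) > 0" using p prime_gt_0_nat by simp
    then obtain N where "\<forall>m\<ge>N. \<forall>n\<ge>N. padic_abs p (a m - a n) < real p powi (- int k)"
      using C unfolding padic_Cauchy_def by blast
    then show "\<exists>N. \<forall>m\<ge>N. \<forall>n\<ge>N. pdvd (int k) (a m - a n)"
      unfolding pdvd_iff by (meson order_less_imp_le)
  qed
next
  assume C: "\<forall>k::nat. \<exists>N. \<forall>m\<ge>N. \<forall>n\<ge>N. pdvd (int k) (a m - a n)"
  show "padic_Cauchy p a"
    unfolding padic_Cauchy_def
  proof (intro allI impI)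
    fix e :: real assume "e > 0"
    then obtain k :: nat where "real p powi (- int k) < e" by (rule small_power)
    then show "\<exists>N. \<forall>m\<ge>N. \<forall>n\<ge>N. padic_abs p (a m - a n) < e"
      using C unfolding pdvd_iff by (meson order_le_less_trans)
  qed
qed

lemma padic_null_iff:
  "padic_null p a \<longleftrightarrow> (\<forall>k::nat. \<exists>N. \<forall>n\<ge>N. pdvd (int k) (a n))"
proof -
  have nonneg: "padic_abs p x \<ge> 0" for x
    unfolding padic_abs_def by (auto split: prod.splits)
  have "padic_null p a \<longleftrightarrow> (\<forall>e>0. \<exists>N. \<forall>n\<ge>N. padic_abs p (a n) < e)"
    unfolding padic_null_def LIMSEQ_iff using nonneg by simp
  also have "\<dots> \<longleftrightarrow> (\<forall>k::nat. \<exists>N. \<forall>n\<ge>N. pdvd (int k) (a n))"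
  proof
    assume C: "\<forall>e>0. \<exists>N. \<forall>n\<ge>N. padic_abs p (a n) < e"
    show "\<forall>k::nat. \<exists>N. \<forall>n\<ge>N. pdvd (int k) (a n)"
    proof
      fix k :: nat
      have "real p powi (- int k) > 0" using p prime_gt_0_nat by simp
      then show "\<exists>N. \<forall>n\<ge>N. pdvd (int k) (a n)"
        using C unfolding pdvd_iff by (meson order_less_imp_le)
    qed
  next
    assume C: "\<forall>k::nat. \<exists>N. \<forall>n\<ge>N. pdvd (int k) (a n)"
    show "\<forall>e>0. \<exists>N. \<forall>n\<ge>N. padic_abs p (a n) < e"
    proof (intro allI impI)
      fix e :: real assume "e > 0"
      then obtain k :: nat where "real p powi (- int k) < e" by (rule small_power)
      then show "\<exists>N. \<forall>n\<ge>N. padic_abs p (a n) < e"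
        using C unfolding pdvd_iff by (meson order_le_less_trans)
    qed
  qed
  finally show ?thesis .
qed

lemma pdvd_some: "\<exists>k::nat. pdvd (- int k) x"
proof (cases "x = 0")
  case False
  obtain a b :: int and e where ab: "\<not> int p dvd b" "x = of_int a / of_int b * of_nat p powi e"
    using multiplicity_quotient[OF False] by metis
  then have "pdvd e x" by (intro pdvd_I)
  then have "pdvd (- int (nat (- e))) x" by (rule pdvd_mono) auto
  then show ?thesis by blast
qed auto

lemma Cauchy_bounded:
  assumes "padic_Cauchy p a"
  obtains k :: nat where "\<And>n. pdvd (- int k) (a n)"
proof -
  obtain N where N: "\<forall>m\<ge>N. \<forall>n\<ge>N. pdvd (int 0) (a m - a n)"
    using assms unfolding padic_Cauchy_iff by blast
  have "\<forall>n. \<exists>k::nat. pdvd (- int k) (a n)" using pdvd_some by blast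
  from choice[OF this] obtain f :: "nat \<Rightarrow> nat" where f: "\<And>n. pdvd (- int (f n)) (a n)" by blast
  define k where "k = Max (f ` {..N})"
  have small: "pdvd (- int k) (a n)" if "n \<le> N" for n
    using f[of n] by (rule pdvd_mono) (use that in \<open>auto simp: k_def\<close>)
  have "pdvd (- int k) (a n)" for n
  proof (cases "n \<le> N")
    case False
    then have "pdvd 0 (a n - a N)" using N by simp
    then have "pdvd (- int k) (a n - a N)" by (rule pdvd_mono) simp
    from pdvd_add[OF this small[of N]] show ?thesis by simp
  qed (rule small)
  then show ?thesis using that by blast
qed

lemma Cauchy_add:
  assumes "padic_Cauchy p a" "padic_Cauchy p b"
  shows "padic_Cauchy p (\<lambda>n. a n + b n)"
  unfolding padic_Cauchy_iff
proof
  fix k :: nat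
  obtain N where N: "\<forall>m\<ge>N. \<forall>n\<ge>N. pdvd (int k) (a m - a n)" using assms(1) unfolding padic_Cauchy_iff by blast
  obtain M where M: "\<forall>m\<ge>M. \<forall>n\<ge>M. pdvd (int k) (b m - b n)" using assms(2) unfolding padic_Cauchy_iff by blast
  show "\<exists>N. \<forall>m\<ge>N. \<forall>n\<ge>N. pdvd (int k) (a m + b m - (a n + b n))"
  proof (intro exI[of _ "max N M"] allI impI)
    fix m n assume "max N M \<le> m" "max N M \<le> n"
    then have "pdvd (int k) ((a m - a n) + (b m - b n))" using N M by (intro pdvd_add) auto
    then show "pdvd (int k) (a m + b m - (a n + b n))" by (simp add: algebra_simps)
  qed
qed

lemma Cauchy_mult:
  assumes "padic_Cauchy p a" "padic_Cauchy p b"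
  shows "padic_Cauchy p (\<lambda>n. a n * b n)"
  unfolding padic_Cauchy_iff
proof
  fix k :: nat
  obtain r where r: "\<And>n. pdvd (- int r) (a n)" using Cauchy_bounded[OF assms(1)] by blast
  obtain s where s: "\<And>n. pdvd (- int s) (b n)" using Cauchy_bounded[OF assms(2)] by blast
  obtain N where N: "\<forall>m\<ge>N. \<forall>n\<ge>N. pdvd (int (k + s)) (a m - a n)" using assms(1) unfolding padic_Cauchy_iff by blast
  obtain M where M: "\<forall>m\<ge>M. \<forall>n\<ge>M. pdvd (int (k + r)) (b m - b n)" using assms(2) unfolding padic_Cauchy_iff by blast
  show "\<exists>N. \<forall>m\<ge>N. \<forall>n\<ge>N. pdvd (int k) (a m * b m - a n * b n)"
  proof (intro exI[of _ "max N M"] allI impI)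
    fix m n assume *: "max N M \<le> m" "max N M \<le> n"
    have "pdvd (int (k + s) + - int s) ((a m - a n) * b m)" using * N s by (intro pdvd_mult) auto
    moreover have "pdvd (- int r + int (k + r)) (a n * (b m - b n))" using * M r by (intro pdvd_mult) auto
    ultimately have "pdvd (int k) ((a m - a n) * b m + a n * (b m - b n))" by (intro pdvd_add) auto
    then show "pdvd (int k) (a m * b m - a n * b n)" by (simp add: algebra_simps)
  qed
qed

lemma Cauchy_const: "padic_Cauchy p (\<lambda>_. c)"
  by (simp add: padic_Cauchy_iff)

lemma Cauchy_minus: "padic_Cauchy p a \<Longrightarrow> padic_Cauchy p (\<lambda>n. - a n)"
  using Cauchy_mult[OF Cauchy_const[of "-1"], of a] by simp

lemma Cauchy_diff:
  assumes "padic_Cauchy p a" "padic_Cauchy p b"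
  shows "padic_Cauchy p (\<lambda>n. a n - b n)"
  using Cauchy_add[OF assms(1) Cauchy_minus[OF assms(2)]] by simp

lemma null_Cauchy:
  assumes "padic_null p a"
  shows "padic_Cauchy p a"
  unfolding padic_Cauchy_iff
proof
  fix k :: nat
  obtain N where "\<forall>n\<ge>N. pdvd (int k) (a n)" using assms unfolding padic_null_iff by blast
  then show "\<exists>N. \<forall>m\<ge>N. \<forall>n\<ge>N. pdvd (int k) (a m - a n)"
    by (intro exI[of _ N]) (auto intro: pdvd_diff)
qed

lemma null_diff:
  assumes "padic_null p a" "padic_null p b"
  shows "padic_null p (\<lambda>n. a n - b n)"
  unfolding padic_null_iff
proof
  fix k :: nat
  obtain N where N: "\<forall>n\<ge>N. pdvd (int k) (a n)" using assms(1) unfolding padic_null_iff by blast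
  obtain M where M: "\<forall>n\<ge>M. pdvd (int k) (b n)" using assms(2) unfolding padic_null_iff by blast
  show "\<exists>N. \<forall>n\<ge>N. pdvd (int k) (a n - b n)"
    using N M by (intro exI[of _ "max N M"]) (auto intro: pdvd_diff)
qed

lemma null_mult:
  assumes "padic_Cauchy p a" "padic_null p b"
  shows "padic_null p (\<lambda>n. a n * b n)"
  unfolding padic_null_iff
proof
  fix k :: nat
  obtain r where r: "\<And>n. pdvd (- int r) (a n)" using Cauchy_bounded[OF assms(1)] by blast
  obtain M where M: "\<forall>n\<ge>M. pdvd (int (k + r)) (b n)" using assms(2) unfolding padic_null_iff by blast
  show "\<exists>N. \<forall>n\<ge>N. pdvd (int k) (a n * b n)"
  proof (intro exI[of _ M] allI impI)
    fix n assume *: "M \<le> n"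
    have "pdvd (- int r + int (k + r)) (a n * b n)" using * M r by (intro pdvd_mult) auto
    then show "pdvd (int k) (a n * b n)" by simp
  qed
qed

lemma null_0: "padic_null p (\<lambda>_. 0)"
  by (simp add: padic_null_iff)

lemma padic_Cauchy_cring: "cring (padic_Cauchy_ring p)"
proof (rule cringI)
  show "abelian_group (padic_Cauchy_ring p)"
  proof (rule abelian_groupI)
    fix a assume "a \<in> carrier (padic_Cauchy_ring p)"
    then show "\<exists>b\<in>carrier (padic_Cauchy_ring p). b \<oplus>\<^bsub>padic_Cauchy_ring p\<^esub> a = \<zero>\<^bsub>padic_Cauchy_ring p\<^esub>"
      by (intro bexI[of _ "\<lambda>n. - a n"]) (auto simp: padic_Cauchy_ring_def intro: Cauchy_minus)
  qed (auto simp: padic_Cauchy_ring_def Cauchy_add Cauchy_const algebra_simps)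
  show "Group.comm_monoid (padic_Cauchy_ring p)"
    by (rule comm_monoidI) (auto simp: padic_Cauchy_ring_def Cauchy_mult Cauchy_const algebra_simps)
qed (auto simp: padic_Cauchy_ring_def algebra_simps)

lemma padic_null_ideal: "ideal {a. padic_null p a} (padic_Cauchy_ring p)"
proof (rule idealI)
  interpret cring "padic_Cauchy_ring p" by (rule padic_Cauchy_cring)
  show "ring (padic_Cauchy_ring p)" by (rule ring_axioms)
  show "subgroup {a. padic_null p a} (add_monoid (padic_Cauchy_ring p))"
  proof (rule add.subgroupI)
    show "{a. padic_null p a} \<subseteq> carrier (padic_Cauchy_ring p)"
      by (auto simp: padic_Cauchy_ring_def null_Cauchy)
    show "{a. padic_null p a} \<noteq> {}" using null_0 by blast
  next
    fix a assume a: "a \<in> {a. padic_null p a}"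
    then have *: "padic_null p (\<lambda>n. - a n)" using null_diff[OF null_0] by force
    have "\<ominus>\<^bsub>padic_Cauchy_ring p\<^esub> a = (\<lambda>n. - a n)"
      by (rule minus_equality) (use a null_Cauchy null_Cauchy[OF *] in \<open>auto simp: padic_Cauchy_ring_def\<close>)
    then show "\<ominus>\<^bsub>padic_Cauchy_ring p\<^esub> a \<in> {a. padic_null p a}" using * by simp
  next
    fix a b assume ab: "a \<in> {a. padic_null p a}" "b \<in> {a. padic_null p a}"
    then have "padic_null p (\<lambda>n. a n - (0 - b n))" by (intro null_diff null_0) auto
    then show "a \<oplus>\<^bsub>padic_Cauchy_ring p\<^esub> b \<in> {a. padic_null p a}" by (simp add: padic_Cauchy_ring_def)
  qed
next
  fix a x assume "a \<in> {a. padic_null p a}" "x \<in> carrier (padic_Cauchy_ring p)"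
  then have "padic_null p (\<lambda>n. x n * a n)" by (intro null_mult) (auto simp: padic_Cauchy_ring_def)
  then show "x \<otimes>\<^bsub>padic_Cauchy_ring p\<^esub> a \<in> {a. padic_null p a}" "a \<otimes>\<^bsub>padic_Cauchy_ring p\<^esub> x \<in> {a. padic_null p a}"
    by (auto simp: padic_Cauchy_ring_def mult.commute)
qed

end

text \<open>A homomorphism out of the p-adic numbers is recorded as a map on Cauchy sequences that
  kills null sequences, so that later arguments handle sequences in place of cosets.\<close>

locale padic_hom =
  fixes p :: nat and H :: "(nat \<Rightarrow> rat) \<Rightarrow> 'a::field"
  assumes p: "prime p"
    and H_add: "padic_Cauchy p a \<Longrightarrow> padic_Cauchy p b \<Longrightarrow> H (\<lambda>n. a n + b n) = H a + H b"
    and H_mult: "padic_Cauchy p a \<Longrightarrow> padic_Cauchy p b \<Longrightarrow> H (\<lambda>n. a n * b n) = H a * H b"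
    and H_one: "H (\<lambda>n. 1) = 1"
    and H_null: "padic_null p a \<Longrightarrow> H a = 0"

lemma padic_hom_of_ring_hom:
  assumes p: "prime p" and h: "h \<in> ring_hom (Qp p) (ring_of_type_algebra :: 'k::field ring)"
    and g: "g 0 = (0 :: 'a::field)" "g 1 = 1" "\<And>x y. g (x + y) = g x + g y" "\<And>x y. g (x * y) = g x * g y"
  shows "\<exists>H. padic_hom p H \<and> H ` {a. padic_Cauchy p a} = g ` h ` carrier (Qp p)"
proof -
  let ?R = "padic_Cauchy_ring p" and ?I = "{a. padic_null p a}"
  interpret ideal ?I ?R by (rule padic_null_ideal[OF p])
  define c where "c = (\<lambda>a. ?I +>\<^bsub>?R\<^esub> a)"
  have chom: "c \<in> ring_hom ?R (Qp p)"
    using rcos_ring_hom unfolding c_def Qp_def by simp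
  have hc: "h \<circ> c \<in> ring_hom ?R (ring_of_type_algebra :: 'k ring)"
    by (rule ring_hom_trans[OF chom h])
  have carr: "carrier (Qp p) = c ` carrier ?R"
    by (auto simp: Qp_def FactRing_def A_RCOSETS_def RCOSETS_def c_def a_r_coset_def)
  have Rc: "carrier ?R = {a. padic_Cauchy p a}" by (simp add: padic_Cauchy_ring_def)
  let ?H = "\<lambda>a. g (h (c a))"
  have add: "h (c (\<lambda>n. a n + b n)) = h (c a) + h (c b)" if "padic_Cauchy p a" "padic_Cauchy p b" for a b
    using ring_hom_add[OF hc, of a b] that Rc by (simp add: padic_Cauchy_ring_def ring_of_type_algebra_def)
  have mult: "h (c (\<lambda>n. a n * b n)) = h (c a) * h (c b)" if "padic_Cauchy p a" "padic_Cauchy p b" for a b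
    using ring_hom_mult[OF hc, of a b] that Rc by (simp add: padic_Cauchy_ring_def ring_of_type_algebra_def)
  have one: "h (c (\<lambda>n. 1)) = 1"
    using ring_hom_one[OF hc] by (simp add: padic_Cauchy_ring_def ring_of_type_algebra_def)
  have zero: "h (c (\<lambda>n. 0)) = 0"
    using add[of "\<lambda>_. 0" "\<lambda>_. 0"] Cauchy_const[OF p, of 0]
    by (metis add_cancel_right_right)
  have null: "h (c a) = 0" if "padic_null p a" for a
  proof -
    have "c a = c (\<lambda>n. 0)"
      unfolding c_def using a_coset_join2[OF _ a_subgroup] that null_0[OF p] null_Cauchy[OF p] Rc
      by (metis (no_types, lifting) mem_Collect_eq Cauchy_const[OF p])
    then show ?thesis using zero by simp
  qed
  have "padic_hom p ?H"
    by unfold_locales (use p add mult one null g in auto)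
  moreover have "?H ` {a. padic_Cauchy p a} = g ` h ` carrier (Qp p)"
    unfolding carr Rc by (simp add: image_image)
  ultimately show ?thesis by blast
qed

section \<open>p-adic integers as coherent sequences of integers\<close>

context padic_hom
begin

definition Q :: "'a set" where "Q = H ` {a. padic_Cauchy p a}"

text \<open>Coherent sequences represent the p-adic integers.\<close>

definition coherent :: "(nat \<Rightarrow> int) \<Rightarrow> bool" where
  "coherent u \<longleftrightarrow> (\<forall>n. [u (Suc n) = u n] (mod int p ^ Suc n))"

definition Z :: "(nat \<Rightarrow> int) \<Rightarrow> 'a" where
  "Z u = H (\<lambda>n. of_int (u n))"

lemmas Cauchy_rules = Cauchy_const[OF p] Cauchy_add[OF p] Cauchy_mult[OF p] Cauchy_minus[OF p] Cauchy_diff[OF p]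

lemma p_pos: "p > 0" "p > 1" "int p > 0"
  using p prime_gt_0_nat prime_gt_1_nat by auto

lemma H_diff: "padic_Cauchy p a \<Longrightarrow> padic_Cauchy p b \<Longrightarrow> H (\<lambda>n. a n - b n) = H a - H b"
  using H_add[of "\<lambda>n. a n - b n" b] Cauchy_rules by simp

lemma H_eq:
  assumes "padic_Cauchy p a" "padic_Cauchy p b" "padic_null p (\<lambda>n. a n - b n)"
  shows "H a = H b"
  using H_diff[OF assms(1,2)] H_null[OF assms(3)] by simp

lemma H_zero: "H (\<lambda>n. 0) = 0"
  using H_null[OF null_0[OF p]] .

lemma H_of_nat: "H (\<lambda>_. of_nat n) = of_nat n"
  by (induction n) (use H_add[OF Cauchy_const[OF p] Cauchy_const[OF p], of 1] H_one H_zero in auto)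

lemma H_of_int: "H (\<lambda>_. of_int n) = of_int n"
proof (cases n)
  case (neg m)
  have "H (\<lambda>_. 0 - of_nat (Suc m)) = 0 - of_nat (Suc m)"
    using H_diff[OF Cauchy_const[OF p] Cauchy_const[OF p], of 0 "of_nat (Suc m)"] H_of_nat[of "Suc m"] H_zero
    by simp
  then show ?thesis using neg by (simp del: of_nat_Suc)
qed (use H_of_nat in simp)

lemma coherent_cong:
  assumes "coherent u" "n \<le> m"
  shows "[u m = u n] (mod int p ^ Suc n)"
  using assms(2)
proof (induction m rule: dec_induct)
  case (step m)
  have "[u (Suc m) = u m] (mod int p ^ Suc m)" using assms(1) by (simp add: coherent_def)
  then have "[u (Suc m) = u m] (mod int p ^ Suc n)"
    by (rule cong_dvd_modulus) (use step in \<open>auto intro: le_imp_power_dvd simp del: power_Suc\<close>)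
  then show ?case using step cong_trans by blast
qed simp

lemma coherent_Cauchy:
  assumes "coherent u"
  shows "padic_Cauchy p (\<lambda>n. of_int (u n))"
  unfolding padic_Cauchy_iff[OF p]
proof
  fix k :: nat
  have "pdvd p (int k) (of_int (u m) - of_int (u n))" if "m \<ge> k" "n \<ge> k" for m n
  proof -
    have "[u m = u n] (mod int p ^ Suc k)"
      using coherent_cong[OF assms that(1)] coherent_cong[OF assms that(2)] cong_sym cong_trans by blast
    then have "int p ^ Suc k dvd u m - u n" by (simp add: cong_iff_dvd_diff)
    then have "int p ^ k dvd u m - u n" by (metis dvd_trans le_imp_power_dvd lessI less_imp_le)
    then show ?thesis using pdvd_int[OF p, of k "u m - u n"] by simp
  qed
  then show "\<exists>N. \<forall>m\<ge>N. \<forall>n\<ge>N. pdvd p (int k) (of_int (u m) - of_int (u n))" by blast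
qed

lemma null_int:
  assumes "\<And>n. int p ^ Suc n dvd u n"
  shows "padic_null p (\<lambda>n. of_int (u n))"
  unfolding padic_null_iff[OF p]
proof
  fix k :: nat
  have "pdvd p (int k) (of_int (u n))" if "n \<ge> k" for n
    unfolding pdvd_int[OF p] using assms[of n] that by (meson dvd_trans le_SucI le_imp_power_dvd)
  then show "\<exists>N. \<forall>n\<ge>N. pdvd p (int k) (of_int (u n))" by blast
qed

lemma Z_eq:
  assumes "coherent u" "coherent w" "\<And>n. [u n = w n] (mod int p ^ Suc n)"
  shows "Z u = Z w"
  unfolding Z_def
proof (rule H_eq)
  show "padic_null p (\<lambda>n. of_int (u n) - of_int (w n))"
    using null_int[of "\<lambda>n. u n - w n"] assms(3) by (simp add: cong_iff_dvd_diff)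
qed (use assms coherent_Cauchy in auto)

lemma coherent_const: "coherent (\<lambda>_. c)" by (simp add: coherent_def)
lemma coherent_diff: "coherent u \<Longrightarrow> coherent w \<Longrightarrow> coherent (\<lambda>n. u n - w n)"
  by (auto simp: coherent_def intro: cong_diff)
lemma coherent_mult: "coherent u \<Longrightarrow> coherent w \<Longrightarrow> coherent (\<lambda>n. u n * w n)"
  by (auto simp: coherent_def intro: cong_mult)
lemma coherent_power: "coherent u \<Longrightarrow> coherent (\<lambda>n. u n ^ k)"
  by (auto simp: coherent_def intro: cong_pow)

lemma Z_const: "Z (\<lambda>_. c) = of_int c"
  unfolding Z_def by (rule H_of_int)
lemma Z_diff: "coherent u \<Longrightarrow> coherent w \<Longrightarrow> Z (\<lambda>n. u n - w n) = Z u - Z w"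
  using H_diff[OF coherent_Cauchy coherent_Cauchy] by (simp add: Z_def)
lemma Z_mult: "coherent u \<Longrightarrow> coherent w \<Longrightarrow> Z (\<lambda>n. u n * w n) = Z u * Z w"
  using H_mult[OF coherent_Cauchy coherent_Cauchy] by (simp add: Z_def)
lemma Z_power: "coherent u \<Longrightarrow> Z (\<lambda>n. u n ^ k) = Z u ^ k"
  by (induction k) (use Z_const[of 1] in \<open>auto simp: Z_mult coherent_power\<close>)

lemma Z_in_Q: "coherent u \<Longrightarrow> Z u \<in> Q"
  using coherent_Cauchy by (auto simp: Z_def Q_def)

text \<open>Entry \<open>n\<close> is precise modulo \<open>p ^ Suc n\<close>. Division by
  \<open>p ^ k\<close> costs \<open>k\<close> digits, so the quotient is read from the entries
  shifted by \<open>k\<close>; shifting alone does not change the p-adic integer.\<close>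

lemma coherent_shift:
  assumes u: "coherent u" and d: "int p ^ k dvd u k"
  shows "\<exists>w. coherent w \<and> Z u = of_nat p ^ k * Z w \<and> (\<forall>m. u (k + m) = int p ^ k * w m)"
proof -
  have dv: "int p ^ k dvd u (k + m)" for m
  proof -
    have "int p ^ Suc k dvd u (k + m) - u k"
      using coherent_cong[OF u, of k "k + m"] by (simp add: cong_iff_dvd_diff)
    then have "int p ^ k dvd u (k + m) - u k" by (metis dvd_trans le_imp_power_dvd lessI less_imp_le)
    from dvd_add[OF this d] show ?thesis by simp
  qed
  define w where "w = (\<lambda>m. u (k + m) div int p ^ k)"
  have w: "u (k + m) = int p ^ k * w m" for m using dv by (simp add: w_def)
  have cw: "coherent w"
    unfolding coherent_def
  proof
    fix m
    have "int p ^ Suc (k + m) dvd u (Suc (k + m)) - u (k + m)"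
      using u unfolding coherent_def by (simp add: cong_iff_dvd_diff)
    then have "int p ^ k * int p ^ Suc m dvd int p ^ k * (w (Suc m) - w m)"
      using w[of m] w[of "Suc m"] by (simp add: power_add right_diff_distrib mult.assoc mult.left_commute)
    then have "int p ^ Suc m dvd w (Suc m) - w m" using p_pos by (simp only: dvd_mult_cancel_left) simp
    then show "[w (Suc m) = w m] (mod int p ^ Suc m)" by (simp add: cong_iff_dvd_diff)
  qed
  have "Z u = Z (\<lambda>m. int p ^ k * w m)"
  proof (rule Z_eq)
    fix n show "[u n = int p ^ k * w n] (mod int p ^ Suc n)"
      using coherent_cong[OF u, of n "k + n"] w[of n] by (simp add: cong_sym)
  qed (use u cw in \<open>auto intro: coherent_mult coherent_const\<close>)
  also have "\<dots> = of_nat p ^ k * Z w"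
    using Z_mult[OF coherent_const cw] Z_const[of "int p ^ k"] by simp
  finally show ?thesis using cw w by blast
qed

lemma coherent_cases:
  assumes u: "coherent u"
  obtains "Z u = 0" | k w where "coherent w" "\<not> int p dvd w 0" "Z u = of_nat p ^ k * Z w"
proof (cases "\<forall>n. int p ^ Suc n dvd u n")
  case True
  then have "Z u = 0" unfolding Z_def using H_null[OF null_int] by blast
  then show ?thesis using that by blast
next
  case False
  \<comment> \<open>The first entry that is nonzero to its precision; \<open>k\<close> is the p-adic
    order. That \<open>p ^ k\<close> still divides \<open>u k\<close> is inherited from the entry
    before it, which vanishes modulo \<open>p ^ k\<close>.\<close>
  define k where "k = (LEAST n. \<not> int p ^ Suc n dvd u n)"
  have k: "\<not> int p ^ Suc k dvd u k" unfolding k_def using False by (metis (mono_tags, lifting) LeastI)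
  have "int p ^ k dvd u k"
  proof (cases k)
    case (Suc j)
    then have "int p ^ Suc j dvd u j" using not_less_Least[of j "\<lambda>n. \<not> int p ^ Suc n dvd u n"] k_def by auto
    moreover have "int p ^ Suc j dvd u k - u j"
      using coherent_cong[OF u, of j k] Suc by (simp add: cong_iff_dvd_diff)
    ultimately have "int p ^ Suc j dvd u k - u j + u j" by (intro dvd_add)
    then show ?thesis using Suc by simp
  qed simp
  then obtain w where w: "coherent w" "Z u = of_nat p ^ k * Z w" "\<And>m. u (k + m) = int p ^ k * w m"
    using coherent_shift[OF u] by blast
  have "\<not> int p dvd w 0"
    using w(3)[of 0] k p_pos by auto
  then show ?thesis using that w by blast
qed

text \<open>The constant sequence \<open>1 / n\<close> is sent to an inverse of
  \<open>n\<close>.\<close>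

lemma char0: "n > 0 \<Longrightarrow> of_nat n \<noteq> (0::'a)"
  using H_mult[OF Cauchy_const[OF p] Cauchy_const[OF p], of "of_nat n" "1 / of_nat n"] H_of_nat[of n] H_one
  by auto

lemma H_p_power: "H (\<lambda>_. of_nat p powi k) = of_nat p powi k"
proof (cases "k \<ge> 0")
  case True
  then show ?thesis using H_of_nat[of "p ^ nat k"] by (simp add: power_int_def)
next
  case False
  have "H (\<lambda>_. of_nat p powi k) * H (\<lambda>_. of_nat (p ^ nat (- k))) = 1"
    using H_mult[OF Cauchy_const[OF p] Cauchy_const[OF p], of "of_nat p powi k" "of_nat (p ^ nat (- k))"]
      H_one False p_pos by (simp add: power_int_def power_inverse)
  then have "H (\<lambda>_. of_nat p powi k) * of_nat p ^ nat (- k) = 1"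
    using H_of_nat[of "p ^ nat (- k)"] by simp
  then have "inverse (of_nat p ^ nat (- k)) = H (\<lambda>_. of_nat p powi k)"
    by (intro inverse_unique) (simp add: mult.commute)
  then show ?thesis using False by (simp add: power_int_def power_inverse)
qed

lemma coprime_p: "\<not> int p dvd b \<Longrightarrow> coprime b (int p ^ k)"
  using prime_imp_coprime[of "int p" b] p by (simp add: coprime_commute)

lemma approx_int:
  assumes "pdvd p 0 x"
  shows "\<exists>z. pdvd p (int k) (x - of_int z)"
proof -
  obtain a b where ab: "\<not> int p dvd b" "b \<noteq> 0" "x = of_int a / of_int b * of_nat p powi 0"
    using assms by (rule pdvd_E[OF p])
  have "coprime b (int p ^ k)" using coprime_p ab(1) .
  then obtain c where c: "[b * c = 1] (mod int p ^ k)" using cong_solve_coprime_int by blast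
  have "int p ^ k dvd a - b * (c * a)"
    using cong_mult[OF c cong_refl[of a]] by (simp add: cong_iff_dvd_diff dvd_diff_commute mult.assoc)
  then obtain d where d: "a - b * (c * a) = int p ^ k * d" by (auto elim: dvdE)
  have "x - of_int (c * a) = of_int (a - b * (c * a)) / of_int b"
    using ab by (simp add: field_simps)
  also have "\<dots> = of_int d / of_int b * of_nat p powi int k"
    unfolding d by simp
  finally show ?thesis using pdvd_I[OF p ab(1)] by blast
qed

text \<open>A common power of \<open>p\<close> clears the denominators; then a subsequence
  converging at the rate \<open>p ^ Suc k\<close> is rounded to integers by
  \<open>approx_int\<close>.\<close>

lemma Q_cases:
  assumes "x \<in> Q"
  obtains k u where "coherent u" "x = of_nat p powi k * Z u"
proof -
  obtain a where a: "padic_Cauchy p a" "x = H a" using assms by (auto simp: Q_def)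
  obtain r where r: "\<And>n. pdvd p (- int r) (a n)" using Cauchy_bounded[OF p a(1)] by blast
  define c where "c = (\<lambda>n. of_nat p powi int r * a n)"
  have cC: "padic_Cauchy p c" unfolding c_def by (intro Cauchy_rules a)
  have "pdvd p (int r) (of_nat p powi int r)"
    using pdvd_int[OF p, of r "int p ^ r"] by simp
  then have c0: "pdvd p 0 (c n)" for n
    using pdvd_mult[OF p _ r[of n], of "int r"] by (simp add: c_def)
  have "\<exists>N. \<forall>m\<ge>N. \<forall>n\<ge>N. pdvd p (int (Suc k)) (c m - c n)" for k
    using cC unfolding padic_Cauchy_iff[OF p] by blast
  then obtain f where f: "\<And>k m n. m \<ge> f k \<Longrightarrow> n \<ge> f k \<Longrightarrow> pdvd p (int (Suc k)) (c m - c n)"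
    by metis
  \<comment> \<open>\<open>M k\<close> lies beyond every threshold \<open>f j\<close> with
    \<open>j \<le> k\<close>, so consecutive roundings agree to the required precision.\<close>
  define M where "M = (\<lambda>k. Max (f ` {..k}) + k)"
  have M: "f j \<le> M k" if "j \<le> k" for j k
  proof -
    have "f j \<le> Max (f ` {..k})" using that by (intro Max_ge) auto
    then show ?thesis by (simp add: M_def)
  qed
  have "\<forall>k. \<exists>z. pdvd p (int (Suc k)) (c (M k) - of_int z)" using approx_int[OF c0] by blast
  from choice[OF this] obtain u where u: "\<And>k. pdvd p (int (Suc k)) (c (M k) - of_int (u k))"
    by blast
  have co: "coherent u"
    unfolding coherent_def
  proof
    fix n
    have "pdvd p (int (Suc n)) (c (M (Suc n)) - of_int (u (Suc n)))"
      by (rule pdvd_mono[OF p u]) simp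
    moreover have "pdvd p (int (Suc n)) (c (M (Suc n)) - c (M n))" using f M by simp
    ultimately have "pdvd p (int (Suc n)) ((c (M (Suc n)) - c (M n)) - (c (M (Suc n)) - of_int (u (Suc n))))"
      using pdvd_diff[OF p] by blast
    from pdvd_add[OF p this u[of n]] have "pdvd p (int (Suc n)) (of_int (u (Suc n) - u n))"
      by simp
    then show "[u (Suc n) = u n] (mod int p ^ Suc n)"
      unfolding pdvd_int[OF p] by (simp add: cong_iff_dvd_diff)
  qed
  have "H c = Z u"
    unfolding Z_def
  proof (rule H_eq[OF cC coherent_Cauchy[OF co]])
    show "padic_null p (\<lambda>n. c n - of_int (u n))"
      unfolding padic_null_iff[OF p]
    proof
      fix k :: nat
      have "pdvd p (int k) (c n - of_int (u n))" if "n \<ge> f k + k" for n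
      proof -
        have "M n \<ge> f k" using M[of k n] that by simp
        then have "pdvd p (int (Suc k)) (c n - c (M n))" using f that by simp
        then have "pdvd p (int k) (c n - c (M n))" by (rule pdvd_mono[OF p]) simp
        moreover have "pdvd p (int k) (c (M n) - of_int (u n))"
          by (rule pdvd_mono[OF p u]) (use that in simp)
        ultimately show ?thesis using pdvd_add[OF p] by fastforce
      qed
      then show "\<exists>N. \<forall>n\<ge>N. pdvd p (int k) (c n - of_int (u n))" by blast
    qed
  qed
  moreover have "H c = of_nat p powi int r * x"
    unfolding c_def a using H_mult[OF Cauchy_const[OF p] a(1)] H_p_power[of "int r"] by simp
  ultimately have "x = of_nat p powi (- int r) * Z u"
    using char0[OF p_pos(1)] by (simp add: power_int_minus field_simps)
  then show ?thesis using that co by blast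
qed

text \<open>Inverses modulo \<open>p ^ Suc n\<close> are unique, so inverses chosen separately at
  each level are automatically coherent.\<close>

lemma unit_inverse:
  assumes u: "coherent u" "\<not> int p dvd u 0"
  shows "\<exists>w. coherent w \<and> Z u * Z w = 1"
proof -
  have un: "\<not> int p dvd u n" for n
  proof
    assume "int p dvd u n"
    moreover have "int p dvd u n - u 0"
      using coherent_cong[OF u(1), of 0 n] by (simp add: cong_iff_dvd_diff)
    ultimately have "int p dvd u n - (u n - u 0)" by (rule dvd_diff)
    then show False using u by simp
  qed
  have cop: "coprime (u n) (int p ^ k)" for n k
    using un coprime_p by blast
  have "\<exists>c. [u n * c = 1] (mod int p ^ Suc n)" for n
    using cong_solve_coprime_int[OF cop] by blast
  then obtain w where w: "\<And>n. [u n * w n = 1] (mod int p ^ Suc n)" by metis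
  have co: "coherent w"
    unfolding coherent_def
  proof
    fix n
    have 1: "[u n * w (Suc n) = u (Suc n) * w (Suc n)] (mod int p ^ Suc n)"
      using u(1) by (intro cong_mult cong_refl) (simp add: coherent_def cong_sym)
    have 2: "[u (Suc n) * w (Suc n) = 1] (mod int p ^ Suc n)"
      by (rule cong_dvd_modulus[OF w]) simp
    have "[u n * w (Suc n) = u n * w n] (mod int p ^ Suc n)"
      using 1 2 w[of n] cong_trans cong_sym by meson
    then show "[w (Suc n) = w n] (mod int p ^ Suc n)"
      using cong_mult_lcancel[OF cop] by blast
  qed
  have "Z (\<lambda>n. u n * w n) = Z (\<lambda>_. 1)"
    by (rule Z_eq) (use u co w in \<open>auto intro: coherent_mult coherent_const\<close>)
  then show ?thesis using Z_mult[OF u(1) co] Z_const[of 1] co by auto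
qed

lemma Q_field: "sub_field Q"
  unfolding sub_field_def sub_ring_def
proof (intro conjI ballI)
  show "1 \<in> Q" using H_one Cauchy_const[OF p, of 1] by (force simp: Q_def image_iff)
next
  fix x y assume "x \<in> Q" "y \<in> Q"
  then obtain a b where ab: "padic_Cauchy p a" "x = H a" "padic_Cauchy p b" "y = H b" by (auto simp: Q_def)
  then have "x - y = H (\<lambda>n. a n - b n)" "x * y = H (\<lambda>n. a n * b n)" by (simp_all add: H_diff H_mult)
  then show "x - y \<in> Q" "x * y \<in> Q" using ab Cauchy_rules by (auto simp: Q_def)
next
  fix x assume "x \<in> Q"
  then obtain k u where ku: "coherent u" "x = of_nat p powi k * Z u" using Q_cases by blast
  have mult: "x * y \<in> Q" if xy: "x \<in> Q" "y \<in> Q" for x y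
  proof -
    obtain a b where ab: "padic_Cauchy p a" "x = H a" "padic_Cauchy p b" "y = H b"
      using xy by (auto simp: Q_def)
    then have "x * y = H (\<lambda>n. a n * b n)" by (simp add: H_mult)
    then show ?thesis using ab Cauchy_rules by (auto simp: Q_def)
  qed
  have pw: "of_nat p powi l \<in> Q" for l
    using H_p_power[of l] Cauchy_const[OF p, of "of_nat p powi l"] by (force simp: Q_def image_iff)
  show "inverse x \<in> Q"
    using ku(1)
  proof (cases rule: coherent_cases)
    case 1
    then show ?thesis using ku \<open>x \<in> Q\<close> by simp
  next
    case (2 j w)
    obtain w' where w': "coherent w'" "Z w * Z w' = 1" using unit_inverse[OF 2(1,2)] by blast
    have "inverse (Z w) = Z w'" using w' by (simp add: inverse_unique)
    then have "inverse x = of_nat p powi (- k) * (of_nat p powi (- int j) * Z w')"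
      using ku 2 by (simp add: power_int_minus power_inverse)
    then show ?thesis using mult pw Z_in_Q w' by simp
  qed
qed

section \<open>Roots of one-units\<close>

lemma fermat_int:
  assumes "\<not> int p dvd a"
  shows "[a ^ (p - 1) = 1] (mod int p)"
proof -
  define b where "b = nat (a mod int p)"
  have b: "int b = a mod int p" using p_pos by (simp add: b_def)
  have "\<not> p dvd b"
    using assms b by (metis dvd_mod_iff dvd_refl int_dvd_int_iff)
  then have "[b ^ (p - 1) = 1] (mod p)" using fermat_theorem[OF p] by blast
  then have "[int b ^ (p - 1) = 1] (mod int p)"
    by (metis cong_int_iff of_nat_1 of_nat_power)
  moreover have "[a ^ (p - 1) = int b ^ (p - 1)] (mod int p)"
    unfolding b by (intro cong_pow) (simp add: cong_def)
  ultimately show ?thesis using cong_trans by blast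
qed

text \<open>In the induction \<open>y ^ p - 1\<close> is \<open>y - 1\<close> times a sum of
  \<open>p\<close> terms congruent to 1; the first factor carries \<open>p ^ Suc n\<close> and the
  sum one more \<open>p\<close>.\<close>

lemma one_unit_power:
  assumes "[a = (1::int)] (mod int p)"
  shows "[a ^ (p ^ n) = 1] (mod int p ^ Suc n)"
proof (induction n)
  case (Suc n)
  obtain c where c: "a ^ (p ^ n) = 1 + int p ^ Suc n * c"
    using Suc by (metis cong_iff_lin cong_sym mult.commute)
  have "a ^ (p ^ Suc n) = (1 + int p ^ Suc n * c) ^ p"
    unfolding c[symmetric] by (simp add: power_mult[symmetric] mult.commute)
  also have "[\<dots> = 1] (mod int p ^ Suc (Suc n))"
  proof -
    have "int p ^ Suc (Suc n) dvd (1 + int p ^ Suc n * c) ^ p - 1"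
    proof -
      define y where "y = 1 + int p ^ Suc n * c"
      have "y ^ p - 1 = (y - 1) * (\<Sum>i<p. y ^ i)" by (simp add: power_diff_1_eq)
      moreover have "int p ^ Suc n dvd y - 1" by (simp add: y_def)
      moreover have "int p dvd (\<Sum>i<p. y ^ i)"
      proof -
        have "[y = 1] (mod int p)" by (simp add: y_def cong_iff_dvd_diff)
        then have "[(\<Sum>i<p. y ^ i) = (\<Sum>i<p. 1 ^ i)] (mod int p)" by (intro cong_sum cong_pow)
        moreover have "[(\<Sum>i<p. 1 ^ i) = (0::int)] (mod int p)" by (simp add: cong_def)
        ultimately show ?thesis using cong_trans by (metis cong_0_iff)
      qed
      ultimately have "int p ^ Suc n * int p dvd y ^ p - 1" by (simp only: mult_dvd_mono)
      then show ?thesis by (simp add: y_def mult.commute)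
    qed
    then show ?thesis by (simp add: cong_iff_dvd_diff)
  qed
  finally show ?case .
qed (use assms in simp)

text \<open>Modulo \<open>p ^ Suc n\<close> a one-unit is killed by the exponent
  \<open>p ^ n\<close>, so it may be raised to an exponent known only modulo \<open>p ^ n\<close>.
  The root is the power with exponent \<open>t n\<close>, an inverse of \<open>m\<close> modulo
  \<open>p ^ n\<close>.\<close>

lemma one_unit_roots:
  assumes u: "coherent u" "\<And>n. [u n = 1] (mod int p)" and m: "coprime m p"
  shows "\<exists>w. coherent w \<and> Z w ^ m = Z u"
proof -
  have "\<exists>t. [m * t = 1] (mod p ^ n)" for n
    using cong_solve_coprime_nat[of m "p ^ n"] m by simp
  then obtain t where t: "\<And>n. [m * t n = 1] (mod p ^ n)" by metis
  define w where "w = (\<lambda>n. u n ^ t n)"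
  have pw: "[a ^ i = a ^ j] (mod int p ^ Suc n)" if aij: "[a = 1] (mod int p)" "[i = j] (mod p ^ n)" "i \<ge> j" for a i j n
  proof -
    obtain k where k: "i = j + k * p ^ n"
      using cong_le_nat[of j i "p ^ n"] aij by (auto simp: add.commute)
    have "[(a ^ p ^ n) ^ k = 1 ^ k] (mod int p ^ Suc n)"
      by (intro cong_pow one_unit_power aij)
    then have "[a ^ j * (a ^ p ^ n) ^ k = a ^ j * 1] (mod int p ^ Suc n)"
      by (intro cong_mult cong_refl) simp
    moreover have "a ^ i = a ^ j * (a ^ p ^ n) ^ k"
      unfolding k by (simp only: power_add mult.commute[of k] power_mult)
    ultimately show ?thesis by simp
  qed
  have pw: "[a ^ i = a ^ j] (mod int p ^ Suc n)" if aij: "[a = 1] (mod int p)" "[i = j] (mod p ^ n)" for a i j n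
    using pw[of a i j n] pw[of a j i n] aij cong_sym by (metis nle_le)
  have co: "coherent w"
    unfolding coherent_def
  proof
    fix n
    have "coprime m (p ^ n)" using m by simp
    moreover have "[m * t (Suc n) = m * t n] (mod p ^ n)"
      using cong_dvd_modulus_nat[OF t[of "Suc n"], of "p ^ n"] t[of n] cong_trans cong_sym
      by (metis dvd_triv_right power_Suc)
    ultimately have "[t (Suc n) = t n] (mod p ^ n)"
      using cong_mult_lcancel_nat by blast
    then have "[u (Suc n) ^ t (Suc n) = u (Suc n) ^ t n] (mod int p ^ Suc n)"
      by (intro pw u)
    moreover have "[u (Suc n) ^ t n = u n ^ t n] (mod int p ^ Suc n)"
      using u(1) by (intro cong_pow) (simp add: coherent_def)
    ultimately show "[w (Suc n) = w n] (mod int p ^ Suc n)"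
      unfolding w_def using cong_trans by blast
  qed
  have "Z (\<lambda>n. w n ^ m) = Z u"
  proof (rule Z_eq)
    fix n
    have "[u n ^ (m * t n) = u n ^ 1] (mod int p ^ Suc n)" by (intro pw u t)
    then show "[w n ^ m = u n] (mod int p ^ Suc n)"
      by (simp add: w_def power_mult[symmetric] mult.commute)
  qed (use u co coherent_power in auto)
  then show ?thesis using Z_power[OF co] co by auto
qed

end

section \<open>Valuations on an algebraic closure of the p-adic numbers\<close>

lemma rat_le_if_multiples:
  fixes a b C :: rat
  assumes "\<And>k::nat. of_nat k * a \<le> of_nat k * b + C"
  shows "a \<le> b"
proof (rule ccontr)
  assume "\<not> a \<le> b"
  then obtain k :: nat where "C < of_nat k * (a - b)"
    using ex_less_of_nat_mult[of "a - b" C] by auto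
  then show False using assms[of k] by (simp add: algebra_simps)
qed

text \<open>Here \<open>v\<close> is not yet tied to \<open>p\<close>: it is integral on the image
  \<open>Q\<close> of the p-adic numbers and takes the value 1 somewhere, which excludes the trivial
  valuation.\<close>

locale padic_closure = padic_hom p H + valued_field v
  for p and H :: "(nat \<Rightarrow> rat) \<Rightarrow> 'a::alg_closed_field" and v :: "'a \<Rightarrow> rat" +
  assumes alg: "algebraic_in Q x"
    and v_Q: "x \<in> Q \<Longrightarrow> x \<noteq> 0 \<Longrightarrow> v x \<in> \<int>"
    and nontrivial: "\<exists>x. x \<noteq> 0 \<and> v x = 1"
begin

lemma Q_ring: "sub_ring Q"
  using Q_field by (simp add: sub_field_def)

text \<open>A one-unit is an \<open>m\<close>-th power for every \<open>m\<close> prime to \<open>p\<close>, so its integral value vanishes.\<close>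

lemma v_unit:
  assumes u: "coherent u" "\<not> int p dvd u 0"
  shows "Z u \<noteq> 0" "v (Z u) = 0"
proof -
  show nz: "Z u \<noteq> 0" using unit_inverse[OF u] by auto
  \<comment> \<open>By Fermat's little theorem this power of the unit is a one-unit.\<close>
  define w where "w = (\<lambda>n. u n ^ (p - 1))"
  have w: "coherent w" unfolding w_def by (rule coherent_power[OF u(1)])
  have un: "[w n = 1] (mod int p)" for n
  proof -
    have "[u n = u 0] (mod int p)" using coherent_cong[OF u(1), of 0 n] by simp
    then have "[w n = u 0 ^ (p - 1)] (mod int p)" unfolding w_def by (rule cong_pow)
    then show ?thesis using fermat_int[OF u(2)] cong_trans by blast
  qed
  have Zw: "Z w = Z u ^ (p - 1)" unfolding w_def by (rule Z_power[OF u(1)])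
  then have wnz: "Z w \<noteq> 0" using nz by simp
  obtain a where a: "v (Z w) = of_int a" using v_Q[OF Z_in_Q[OF w] wnz] by (auto elim: Ints_cases)
  \<comment> \<open>This \<open>m\<close> is prime to \<open>p\<close> and exceeds the absolute
    value of \<open>a\<close>. An \<open>m\<close>-th root in \<open>Q\<close> makes
    \<open>a\<close> a multiple of \<open>m\<close>, hence zero.\<close>
  define m where "m = p * nat \<bar>a\<bar> + 1"
  have "coprime m p" unfolding m_def by (metis coprime_1_left gcd.commute coprime_iff_gcd_eq_1 gcd_add_mult mult.commute add.commute)
  then obtain y where y: "coherent y" "Z y ^ m = Z w" using one_unit_roots[OF w un] by blast
  have ynz: "Z y \<noteq> 0" using y wnz by (auto simp: m_def)
  obtain b where b: "v (Z y) = of_int b" using v_Q[OF Z_in_Q[OF y(1)] ynz] by (auto elim: Ints_cases)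
  have "of_int a = (of_nat m * of_int b :: rat)" using v_power[OF ynz, of m] y(2) a b by simp
  also have "\<dots> = of_int (int m * b)" by simp
  finally have "a = int m * b" by (simp only: of_int_eq_iff)
  then have dv: "int m dvd a" by simp
  have "int (nat \<bar>a\<bar>) \<le> int (p * nat \<bar>a\<bar>)" using p_pos by (simp only: zle_int) simp
  then have "\<bar>a\<bar> < int m" by (simp add: m_def)
  then have "a = 0" using dv dvd_imp_le_int[of a "int m"] by fastforce
  then have "of_nat (p - 1) * v (Z u) = 0" using a Zw v_power[OF nz, of "p - 1"] by simp
  then show "v (Z u) = 0" using p_pos by auto
qed

lemma v_p_nonneg: "v (of_nat p) \<ge> 0"
  using vge_of_nat[of p] char0[OF p_pos(1)] by (auto simp: vge_def)

lemma vge_Z: "coherent u \<Longrightarrow> vge 0 (Z u)"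
proof (erule coherent_cases)
  fix k w assume w: "coherent w" "\<not> int p dvd w 0" "Z u = of_nat p ^ k * Z w"
  then show "vge 0 (Z u)"
    using v_unit[OF w(1,2)] char0[OF p_pos(1)] v_p_nonneg by (simp add: vge_def v_mult v_power)
qed simp

lemma v_Q_unit:
  assumes "x \<in> Q" "x \<noteq> 0"
  obtains k u where "coherent u" "\<not> int p dvd u 0" "x = of_nat p powi k * Z u" "v x = of_int k * v (of_nat p)"
proof -
  obtain k u where ku: "coherent u" "x = of_nat p powi k * Z u" using Q_cases assms(1) by blast
  show ?thesis
    using ku(1)
  proof (cases rule: coherent_cases)
    case (2 j w)
    have "x = of_nat p powi (k + int j) * Z w"
      using ku 2 char0[OF p_pos(1)] by (simp add: power_int_add)
    moreover from this have "v x = of_int (k + int j) * v (of_nat p)"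
      using v_unit[OF 2(1,2)] char0[OF p_pos(1)] by (simp add: v_mult v_powi)
    ultimately show ?thesis using that 2 by blast
  qed (use ku assms in simp)
qed

text \<open>If \<open>v\<close> vanished at \<open>p\<close> it would be trivial on
  \<open>Q\<close>, and the terms of an algebraic relation over \<open>Q\<close> for an element of
  value 1 would all have different values. Integrality on \<open>Q\<close> raises a positive value
  to at least 1.\<close>

lemma v_p_ge_1: "v (of_nat p) \<ge> 1"
proof -
  have "v (of_nat p) \<noteq> 0"
  proof
    assume 0: "v (of_nat p) = 0"
    have vQ: "v x = 0" if "x \<in> Q" "x \<noteq> 0" for x
      using v_Q_unit[OF that] 0 by (metis mult_zero_right)
    obtain x where x: "x \<noteq> 0" "v x = 1" using nontrivial by blast
    obtain P where P: "cf Q P" "P \<noteq> 0" "poly P x = 0" using alg[of x] by (auto simp: algebraic_in_def)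
    have vt: "v (coeff P i * x ^ i) = of_nat i" if "coeff P i \<noteq> 0" for i
      using that P x vQ by (simp add: v_mult v_power cf_def)
    have "(\<Sum>i\<le>degree P. coeff P i * x ^ i) \<noteq> 0"
    proof (rule distinct_sum(1))
      show "inj_on (\<lambda>i. v (coeff P i * x ^ i)) {i \<in> {..degree P}. coeff P i * x ^ i \<noteq> 0}"
        by (rule inj_onI) (use vt in auto)
      show "degree P \<in> {..degree P}" "coeff P (degree P) * x ^ degree P \<noteq> 0" using P x by auto
    qed simp
    then show False using P by (simp add: poly_altdef)
  qed
  moreover have "of_nat p \<in> Q" using sub_ring_of_nat[OF Q_ring] .
  then obtain a where "v (of_nat p) = of_int a" using v_Q char0[OF p_pos(1)] by (auto elim: Ints_cases)
  ultimately show ?thesis using v_p_nonneg by auto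
qed

lemma vge_Z_divisible:
  assumes "coherent w" "int p ^ k dvd w k"
  shows "vge (of_nat k) (Z w)"
proof -
  obtain y where y: "coherent y" "Z w = of_nat p ^ k * Z y" using coherent_shift[OF assms] by blast
  have "of_nat k * 1 \<le> of_nat k * v (of_nat p)" using v_p_ge_1 by (intro mult_left_mono) auto
  then have "vge (of_nat k) (of_nat p ^ k)"
    using char0[OF p_pos(1)] by (simp add: vge_def v_power)
  from vge_mult[OF this vge_Z[OF y(1)]] show ?thesis using y by simp
qed

lemma vge_Z_diff:
  assumes "coherent u"
  shows "vge (of_nat k) (Z u - of_int (u k))"
proof -
  have "vge (of_nat k) (Z (\<lambda>m. u m - u k))"
    by (rule vge_Z_divisible) (use assms in \<open>auto intro: coherent_diff coherent_const\<close>)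
  then show ?thesis using assms by (simp add: Z_diff coherent_const Z_const)
qed

lemma v_of_nat:
  assumes "\<not> p dvd n"
  shows "v (of_nat n) = 0"
  using v_unit(2)[of "\<lambda>_. int n"] assms by (simp add: coherent_const Z_const)

definition int_poly :: "nat \<Rightarrow> (nat \<Rightarrow> int) \<Rightarrow> 'a poly" where
  "int_poly n c = (\<Sum>i<n. monom (of_int (c i)) i)"

lemma powers_bounded_below: "\<exists>a\<le>0. \<forall>i<n. vge a ((x::'a) ^ i)"
proof -
  define a where "a = Min (insert 0 ((\<lambda>i. v (x ^ i)) ` {..<n}))"
  have "a \<le> 0" "\<And>i. i < n \<Longrightarrow> a \<le> v (x ^ i)" unfolding a_def by (auto intro!: Min_le)
  then show ?thesis by (auto simp: vge_def)
qed

lemma vge_poly_sum: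
  assumes "\<And>i. i < n \<Longrightarrow> vge a ((x::'a) ^ i)" "\<And>i. i < n \<Longrightarrow> vge k (d i)"
  shows "vge (k + a) (\<Sum>i<n. d i * x ^ i)"
  by (intro vge_sum vge_mult) (use assms in auto)

lemma poly_int_poly: "poly (int_poly n c) x = (\<Sum>i<n. of_int (c i) * x ^ i)"
  by (simp add: int_poly_def poly_sum poly_monom)

lemma infinite_residue_class:
  fixes c :: "nat \<Rightarrow> nat \<Rightarrow> int"
  assumes "infinite S" "M > 0"
  shows "\<exists>e. infinite {j\<in>S. \<forall>i<n. [c j i = e i] (mod M)}"
proof -
  define f where "f = (\<lambda>j i. if i < n then c j i mod M else 0)"
  have "f ` S \<subseteq> {g. \<forall>i. (i \<in> {..<n} \<longrightarrow> g i \<in> {0..<M}) \<and> (i \<notin> {..<n} \<longrightarrow> g i = 0)}"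
    using assms(2) by (auto simp: f_def)
  moreover have "finite {g::nat \<Rightarrow> int. \<forall>i. (i \<in> {..<n} \<longrightarrow> g i \<in> {0..<M}) \<and> (i \<notin> {..<n} \<longrightarrow> g i = 0)}"
    by (rule finite_set_of_finite_funs) auto
  ultimately have "finite (f ` S)" by (rule finite_subset)
  then obtain j0 where "infinite {j\<in>S. f j = f j0}" using pigeonhole_infinite[OF assms(1)] by blast
  moreover have "{j\<in>S. f j = f j0} \<subseteq> {j\<in>S. \<forall>i<n. [c j i = c j0 i] (mod M)}"
    by (auto simp: f_def fun_eq_iff cong_def)
  ultimately show ?thesis using infinite_super by blast
qed

text \<open>Compactness of the set of primitive p-adic integral vectors, by Koenig's lemma.\<close>

lemma primitive_bound:
  assumes g: "min_poly Q \<alpha> g" and n: "n = degree g"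
  shows "\<exists>C. \<forall>c. (\<exists>i<n. \<not> int p dvd c i) \<longrightarrow> v (poly (int_poly n c) \<alpha>) < C"
proof (rule ccontr)
  assume "\<not> ?thesis"
  then have "\<forall>k::nat. \<exists>c. (\<exists>i<n. \<not> int p dvd c i) \<and> of_nat k \<le> v (poly (int_poly n c) \<alpha>)"
    by (meson not_le)
  from choice[OF this] obtain c where c: "\<And>k. \<exists>i<n. \<not> int p dvd c k i"
    "\<And>k. of_nat k \<le> v (poly (int_poly n (c k)) \<alpha>)" by blast
  \<comment> \<open>The indices of vectors congruent to \<open>e\<close> modulo
    \<open>p ^ Suc k\<close>. The branch that is built follows residue vectors whose set of indices
    stays infinite.\<close>
  define T where "T = (\<lambda>k e. {j. \<forall>i<n. [c j i = e i] (mod int p ^ Suc k)})"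
  have "\<exists>e. \<forall>k. infinite (T k (e k)) \<and> (\<forall>i<n. [e (Suc k) i = e k i] (mod int p ^ Suc k))"
  proof (rule dependent_nat_choice)
    show "\<exists>e. infinite (T 0 e)"
      using infinite_residue_class[of UNIV "int p ^ Suc 0" n c] p_pos by (simp add: T_def)
  next
    fix e k assume inf: "infinite (T k e)"
    obtain e' where e': "infinite {j\<in>T k e. \<forall>i<n. [c j i = e' i] (mod int p ^ Suc (Suc k))}"
      using infinite_residue_class[OF inf, of "int p ^ Suc (Suc k)" n c] p_pos by auto
    then obtain j where j: "j \<in> T k e" "\<And>i. i < n \<Longrightarrow> [c j i = e' i] (mod int p ^ Suc (Suc k))"
      using infinite_imp_nonempty by blast
    have "[e' i = e i] (mod int p ^ Suc k)" if "i < n" for i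
    proof -
      have "[c j i = e' i] (mod int p ^ Suc k)"
        using j(2)[OF that] by (rule cong_dvd_modulus) simp
      moreover have "[c j i = e i] (mod int p ^ Suc k)" using j(1) that by (simp add: T_def)
      ultimately show ?thesis using cong_sym cong_trans by blast
    qed
    moreover have "infinite (T (Suc k) e')"
      using e' by (rule infinite_super[rotated]) (auto simp: T_def)
    ultimately show "\<exists>e'. infinite (T (Suc k) e') \<and> (\<forall>i<n. [e' i = e i] (mod int p ^ Suc k))" by blast
  qed
  then obtain e where e: "\<And>k. infinite (T k (e k))"
    "\<And>k i. i < n \<Longrightarrow> [e (Suc k) i = e k i] (mod int p ^ Suc k)" by blast
  have co: "coherent (\<lambda>k. e k i)" if "i < n" for i
    using e(2)[OF that] by (simp add: coherent_def)
  \<comment> \<open>The polynomial of the limit vector. It is nonzero because primitivity is visible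
    modulo \<open>p\<close>, and its degree is below that of \<open>g\<close>; yet it is
    approximated by polynomials whose values at \<open>\<alpha>\<close> grow without bound.\<close>
  define G where "G = (\<Sum>i<n. monom (Z (\<lambda>k. e k i)) i)"
  have cG: "coeff G i = (if i < n then Z (\<lambda>k. e k i) else 0)" for i
    by (simp add: G_def coeff_sum)
  have cfG: "cf Q G" unfolding G_def by (intro cf_sum[OF Q_ring] cf_monom[OF Q_ring] Z_in_Q co) auto
  obtain j where j: "j \<in> T 0 (e 0)" using e(1) infinite_imp_nonempty by blast
  obtain i where i: "i < n" "\<not> int p dvd c j i" using c(1) by blast
  have "\<not> int p dvd e 0 i" using j i by (auto simp: T_def cong_dvd_iff)
  then have "Z (\<lambda>k. e k i) \<noteq> 0" using v_unit(1)[OF co[OF i(1)]] by simp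
  then have G0: "G \<noteq> 0" using cG[of i] i by auto
  have "degree G < n"
  proof -
    have "degree G \<le> n - 1" by (rule degree_le) (use cG i in auto)
    then show ?thesis using i by simp
  qed
  then have nz: "poly G \<alpha> \<noteq> 0" using g G0 cfG n unfolding min_poly_def by fastforce
  obtain a where a: "a \<le> 0" "\<And>i. i < n \<Longrightarrow> vge a (\<alpha> ^ i)" using powers_bounded_below by blast
  have "vge (of_nat k + a) (poly G \<alpha>)" for k
  proof -
    have "\<exists>j. j \<in> T k (e k) \<and> k \<le> j"
      using e(1)[of k] by (metis finite_nat_set_iff_bounded linorder_not_less)
    then obtain j where j: "j \<in> T k (e k)" "k \<le> j" by blast
    have "vge (of_nat k + a) (\<Sum>i<n. (Z (\<lambda>k. e k i) - of_int (e k i)) * \<alpha> ^ i)"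
      by (rule vge_poly_sum[OF a(2) vge_Z_diff[OF co]])
    moreover have "vge (of_nat k + a) (\<Sum>i<n. of_int (e k i - c j i) * \<alpha> ^ i)"
    proof (rule vge_poly_sum[OF a(2)])
      fix i assume i: "i < n"
      have "int p ^ Suc k dvd e k i - c j i"
        using j i by (simp add: T_def cong_iff_dvd_diff dvd_diff_commute)
      then have "int p ^ k dvd e k i - c j i" by (metis dvd_trans le_imp_power_dvd lessI less_imp_le)
      then show "vge (of_nat k) (of_int (e k i - c j i))"
        using vge_Z_divisible[OF coherent_const, of k "e k i - c j i"] by (simp add: Z_const)
    qed
    moreover have "vge (of_nat k + a) (poly (int_poly n (c j)) \<alpha>)"
    proof -
      have "(of_nat k :: rat) \<le> of_nat j" using j by simp
      then have "of_nat k + a \<le> v (poly (int_poly n (c j)) \<alpha>)" using c(2)[of j] a(1) by linarith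
      then show ?thesis by (simp add: vge_def)
    qed
    ultimately have "vge (of_nat k + a) ((\<Sum>i<n. (Z (\<lambda>k. e k i) - of_int (e k i)) * \<alpha> ^ i)
        + (\<Sum>i<n. of_int (e k i - c j i) * \<alpha> ^ i) + poly (int_poly n (c j)) \<alpha>)"
      by (intro vge_add)
    moreover have "\<dots> = poly G \<alpha>"
      unfolding poly_int_poly G_def
      by (simp add: poly_sum poly_monom sum.distrib[symmetric] algebra_simps)
    ultimately show ?thesis by simp
  qed
  then have "of_nat k + a \<le> v (poly G \<alpha>)" for k :: nat using nz by (simp add: vge_def)
  then have le: "of_nat k \<le> v (poly G \<alpha>) - a" for k :: nat by (simp add: le_diff_eq)
  obtain k :: nat where "v (poly G \<alpha>) - a < of_nat k" using reals_Archimedean2 by blast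
  then show False using le[of k] by simp
qed

text \<open>Reduce modulo the minimal polynomial and scale by a power of \<open>p\<close> until the
  coefficients are p-adic integers, not all divisible by \<open>p\<close>. Then
  \<open>primitive_bound\<close> limits the value at \<open>\<alpha>\<close> from above, integrality
  of the coefficients limits the value at \<open>\<beta>\<close> from below, and the scaling cancels
  in the comparison.\<close>

lemma conj_bound:
  assumes conj: "\<And>P. cf Q P \<Longrightarrow> poly P \<alpha> = 0 \<Longrightarrow> poly P \<beta> = 0"
  shows "\<exists>C. \<forall>P. cf Q P \<longrightarrow> poly P \<alpha> \<noteq> 0 \<longrightarrow> poly P \<beta> \<noteq> 0 \<longrightarrow> v (poly P \<alpha>) \<le> v (poly P \<beta>) + C"
proof -
  obtain g where g: "min_poly Q \<alpha> g" using min_poly_exists[OF Q_field alg] by blast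
  define n where "n = degree g"
  have n0: "n > 0" using min_poly_degree_pos[OF g] by (simp add: n_def)
  have g\<beta>: "poly g \<beta> = 0" using conj g by (simp add: min_poly_def)
  obtain C where C: "\<And>c. \<exists>i<n. \<not> int p dvd c i \<Longrightarrow> v (poly (int_poly n c) \<alpha>) < C"
    using primitive_bound[OF g n_def] by blast
  obtain a where a: "a \<le> 0" "\<And>i. i < n \<Longrightarrow> vge a (\<alpha> ^ i)" using powers_bounded_below by blast
  obtain b where b: "b \<le> 0" "\<And>i. i < n \<Longrightarrow> vge b (\<beta> ^ i)" using powers_bounded_below by blast
  have "v (poly P \<alpha>) \<le> v (poly P \<beta>) + (C - b)"
    if P: "cf Q P" "poly P \<alpha> \<noteq> 0" "poly P \<beta> \<noteq> 0" for P
  proof -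
    obtain q R where qR: "cf Q q" "cf Q R" "P = q * g + R" "degree R < n"
      using monic_division[OF Q_ring, of g P] g P n0 by (auto simp: min_poly_def n_def)
    have PR: "poly P \<alpha> = poly R \<alpha>" "poly P \<beta> = poly R \<beta>" using qR g g\<beta> by (auto simp: min_poly_def)
    have R0: "R \<noteq> 0" using PR P by auto
    let ?B = "{i. coeff R i \<noteq> 0}"
    have B: "?B \<subseteq> {..<n}" using qR(4) by (auto intro: le_less_trans[OF le_degree])
    have finB: "finite ?B" using B finite_subset by blast
    have "\<exists>k u. coherent u \<and> \<not> int p dvd u 0 \<and> coeff R i = of_nat p powi k * Z u" if "i \<in> ?B" for i
      using v_Q_unit[of "coeff R i"] qR(2) that unfolding cf_def by (metis mem_Collect_eq)
    then obtain k u where ku: "\<And>i. i \<in> ?B \<Longrightarrow> coherent (u i) \<and> \<not> int p dvd u i 0 \<and> coeff R i = of_nat p powi (k i) * Z (u i)"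
      by metis
    have neB: "?B \<noteq> {}" using R0 by (auto simp: poly_eq_iff)
    define l where "l = Min (k ` ?B)"
    have l: "\<And>i. i \<in> ?B \<Longrightarrow> l \<le> k i" using finB by (simp add: l_def)
    obtain i0 where i0: "i0 \<in> ?B" "k i0 = l"
      using Min_in[of "k ` ?B"] finB neB unfolding l_def by (metis (no_types, lifting) finite_imageI image_iff image_is_empty)
    define w where "w = (\<lambda>i m. if i \<in> ?B then int p ^ nat (k i - l) * u i m else 0)"
    have w: "coherent (w i)" for i
      using ku[of i] by (cases "i \<in> ?B") (auto simp: w_def intro!: coherent_mult coherent_const)
    have cR: "coeff R i = of_nat p powi l * Z (w i)" for i
    proof (cases "i \<in> ?B")
      case True
      have "Z (w i) = of_nat p ^ nat (k i - l) * Z (u i)"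
        using ku[OF True] True Z_mult[OF coherent_const, of "u i" "int p ^ nat (k i - l)"] by (simp add: w_def Z_const)
      moreover have "(of_nat p :: 'a) powi (k i) = of_nat p powi l * of_nat p ^ nat (k i - l)"
        using char0[OF p_pos(1)] l[OF True]
        by (simp add: power_int_def[symmetric] power_int_add[symmetric] flip: power_int_of_nat)
      ultimately show ?thesis using ku[OF True] by simp
    next
      case False
      then show ?thesis using Z_const[of 0] by (simp add: w_def)
    qed
    let ?s = "\<lambda>x. \<Sum>i<n. Z (w i) * x ^ i"
    have pR: "poly R x = of_nat p powi l * ?s x" for x
    proof -
      have "poly R x = (\<Sum>i<n. coeff R i * x ^ i)"
        unfolding poly_altdef using qR(4) by (intro sum.mono_neutral_left) (auto simp: coeff_eq_0)
      then show ?thesis by (simp add: cR sum_distrib_left mult.assoc)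
    qed
    \<comment> \<open>Rounding the coefficients to integers at precision \<open>m\<close> causes an
      error of value above \<open>C\<close> at \<open>\<alpha>\<close>, so the bound for integer
      coefficients carries over.\<close>
    obtain m :: nat where m: "C - a < of_nat m" using reals_Archimedean2 by blast
    define c where "c = (\<lambda>i. w i m)"
    have "\<not> int p dvd c i0"
    proof -
      have "[u i0 m = u i0 0] (mod int p)" using coherent_cong[of "u i0" 0 m] ku[OF i0(1)] by simp
      then show ?thesis using ku[OF i0(1)] i0 by (simp add: c_def w_def cong_dvd_iff)
    qed
    then have vc: "v (poly (int_poly n c) \<alpha>) < C" using C i0 B by blast
    have "vge (of_nat m + a) (\<Sum>i<n. (Z (w i) - of_int (c i)) * \<alpha> ^ i)"
      unfolding c_def by (rule vge_poly_sum[OF a(2) vge_Z_diff[OF w]])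
    moreover have "(\<Sum>i<n. (Z (w i) - of_int (c i)) * \<alpha> ^ i) = ?s \<alpha> - poly (int_poly n c) \<alpha>"
      by (simp add: poly_int_poly sum_subtractf left_diff_distrib)
    ultimately have "vge C (?s \<alpha> - poly (int_poly n c) \<alpha>)"
      using m vge_mono[of "of_nat m + a" _ C] by simp
    moreover have s\<alpha>: "?s \<alpha> \<noteq> 0" "?s \<beta> \<noteq> 0" using pR PR P by auto
    ultimately have "v (?s \<alpha>) < C"
    proof -
      assume d: "vge C (?s \<alpha> - poly (int_poly n c) \<alpha>)"
      show ?thesis
      proof (rule ccontr)
        assume "\<not> v (?s \<alpha>) < C"
        then have "vge C (?s \<alpha>)" by (simp add: vge_def)
        from vge_diff[OF this d] have "vge C (poly (int_poly n c) \<alpha>)" by simp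
        then have "poly (int_poly n c) \<alpha> = 0" using vc by (simp add: vge_def)
        moreover have "int_poly n c \<noteq> 0"
        proof -
          have "coeff (int_poly n c) i0 = of_int (c i0)" using i0 B by (auto simp: int_poly_def coeff_sum)
          moreover have "of_int (c i0) \<noteq> (0::'a)"
            using v_unit(1)[OF coherent_const, of "c i0"] \<open>\<not> int p dvd c i0\<close> by (simp add: Z_const)
          ultimately show ?thesis by auto
        qed
        moreover have "cf Q (int_poly n c)"
          unfolding int_poly_def by (intro cf_sum[OF Q_ring] cf_monom[OF Q_ring] sub_ring_of_int[OF Q_ring])
        moreover have "degree (int_poly n c) \<le> n - 1"
          by (rule degree_le) (use n0 in \<open>auto simp: int_poly_def coeff_sum\<close>)
        then have "degree (int_poly n c) < n" using n0 by simp
        ultimately show False using g unfolding min_poly_def n_def by (meson linorder_not_less)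
      qed
    qed
    moreover have "vge (0 + b) (?s \<beta>)" by (rule vge_poly_sum[OF b(2) vge_Z[OF w]])
    then have "b \<le> v (?s \<beta>)" using s\<alpha> by (simp add: vge_def)
    moreover have "v (poly P \<alpha>) = of_int l * v (of_nat p) + v (?s \<alpha>)" "v (poly P \<beta>) = of_int l * v (of_nat p) + v (?s \<beta>)"
      using PR pR s\<alpha> char0[OF p_pos(1)] by (auto simp: v_mult v_powi)
    ultimately show ?thesis by simp
  qed
  then show ?thesis by blast
qed

text \<open>Applied to the powers of one polynomial, the bound becomes an inequality without constant.\<close>

lemma v_conjugate:
  assumes "\<alpha> \<noteq> 0" "\<beta> \<noteq> 0" and conj: "\<And>P. cf Q P \<Longrightarrow> poly P \<alpha> = 0 \<Longrightarrow> poly P \<beta> = 0"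
  shows "v \<alpha> = v \<beta>"
proof -
  have le: "v (poly A \<alpha>) \<le> v (poly A \<beta>)" if A: "cf Q A" "poly A \<alpha> \<noteq> 0" "poly A \<beta> \<noteq> 0" for A
  proof -
    obtain C where C: "\<And>P. cf Q P \<Longrightarrow> poly P \<alpha> \<noteq> 0 \<Longrightarrow> poly P \<beta> \<noteq> 0 \<Longrightarrow> v (poly P \<alpha>) \<le> v (poly P \<beta>) + C"
      using conj_bound[OF conj] by blast
    show ?thesis
      by (rule rat_le_if_multiples[of _ _ C])
        (use C[OF cf_power[OF Q_ring A(1)]] A in \<open>simp add: v_power\<close>)
  qed
  have cx: "cf Q [:0, 1:]" by (intro cf_pCons[OF Q_ring] cf_0[OF Q_ring] sub_ringD[OF Q_ring])
  \<comment> \<open>The inverse of \<open>\<alpha>\<close> is a polynomial in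
    \<open>\<alpha>\<close>, and the same polynomial inverts \<open>\<beta>\<close>. Applied to it,
    the inequality turns around.\<close>
  have "inverse \<alpha> \<in> {poly P \<alpha> | P. cf Q P}"
  proof -
    have "sub_field {poly P \<alpha> | P. cf Q P}"
      using algebraic_sub_ring_is_sub_field[OF alg adjoin_sub_ring(1,2)[OF Q_ring] Q_field] .
    then show ?thesis using adjoin_sub_ring(3)[OF Q_ring] by (auto simp: sub_field_def)
  qed
  then obtain A where A: "inverse \<alpha> = poly A \<alpha>" "cf Q A" by blast
  have "poly ([:0, 1:] * A - 1) \<beta> = 0"
    by (rule conj) (use A cx assms cf_1[OF Q_ring] in \<open>auto intro!: cf_diff[OF Q_ring] cf_mult[OF Q_ring] simp flip: A(1) simp del: mult_pCons_left\<close>)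
  then have "inverse \<beta> = poly A \<beta>" by (intro inverse_unique) simp
  then have "v (inverse \<alpha>) \<le> v (inverse \<beta>)" using le[OF A(2)] A(1) assms(1,2) by (metis inverse_nonzero_iff_nonzero)
  moreover have "v \<alpha> \<le> v \<beta>" using le[OF cx] assms(1,2) by simp
  ultimately show ?thesis using assms(1,2) by (simp add: v_inverse)
qed

end

text \<open>The powers of \<open>x\<close> with exponents up to \<open>d * m\<close> are one more
  than the \<open>d * m\<close> products of a power below \<open>d\<close> with a generator
  \<open>e j\<close>, in which they all expand over \<open>Q\<close>.\<close>

lemma algebraic_trans:
  fixes e :: "nat \<Rightarrow> 'a::field"
  assumes Q: "sub_field Q" and K: "sub_field K"
    and span: "\<And>y. y \<in> K \<Longrightarrow> \<exists>q. (\<forall>j. q j \<in> Q) \<and> y = (\<Sum>j<m. q j * e j)"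
    and x: "algebraic_in K x"
  shows "algebraic_in Q x"
proof -
  obtain g where g: "min_poly K x g" using min_poly_exists[OF K x] by blast
  have Kr: "sub_ring K" and Qr: "sub_ring Q" using K Q by (auto simp: sub_field_def)
  define d where "d = degree g"
  have d: "d > 0" using min_poly_degree_pos[OF g] by (simp add: d_def)
  have "\<exists>r. cf K r \<and> degree r < d \<and> x ^ i = poly r x" for i
  proof -
    obtain q r where "cf K q" "cf K r" "monom 1 i = q * g + r" "degree r < degree g"
      using monic_division[OF Kr, of g "monom 1 i"] g d cf_monom[OF Kr, of 1 i] sub_ringD(1)[OF Kr]
      by (auto simp: min_poly_def d_def)
    moreover from this have "x ^ i = poly r x"
      using g by (metis (no_types, lifting) add_0 min_poly_def mult_zero_right poly_add poly_monom poly_mult mult_1)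
    ultimately show ?thesis by (auto simp: d_def)
  qed
  then have "\<forall>i. \<exists>r. cf K r \<and> degree r < d \<and> x ^ i = poly r x" by blast
  from choice[OF this] obtain r where r: "\<And>i. cf K (r i)" "\<And>i. degree (r i) < d" "\<And>i. x ^ i = poly (r i) x"
    by blast
  have "\<forall>y. \<exists>q. y \<in> K \<longrightarrow> (\<forall>j. q j \<in> Q) \<and> y = (\<Sum>j<m. q j * e j)" using span by blast
  from choice[OF this] obtain s where
    s: "\<And>y. y \<in> K \<Longrightarrow> (\<forall>j. s y j \<in> Q) \<and> y = (\<Sum>j<m. s y j * e j)" by blast
  define q where "q = (\<lambda>i l. s (coeff (r i) l))"
  have q: "q i l j \<in> Q" "coeff (r i) l = (\<Sum>j<m. q i l j * e j)" for i l j
    using s[of "coeff (r i) l"] r(1)[of i] by (auto simp: q_def cf_def)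
  have pow: "x ^ i = (\<Sum>l<d. (\<Sum>j<m. q i l j * e j) * x ^ l)" for i
  proof -
    have "poly (r i) x = (\<Sum>l<d. coeff (r i) l * x ^ l)"
      unfolding poly_altdef using r(2)[of i] by (intro sum.mono_neutral_left) (auto simp: coeff_eq_0)
    then show ?thesis using r(3) q(2) by simp
  qed
  let ?J = "{..<d} \<times> {..<m}" and ?I = "{..d * m}"
  have "\<exists>c. (\<forall>i. c i \<in> Q) \<and> (\<exists>i\<in>?I. c i \<noteq> 0) \<and> (\<forall>lj\<in>?J. (\<Sum>i\<in>?I. c i * q i (fst lj) (snd lj)) = 0)"
    by (rule linear_dependence[OF Q]) (use q(1) in auto)
  then obtain c where c: "\<And>i. c i \<in> Q" "\<exists>i\<in>?I. c i \<noteq> 0"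
    "\<And>l j. l < d \<Longrightarrow> j < m \<Longrightarrow> (\<Sum>i\<in>?I. c i * q i l j) = 0" by fastforce
  define P where "P = (\<Sum>i\<in>?I. monom (c i) i)"
  have cP: "coeff P i = (if i \<in> ?I then c i else 0)" for i by (simp add: P_def coeff_sum)
  have "P \<noteq> 0" using c(2) cP by (metis coeff_0)
  moreover have "cf Q P" using c(1) sub_ringD(2)[OF Qr] by (simp add: cf_def cP)
  moreover have "poly P x = (\<Sum>l<d. \<Sum>j<m. (\<Sum>i\<in>?I. c i * q i l j) * e j * x ^ l)"
  proof -
    have "poly P x = (\<Sum>i\<in>?I. c i * (\<Sum>l<d. (\<Sum>j<m. q i l j * e j) * x ^ l))"
      unfolding P_def poly_sum poly_monom by (simp only: pow[symmetric])
    also have "\<dots> = (\<Sum>i\<in>?I. \<Sum>l<d. \<Sum>j<m. c i * q i l j * e j * x ^ l)"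
      by (simp add: sum_distrib_left sum_distrib_right mult.assoc)
    also have "\<dots> = (\<Sum>l<d. \<Sum>i\<in>?I. \<Sum>j<m. c i * q i l j * e j * x ^ l)" by (rule sum.swap)
    also have "\<dots> = (\<Sum>l<d. \<Sum>j<m. \<Sum>i\<in>?I. c i * q i l j * e j * x ^ l)"
      by (intro sum.cong refl sum.swap)
    finally show ?thesis by (simp add: sum_distrib_right)
  qed
  then have "poly P x = 0" using c(3) by simp
  ultimately show ?thesis by (auto simp: algebraic_in_def)
qed

lemma dimension_span:
  assumes "ring.dimension (ring_of_type_algebra :: 'k::field ring) n K E" "0 \<in> K"
  shows "\<exists>e. \<forall>x\<in>E. \<exists>q. (\<forall>i. q i \<in> K) \<and> x = (\<Sum>i<n. q i * (e i :: 'k))"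
proof -
  interpret ring "ring_of_type_algebra :: 'k ring" by (rule ring_from_type_algebra)
  show ?thesis
    using assms
  proof (induction rule: dimension.induct)
    case (zero_dim K)
    then show ?case by (auto simp: ring_of_type_algebra_def intro: exI[of _ "\<lambda>_. 0"])
  next
    case (Suc_dim u E n K)
    then obtain e where e: "\<forall>x\<in>E. \<exists>q. (\<forall>i. q i \<in> K) \<and> x = (\<Sum>i<n. q i * e i)" by blast
    have "\<exists>q. (\<forall>i. q i \<in> K) \<and> x = (\<Sum>i<Suc n. q i * (e(n := u)) i)" if x: "x \<in> line_extension K u E" for x
    proof -
      obtain k w where kw: "k \<in> K" "w \<in> E" "x = k * u + w"
        using x unfolding line_extension_mem_iff by (auto simp: ring_of_type_algebra_def)
      obtain q where q: "\<forall>i. q i \<in> K" "w = (\<Sum>i<n. q i * e i)" using e kw(2) by blast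
      show ?thesis
        using q kw by (intro exI[of _ "q(n := k)"]) (auto simp: add.commute)
    qed
    then show ?case by blast
  qed
qed

text \<open>Since \<open>K\<close> is spanned by finitely many elements over \<open>Q\<close>, the
  closure is algebraic over \<open>Q\<close>; and conjugates over \<open>K\<close> are conjugates
  over the smaller field \<open>Q\<close>, where \<open>v_conjugate\<close> applies.\<close>

theorem local_closure_alg_closure:
  fixes v :: "'k::field alg_closure \<Rightarrow> rat"
  assumes p: "prime p" and fin: "finite_extension_of_Qp p TYPE('k)" and v: "normalised_valuation v"
  shows "local_closure v (range to_ac) p"
proof -
  let ?K = "range (to_ac :: 'k \<Rightarrow> 'k alg_closure)"
  interpret val: valued_field v
    using v by unfold_locales (simp add: normalised_valuation_def)
  have vK: "v ` (?K - {0}) = \<int>"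
  proof -
    have "?K - {0} = to_ac ` (UNIV - {0})" by auto
    then show ?thesis using v by (simp add: normalised_valuation_def image_image)
  qed
  have K: "sub_field ?K"
    unfolding sub_field_def sub_ring_def
  proof (intro conjI ballI)
    show "1 \<in> ?K" using rangeI[of to_ac 1] by simp
    show "x - y \<in> ?K" "x * y \<in> ?K" if "x \<in> ?K" "y \<in> ?K" for x y
      using that by (auto simp flip: to_ac_diff to_ac_mult)
    show "inverse x \<in> ?K" if "x \<in> ?K" for x
      using that by (auto simp flip: to_ac_inverse)
  qed
  obtain h where h: "h \<in> ring_hom (Qp p) (ring_of_type_algebra :: 'k ring)"
    and fd: "ring.finite_dimension (ring_of_type_algebra :: 'k ring) (h ` carrier (Qp p)) UNIV"
    using fin by (auto simp: finite_extension_of_Qp_def)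
  obtain H where H: "padic_hom p H" "H ` {a. padic_Cauchy p a} = to_ac ` h ` carrier (Qp p)"
    using padic_hom_of_ring_hom[OF p h, of to_ac] by auto
  interpret padic_hom p H by (rule H)
  have Qh: "Q = to_ac ` h ` carrier (Qp p)" using H(2) by (simp add: Q_def)
  have QK: "Q \<subseteq> ?K" unfolding Qh by auto
  have "0 \<in> Q" using sub_ringD(2) Q_field by (auto simp: sub_field_def)
  then have "0 \<in> h ` carrier (Qp p)" unfolding Qh by (metis image_iff to_ac_eq_0_iff)
  moreover obtain n where "ring.dimension (ring_of_type_algebra :: 'k ring) n (h ` carrier (Qp p)) UNIV"
    using fd unfolding ring.finite_dimension_def[OF ring_from_type_algebra] by blast
  ultimately have "\<exists>e. \<forall>x\<in>UNIV. \<exists>q. (\<forall>i. q i \<in> h ` carrier (Qp p)) \<and> x = (\<Sum>i<n. q i * (e i :: 'k))"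
    by (intro dimension_span)
  then obtain e :: "nat \<Rightarrow> 'k" where
    e: "\<forall>x\<in>UNIV. \<exists>q. (\<forall>i. q i \<in> h ` carrier (Qp p)) \<and> x = (\<Sum>i<n. q i * e i)" by (rule exE)
  have algK: "algebraic_in ?K x" for x :: "'k alg_closure"
  proof -
    obtain P :: "'k poly" where "P \<noteq> 0" "poly (map_poly to_ac P) x = 0" by (rule alg_closure_algebraic)
    moreover from this have "map_poly to_ac P \<noteq> 0" by (metis coeff_map_poly leading_coeff_0_iff coeff_0 to_ac_0 to_ac_eq_0_iff)
    ultimately show ?thesis
      unfolding algebraic_in_def cf_def by (intro exI[of _ "map_poly to_ac P"]) (auto simp: coeff_map_poly)
  qed
  have "algebraic_in Q x" for x
  proof (rule algebraic_trans[OF Q_field K _ algK])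
    fix y assume "y \<in> ?K"
    then obtain z where z: "y = to_ac z" by blast
    obtain q where q: "\<forall>i. q i \<in> h ` carrier (Qp p)" "z = (\<Sum>i<n. q i * e i)" using bspec[OF e UNIV_I, of z] by (elim exE conjE) (rule that)
    show "\<exists>q. (\<forall>j. q j \<in> Q) \<and> y = (\<Sum>j<n. q j * to_ac (e j))"
      using q z by (intro exI[of _ "\<lambda>j. to_ac (q j)"]) (auto simp: Qh to_ac_sum)
  qed
  moreover have "v x \<in> \<int>" if "x \<in> Q" "x \<noteq> 0" for x using that QK vK by auto
  moreover have "\<exists>x. x \<noteq> 0 \<and> v x = 1"
  proof -
    have "1 \<in> v ` (?K - {0})" using vK by simp
    then show ?thesis by (metis DiffE imageE singletonI)
  qed
  ultimately interpret padic_closure p H v by unfold_locales auto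
  show ?thesis
  proof unfold_locales
    fix x y :: "'k alg_closure"
    assume xy: "x \<noteq> 0" "y \<noteq> 0" and conj: "\<And>P. cf ?K P \<Longrightarrow> poly P x = 0 \<Longrightarrow> poly P y = 0"
    show "v x = v y"
      by (rule v_conjugate[OF xy]) (use conj cf_subset[OF QK] in blast)
  qed (use p K algK vK char0 v_of_nat in auto)
qed

section \<open>Cyclic groups acting on cluster pictures\<close>

definition per :: "('b \<Rightarrow> 'b) \<Rightarrow> 'b \<Rightarrow> nat" where
  "per f x = (LEAST n. 0 < n \<and> (f ^^ n) x = x)"

lemma
  assumes N: "N > 0" "(f ^^ N) x = x"
  shows per_pos: "per f x > 0"
    and per_dvd: "(f ^^ m) x = x \<longleftrightarrow> per f x dvd m"
proof -
  define q where "q = per f x"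
  have q: "0 < q" "(f ^^ q) x = x"
    using LeastI[of "\<lambda>n. 0 < n \<and> (f ^^ n) x = x" N] N by (auto simp: q_def per_def)
  then show "per f x > 0" by (simp add: q_def)
  have mult: "(f ^^ (q * k)) x = x" for k
    by (induction k) (use q in \<open>auto simp: funpow_add\<close>)
  have mod: "(f ^^ m) x = (f ^^ (m mod q)) x"
  proof -
    have "(f ^^ (m mod q + q * (m div q))) x = (f ^^ (m mod q)) x"
      by (simp only: funpow_add o_apply mult)
    then show ?thesis by simp
  qed
  have "m mod q = 0" if "(f ^^ m) x = x"
  proof (rule ccontr)
    assume "m mod q \<noteq> 0"
    then have "0 < m mod q \<and> (f ^^ (m mod q)) x = x" using that mod by simp
    then have "q \<le> m mod q" unfolding q_def per_def by (rule Least_le)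
    then show False using mod_less_divisor[OF q(1), of m] by linarith
  qed
  moreover have "(f ^^ m) x = x" if "m mod q = 0"
    by (subst mod, subst that) simp
  ultimately show "(f ^^ m) x = x \<longleftrightarrow> per f x dvd m"
    unfolding q_def dvd_eq_mod_eq_0 by (rule iffI)
qed

lemma per_cong:
  assumes N: "N > 0" "(f ^^ N) x = x"
  shows "(f ^^ m) x = (f ^^ n) x \<longleftrightarrow> [m = n] (mod per f x)"
proof -
  have *: "(f ^^ m) x = (f ^^ n) x \<longleftrightarrow> [m = n] (mod per f x)" if mn: "m \<le> n" for m n
  proof
    assume "[m = n] (mod per f x)"
    then obtain k where k: "n = m + k * per f x" using cong_le_nat[OF mn, of "per f x"] cong_sym by (metis add.commute)
    have "(f ^^ (k * per f x)) x = x" using per_dvd[OF N] by simp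
    then show "(f ^^ m) x = (f ^^ n) x" unfolding k by (simp add: funpow_add)
  next
    assume eq: "(f ^^ m) x = (f ^^ n) x"
    \<comment> \<open>Only forward iterates are available: \<open>r\<close> further steps complete
      the first \<open>m\<close> steps to a multiple of \<open>N\<close> and so undo them.\<close>
    define r where "r = N * m - m"
    have "N * m \<ge> m" using N by (cases N) auto
    then have rm: "r + m = N * m" by (simp add: r_def)
    have "(f ^^ (r + m)) x = x" using per_dvd[OF N] N rm by (metis dvd_mult2)
    moreover have "(f ^^ (r + m)) x = (f ^^ (r + n)) x" using eq by (simp add: funpow_add)
    ultimately have "per f x dvd r + m" "per f x dvd r + n" using per_dvd[OF N] by metis+
    then have "[r + m = r + n] (mod per f x)" by (metis cong_0_iff cong_sym cong_trans)
    then show "[m = n] (mod per f x)" by (simp add: cong_add_lcancel_nat)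
  qed
  show ?thesis using *[of m n] *[of n m] cong_sym by (metis nle_le)
qed

lemma funpow_image:
  fixes c :: "'x \<Rightarrow> 'x"
  shows "(image c ^^ n) s = (c ^^ n) ` s"
  by (induction n) (auto simp: image_comp)

text \<open>The denominator generates the ideal of integers \<open>k\<close> that make
  \<open>k * q\<close> integral; denominators are compared through this divisibility.\<close>

lemma denom_dvd_iff: "of_nat k * q \<in> \<int> \<longleftrightarrow> denom q dvd k"
proof -
  obtain a b where ab: "quotient_of q = (a, b)" by fastforce
  have b: "b > 0" and co: "coprime a b" and q: "q = of_int a / of_int b"
    using quotient_of_denom_pos[OF ab] quotient_of_coprime[OF ab] quotient_of_div[OF ab] by auto
  have dn: "denom q = nat b" by (simp add: denom_def ab)
  have "of_nat k * q \<in> \<int> \<longleftrightarrow> b dvd int k * a"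
  proof
    assume "of_nat k * q \<in> \<int>"
    then obtain m where "of_nat k * q = of_int m" by (auto elim: Ints_cases)
    then have "of_int (int k * a) / of_int b = (of_int m :: rat)" using q by simp
    then have "of_int (int k * a) = (of_int (b * m) :: rat)" using b by (simp add: divide_eq_eq mult.commute)
    then show "b dvd int k * a" by (metis dvd_triv_left of_int_eq_iff)
  next
    assume "b dvd int k * a"
    then obtain m where "int k * a = b * m" by (auto elim: dvdE)
    then have "of_int (int k * a) = (of_int (b * m) :: rat)" by (simp only:)
    then have "of_int (int k * a) / of_int b = (of_int m :: rat)" using b by (simp add: divide_eq_eq mult.commute)
    then have "of_nat k * q = of_int m" using q by simp
    then show "of_nat k * q \<in> \<int>" by simp
  qed
  also have "\<dots> \<longleftrightarrow> b dvd int k" using co by (simp add: coprime_commute coprime_dvd_mult_left_iff)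
  also have "\<dots> \<longleftrightarrow> denom q dvd k" using b dn by (simp add: nat_dvd_iff)
  finally show ?thesis .
qed

lemma denom_pos: "denom q > 0"
  using quotient_of_denom_pos' by (simp add: denom_def)

lemma denom_one: "denom 1 = 1"
  by (simp add: denom_def)

text \<open>Both sides have the same multiples: \<open>e * k\<close> clears the denominator of
  \<open>q\<close> exactly when \<open>k\<close> clears that of \<open>q * e\<close>. This converts
  orbit lengths multiplied down a chain of clusters into the lcm of Hypothesis H.\<close>

lemma lcm_denom:
  assumes "e > 0"
  shows "lcm e (denom q) = e * denom (q * of_nat e)"
proof -
  have "lcm e (denom q) dvd m \<longleftrightarrow> e * denom (q * of_nat e) dvd m" for m
  proof (cases "e dvd m")
    case True
    then obtain k where k: "m = e * k" by (auto elim: dvdE)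
    have "lcm e (denom q) dvd m \<longleftrightarrow> denom q dvd m" using True by simp
    also have "\<dots> \<longleftrightarrow> of_nat m * q \<in> \<int>" by (simp add: denom_dvd_iff)
    also have "of_nat m * q = of_nat k * (q * of_nat e)" by (simp add: k)
    also have "\<dots> \<in> \<int> \<longleftrightarrow> denom (q * of_nat e) dvd k" by (rule denom_dvd_iff)
    also have "\<dots> \<longleftrightarrow> e * denom (q * of_nat e) dvd m" using assms k by simp
    finally show ?thesis .
  qed (auto dest: dvd_mult_left)
  then show ?thesis by (metis dvd_antisym dvd_refl)
qed

section \<open>Children and parents of clusters\<close>

context cluster_picture
begin

lemma finite_clusters: "finite \<Sigma>"
  using clusters_subset finite_X by (meson PowI finite_Pow_iff finite_subset subsetI)

lemma finite_cluster: "s \<in> \<Sigma> \<Longrightarrow> finite s"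
  using clusters_subset finite_X finite_subset by blast

lemma is_childD:
  "is_child \<Sigma> t s \<Longrightarrow> t \<in> \<Sigma>" "is_child \<Sigma> t s \<Longrightarrow> t \<subset> s"
  by (auto simp: is_child_def)

lemma child_exists:
  assumes "u \<in> \<Sigma>" "s \<in> \<Sigma>" "u \<subset> s"
  shows "\<exists>t. is_child \<Sigma> t s \<and> u \<subseteq> t"
proof -
  let ?A = "{t \<in> \<Sigma>. u \<subseteq> t \<and> t \<subset> s}"
  have "finite ?A" "u \<in> ?A" using finite_clusters assms by auto
  then obtain t where "t \<in> ?A" "u \<subseteq> t" "\<forall>t'\<in>?A. t \<subseteq> t' \<longrightarrow> t = t'"
    using finite_has_maximal2 by (metis (no_types, lifting))
  then have "is_child \<Sigma> t s" unfolding is_child_def by blast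
  then show ?thesis using \<open>u \<subseteq> t\<close> by blast
qed

lemma children_disjoint:
  assumes "is_child \<Sigma> t s" "is_child \<Sigma> t' s" "t \<inter> t' \<noteq> {}"
  shows "t = t'"
  using disjoint_or_nested[of t t'] assms unfolding is_child_def by blast

lemma proper_child_of_point:
  assumes "s \<in> \<Sigma>" "card s > 1" "x \<in> s"
  shows "\<exists>t. is_child \<Sigma> t s \<and> x \<in> t"
proof -
  have "{x} \<subset> s" using assms by (auto simp: psubset_eq)
  moreover have "{x} \<in> \<Sigma>" using singletons clusters_subset assms by blast
  ultimately show ?thesis using child_exists[of "{x}" s] assms by auto
qed

lemma card_gt_1_if_child:
  assumes "is_child \<Sigma> t s" "s \<in> \<Sigma>"
  shows "card s > 1"
proof -
  have "card t > 0" "card t < card s"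
    using assms clusters_nonempty finite_cluster is_childD psubset_card_mono card_gt_0_iff by metis+
  then show ?thesis by simp
qed

lemma parent_exists:
  assumes "s \<in> \<Sigma>" "s \<noteq> \<X>"
  shows "\<exists>u\<in>\<Sigma>. is_child \<Sigma> s u"
proof -
  let ?A = "{u \<in> \<Sigma>. s \<subset> u}"
  have "finite ?A" "\<X> \<in> ?A" using finite_clusters assms clusters_subset X_cluster by auto
  then obtain u where u: "u \<in> ?A" "\<forall>t'\<in>?A. t' \<subseteq> u \<longrightarrow> u = t'"
    using finite_has_minimal2 by (metis (no_types, lifting))
  then have "is_child \<Sigma> s u" using assms unfolding is_child_def by blast
  then show ?thesis using u by blast
qed

lemma parent_subset:
  assumes "is_child \<Sigma> s u" "u \<in> \<Sigma>" "s' \<in> \<Sigma>" "s \<subset> s'"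
  shows "u \<subseteq> s'"
  using disjoint_or_nested[of u s'] assms clusters_nonempty[of s] unfolding is_child_def by blast

lemma parent_unique:
  assumes "is_child \<Sigma> s u" "is_child \<Sigma> s u'" "u \<in> \<Sigma>" "u' \<in> \<Sigma>"
  shows "u = u'"
  using parent_subset[OF assms(1,3,4)] parent_subset[OF assms(2,4,3)] is_childD(2)[OF assms(1)] is_childD(2)[OF assms(2)]
  by blast

end

section \<open>The action of one permutation on clusters\<close>

locale cluster_perm = cluster_picture \<X> \<Sigma> d
  for \<X> :: "'x set" and \<Sigma> :: "'x set set" and d :: "'x set \<Rightarrow> rat" +
  fixes c :: "'x \<Rightarrow> 'x"
  assumes c_Bij: "c \<in> carrier (BijGroup \<X>)"
    and c_iso: "cluster_iso_by c \<X> \<Sigma> d \<X> \<Sigma> d"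
begin

text \<open>The period of a cluster under \<open>c\<close>. By \<open>stab_index_eq\<close> it is
  the index of the stabiliser, and it carries the group theory from there on.\<close>

definition e :: "'x set \<Rightarrow> nat" where "e = per (image c)"

lemma c_bij: "bij_betw c \<X> \<X>" and c_ext: "c \<in> extensional \<X>"
  using c_Bij by (auto simp: BijGroup_def Bij_def)

lemma funpow_bij: "bij_betw (c ^^ n) \<X> \<X>"
proof (induction n)
  case 0
  show ?case unfolding funpow.simps by (rule bij_betw_id)
next
  case (Suc n)
  show ?case unfolding funpow.simps by (rule bij_betw_trans[OF Suc c_bij])
qed

lemma group_Bij: "group (BijGroup \<X>)" by (rule group_BijGroup)

lemma funpow_in: "x \<in> \<X> \<Longrightarrow> (c ^^ n) x \<in> \<X>"
  using funpow_bij bij_betwE by blast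

lemma pow_eq: "c [^]\<^bsub>BijGroup \<X>\<^esub> n = restrict (c ^^ n) \<X>"
proof (induction n)
  case 0
  show ?case by (auto simp: BijGroup_def)
next
  case (Suc n)
  have "restrict (c ^^ n) \<X> \<in> Bij \<X>" using funpow_bij by (auto simp: Bij_def)
  moreover have "c \<in> Bij \<X>" using c_Bij by (simp add: BijGroup_def)
  ultimately have "restrict (c ^^ n) \<X> \<otimes>\<^bsub>BijGroup \<X>\<^esub> c = compose \<X> (restrict (c ^^ n) \<X>) c"
    by (simp add: BijGroup_def)
  also have "\<dots> = restrict (c ^^ Suc n) \<X>"
    using c_bij by (auto simp: compose_def fun_eq_iff funpow_swap1 bij_betwE)
  finally have "restrict (c ^^ n) \<X> \<otimes>\<^bsub>BijGroup \<X>\<^esub> c = restrict (c ^^ Suc n) \<X>" .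
  then show ?case
    using monoid.nat_pow_Suc[OF group.is_monoid[OF group_Bij], of c n] unfolding Suc by simp (simp add: fun_eq_iff)
qed

lemma finite_Bij: "finite (carrier (BijGroup \<X>))"
proof -
  have "carrier (BijGroup \<X>) \<subseteq> \<X> \<rightarrow>\<^sub>E \<X>"
    by (auto simp: BijGroup_def Bij_def PiE_def dest: bij_betwE)
  then show ?thesis using finite_PiE[OF finite_X finite_X] finite_subset by blast
qed

lemma order_exists: "\<exists>N>0. \<forall>x\<in>\<X>. (c ^^ N) x = x"
proof -
  interpret group "BijGroup \<X>" by (rule group_Bij)
  have "c [^]\<^bsub>BijGroup \<X>\<^esub> Coset.order (BijGroup \<X>) = \<one>\<^bsub>BijGroup \<X>\<^esub>" using pow_order_eq_1[OF c_Bij] .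
  then have "restrict (c ^^ Coset.order (BijGroup \<X>)) \<X> = (\<lambda>x\<in>\<X>. x)" unfolding pow_eq by (simp add: BijGroup_def)
  then have "\<forall>x\<in>\<X>. (c ^^ Coset.order (BijGroup \<X>)) x = x" by (metis restrict_apply')
  moreover have "Coset.order (BijGroup \<X>) > 0" using order_gt_0_iff_finite finite_Bij by blast
  ultimately show ?thesis by blast
qed

lemma set_order_exists: "\<exists>N>0. \<forall>s. s \<subseteq> \<X> \<longrightarrow> (image c ^^ N) s = s"
  using order_exists unfolding funpow_image by (metis (no_types, lifting) image_cong image_ident subsetD)

lemma e_pos: "s \<subseteq> \<X> \<Longrightarrow> e s > 0"
  unfolding e_def using set_order_exists per_pos by metis

lemma fixed_iff: "s \<subseteq> \<X> \<Longrightarrow> (c ^^ n) ` s = s \<longleftrightarrow> e s dvd n"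
  unfolding e_def funpow_image[symmetric] using set_order_exists per_dvd by metis

lemma eq_iff: "s \<subseteq> \<X> \<Longrightarrow> (c ^^ m) ` s = (c ^^ n) ` s \<longleftrightarrow> [m = n] (mod e s)"
  unfolding e_def funpow_image[symmetric] using set_order_exists per_cong by metis

lemma carrier_C: "carrier (cyclic_group \<X> c) = range (\<lambda>n. restrict (c ^^ n) \<X>)"
proof -
  interpret group "BijGroup \<X>" by (rule group_Bij)
  have "generate (BijGroup \<X>) {c} = {c [^]\<^bsub>BijGroup \<X>\<^esub> k | k. k \<in> (UNIV :: nat set)}"
    using generate_pow_on_finite_carrier[OF finite_Bij c_Bij] .
  then show ?thesis by (auto simp: cyclic_group_def pow_eq)
qed

lemma restrict_image: "s \<subseteq> \<X> \<Longrightarrow> restrict (c ^^ n) \<X> ` s = (c ^^ n) ` s"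
  by (intro image_cong) auto

text \<open>A subgroup of a cyclic group is generated by its least positive power of
  \<open>c\<close>, here the first one that fixes \<open>s\<close>.\<close>

lemma cluster_stab_eq:
  assumes s: "s \<subseteq> \<X>"
  shows "cluster_stab (cyclic_group \<X> c) s = (\<lambda>n. restrict (c ^^ (e s * n)) \<X>) ` UNIV"
proof (intro equalityI subsetI)
  fix g assume "g \<in> cluster_stab (cyclic_group \<X> c) s"
  then obtain n where n: "g = restrict (c ^^ n) \<X>" "g ` s = s"
    by (auto simp: cluster_stab_def stabilizer_def carrier_C)
  then have "e s dvd n" using restrict_image[OF s] fixed_iff[OF s] by simp
  then show "g \<in> (\<lambda>n. restrict (c ^^ (e s * n)) \<X>) ` UNIV" using n by (auto elim!: dvdE)
next
  fix g assume "g \<in> (\<lambda>n. restrict (c ^^ (e s * n)) \<X>) ` UNIV"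
  then obtain n where n: "g = restrict (c ^^ (e s * n)) \<X>" by blast
  have "(c ^^ (e s * n)) ` s = s" using fixed_iff[OF s] by simp
  then show "g \<in> cluster_stab (cyclic_group \<X> c) s"
    using n restrict_image[OF s] by (auto simp: cluster_stab_def stabilizer_def carrier_C)
qed

lemma C_mult: "restrict (c ^^ m) \<X> \<otimes>\<^bsub>cyclic_group \<X> c\<^esub> restrict (c ^^ n) \<X> = restrict (c ^^ (m + n)) \<X>"
proof -
  have "restrict (c ^^ m) \<X> \<in> Bij \<X>" for m using funpow_bij by (auto simp: Bij_def)
  then show ?thesis
    using funpow_in by (auto simp: cyclic_group_def BijGroup_def compose_def fun_eq_iff funpow_add)
qed

lemma stab_index_eq:
  assumes s: "s \<subseteq> \<X>"
  shows "stab_index (cyclic_group \<X> c) s = e s"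
proof -
  let ?C = "cyclic_group \<X> c" and ?S = "cluster_stab (cyclic_group \<X> c) s"
  let ?g = "\<lambda>n. ?S #>\<^bsub>?C\<^esub> restrict (c ^^ n) \<X>"
  have coset: "?g n = {h. \<exists>k. h = restrict (c ^^ (e s * k + n)) \<X>}" for n
    unfolding r_coset_def cluster_stab_eq[OF s] by (auto simp: C_mult)
  have mem: "restrict (c ^^ m) \<X> \<in> ?g n \<longrightarrow> [m = n] (mod e s)" for m n
  proof
    assume "restrict (c ^^ m) \<X> \<in> ?g n"
    then obtain k where "restrict (c ^^ m) \<X> = restrict (c ^^ (e s * k + n)) \<X>" unfolding coset by blast
    then have "(c ^^ m) ` s = (c ^^ (e s * k + n)) ` s" using restrict_image[OF s] by metis
    then have "[m = e s * k + n] (mod e s)" using eq_iff[OF s] by simp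
    then show "[m = n] (mod e s)" by (simp add: cong_def)
  qed
  have "rcosets\<^bsub>?C\<^esub> ?S = ?g ` UNIV" unfolding RCOSETS_def carrier_C by auto
  also have "\<dots> = ?g ` {..<e s}"
  proof -
    have "?g n \<in> ?g ` {..<e s}" for n
    proof -
      obtain N where N: "N > 0" "\<forall>x\<in>\<X>. (c ^^ N) x = x" using order_exists by blast
      have per: "restrict (c ^^ (N * k + m)) \<X> = restrict (c ^^ m) \<X>" for k m
      proof (induction k)
        case (Suc k)
        have "restrict (c ^^ (N + (N * k + m))) \<X> = restrict (c ^^ (N * k + m)) \<X>"
          using N funpow_in by (auto simp: funpow_add fun_eq_iff)
        then show ?case using Suc by (simp add: add.assoc)
      qed simp
      have "?g n = ?g (n mod e s)"
      proof (intro equalityI subsetI)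
        fix h assume "h \<in> ?g n"
        then obtain k where "h = restrict (c ^^ (e s * k + n)) \<X>" unfolding coset by blast
        also have "e s * k + n = e s * (k + n div e s) + n mod e s"
          by (metis add.assoc distrib_left mult_div_mod_eq)
        finally show "h \<in> ?g (n mod e s)" unfolding coset by blast
      next
        fix h assume "h \<in> ?g (n mod e s)"
        then obtain k where k: "h = restrict (c ^^ (e s * k + n mod e s)) \<X>" unfolding coset by blast
        \<comment> \<open>Exponents are natural numbers, so going back by \<open>n div e s\<close>
          turns is replaced by adding turns up to a multiple of \<open>N\<close>.\<close>
        have "N * (n div e s) \<ge> n div e s" using N by (cases N) auto
        then obtain j where j: "N * (n div e s) = n div e s + j" using le_Suc_ex by blast
        have "h = restrict (c ^^ (N * (n div e s * e s) + (e s * k + n mod e s))) \<X>" using k per by simp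
        also have "N * (n div e s * e s) + (e s * k + n mod e s) = e s * (k + j) + n"
        proof -
          have "N * (n div e s * e s) = e s * (n div e s) + e s * j"
            using j by (metis distrib_left mult.assoc mult.commute)
          then show ?thesis using mult_div_mod_eq[of "e s" n] by (simp add: algebra_simps)
        qed
        finally show "h \<in> ?g n" unfolding coset by blast
      qed
      then show ?thesis using e_pos[OF s] by auto
    qed
    then show ?thesis by auto
  qed
  finally have eq: "rcosets\<^bsub>?C\<^esub> ?S = ?g ` {..<e s}" .
  have "inj_on ?g {..<e s}"
  proof (rule inj_onI)
    fix m n assume mn: "m \<in> {..<e s}" "n \<in> {..<e s}" "?g m = ?g n"
    have "restrict (c ^^ m) \<X> \<in> ?g m" unfolding coset by (auto intro: exI[of _ 0])
    then have "[m = n] (mod e s)" using mn mem by blast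
    then show "m = n" using mn by (auto simp: cong_def)
  qed
  then show ?thesis unfolding stab_index_def eq by (simp add: card_image)
qed

text \<open>The stabiliser of \<open>s\<close> is generated by \<open>c ^^ e s\<close>, under which
  \<open>t\<close> first returns after \<open>e t div e s\<close> steps.\<close>

lemma orbit_card:
  assumes s: "s \<subseteq> \<X>" and t: "t \<subseteq> \<X>" "e s dvd e t"
  shows "card (orbit ((cyclic_group \<X> c)\<lparr>carrier := cluster_stab (cyclic_group \<X> c) s\<rparr>) image t) = e t div e s"
proof -
  have "orbit ((cyclic_group \<X> c)\<lparr>carrier := cluster_stab (cyclic_group \<X> c) s\<rparr>) image t
      = range (\<lambda>n. (c ^^ (e s * n)) ` t)"
  proof -
    have "orbit ((cyclic_group \<X> c)\<lparr>carrier := cluster_stab (cyclic_group \<X> c) s\<rparr>) image t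
        = (\<lambda>g. g ` t) ` cluster_stab (cyclic_group \<X> c) s"
      by (auto simp: orbit_def)
    then show ?thesis unfolding cluster_stab_eq[OF s] image_image restrict_image[OF t(1)] .
  qed
  also have "\<dots> = (\<lambda>n. (c ^^ (e s * n)) ` t) ` {..<e t div e s}"
  proof -
    obtain q where q: "e t = e s * q" using t(2) by (auto elim: dvdE)
    then have q0: "q > 0" "e t div e s = q" using e_pos[OF t(1)] e_pos[OF s] by auto
    have "[e s * n = e s * (n mod q)] (mod e t)" for n
      unfolding q cong_def mult_mod_right by (rule mod_mod_trivial[symmetric])
    then have eq: "(c ^^ (e s * n)) ` t = (c ^^ (e s * (n mod q))) ` t" for n using eq_iff[OF t(1)] by blast
    have "(c ^^ (e s * n)) ` t \<in> (\<lambda>n. (c ^^ (e s * n)) ` t) ` {..<q}" for n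
      using eq[of n] by (intro image_eqI[of _ _ "n mod q"]) (use q0 in auto)
    then show ?thesis unfolding q0(2) by auto
  qed
  also have "card \<dots> = e t div e s"
  proof -
    obtain q where q: "e t = e s * q" using t(2) by (auto elim: dvdE)
    have q0: "e t div e s = q" "e s > 0" using q e_pos[OF s] by auto
    have "inj_on (\<lambda>n. (c ^^ (e s * n)) ` t) {..<q}"
    proof (rule inj_onI)
      fix m n assume mn: "m \<in> {..<q}" "n \<in> {..<q}" "(c ^^ (e s * m)) ` t = (c ^^ (e s * n)) ` t"
      then have "[e s * m = e s * n] (mod e s * q)" using eq_iff[OF t(1)] q by simp
      then have "e s * (m mod q) = e s * (n mod q)" unfolding cong_def mult_mod_right .
      then show "m = n" using q0 mn by simp
    qed
    then show ?thesis using q0 by (simp add: card_image)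
  qed
  finally show ?thesis .
qed

lemma image_cluster: "s \<in> \<Sigma> \<Longrightarrow> (c ^^ n) ` s \<in> \<Sigma>"
proof (induction n)
  case (Suc n)
  have "bij_betw (image c) \<Sigma> \<Sigma>" using c_iso by (simp add: cluster_iso_by_def)
  then have "c ` (c ^^ n) ` s \<in> \<Sigma>" using Suc bij_betwE by blast
  then show ?case by (simp add: image_comp)
qed simp

lemma card_image_cluster: "s \<in> \<Sigma> \<Longrightarrow> card ((c ^^ n) ` s) = card s"
  using funpow_bij clusters_subset by (meson bij_betw_imp_inj_on card_image inj_on_subset)

lemma depth_image: "s \<in> \<Sigma> \<Longrightarrow> card s > 1 \<Longrightarrow> d ((c ^^ n) ` s) = d s"
proof (induction n)
  case (Suc n)
  have "d (c ` (c ^^ n) ` s) = d ((c ^^ n) ` s)"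
    using c_iso Suc image_cluster card_image_cluster by (simp add: cluster_iso_by_def)
  then show ?case using Suc by (simp add: image_comp)
qed simp

lemma inverse_power: "\<exists>m. \<forall>x\<in>\<X>. (c ^^ m) ((c ^^ i) x) = x \<and> (c ^^ i) ((c ^^ m) x) = x"
proof -
  obtain N where N: "N > 0" "\<forall>x\<in>\<X>. (c ^^ N) x = x" using order_exists by blast
  have 1: "(c ^^ (N * k)) x = x" if "x \<in> \<X>" for x k
    using that by (induction k) (auto simp: funpow_add N(2))
  have "N * i \<ge> i" using N by (cases N) auto
  then have "(c ^^ (N * i - i)) ((c ^^ i) x) = x \<and> (c ^^ i) ((c ^^ (N * i - i)) x) = x" if "x \<in> \<X>" for x
    using 1[OF that, of i] by (simp flip: funpow_add o_apply[of "c ^^ _"])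
  then show ?thesis by blast
qed

lemma inverse_power_image:
  "\<exists>m. \<forall>u. u \<subseteq> \<X> \<longrightarrow> (c ^^ m) ` (c ^^ i) ` u = u \<and> (c ^^ i) ` (c ^^ m) ` u = u"
proof -
  obtain m where m: "\<And>x. x \<in> \<X> \<Longrightarrow> (c ^^ m) ((c ^^ i) x) = x \<and> (c ^^ i) ((c ^^ m) x) = x"
    using inverse_power by blast
  then have "(c ^^ m) ` (c ^^ i) ` u = u \<and> (c ^^ i) ` (c ^^ m) ` u = u" if "u \<subseteq> \<X>" for u
    using that unfolding image_image by (auto simp: subset_iff intro: image_eqI[rotated])
  then show ?thesis by blast
qed

lemma image_subset_iff:
  assumes "s \<subseteq> \<X>" "t \<subseteq> \<X>"
  shows "(c ^^ n) ` s \<subseteq> (c ^^ n) ` t \<longleftrightarrow> s \<subseteq> t"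
proof
  assume *: "(c ^^ n) ` s \<subseteq> (c ^^ n) ` t"
  have inj: "inj_on (c ^^ n) \<X>" using funpow_bij bij_betw_imp_inj_on by blast
  show "s \<subseteq> t"
  proof
    fix x assume "x \<in> s"
    then obtain y where "y \<in> t" "(c ^^ n) x = (c ^^ n) y" using * by blast
    then show "x \<in> t" using inj_onD[OF inj, of x y] assms \<open>x \<in> s\<close> by blast
  qed
qed blast

lemma image_child:
  assumes "is_child \<Sigma> t s" "s \<in> \<Sigma>"
  shows "is_child \<Sigma> ((c ^^ n) ` t) ((c ^^ n) ` s)"
  unfolding is_child_def
proof (intro conjI notI)
  have t: "t \<in> \<Sigma>" "t \<subset> s" using assms is_childD by auto
  note sub = clusters_subset[OF assms(2)] clusters_subset[OF t(1)]
  show "(c ^^ n) ` t \<in> \<Sigma>" using image_cluster t by blast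
  show "(c ^^ n) ` t \<subset> (c ^^ n) ` s" using t image_subset_iff sub by (simp add: less_le_not_le)
  assume "\<exists>u\<in>\<Sigma>. (c ^^ n) ` t \<subset> u \<and> u \<subset> (c ^^ n) ` s"
  then obtain u where u: "u \<in> \<Sigma>" "(c ^^ n) ` t \<subset> u" "u \<subset> (c ^^ n) ` s" by blast
  obtain m where "\<forall>u. u \<subseteq> \<X> \<longrightarrow> (c ^^ m) ` (c ^^ n) ` u = u \<and> (c ^^ n) ` (c ^^ m) ` u = u"
    using inverse_power_image[of n] by (rule exE)
  then have m: "u \<subseteq> \<X> \<Longrightarrow> (c ^^ m) ` (c ^^ n) ` u = u" for u by simp
  note sub' = clusters_subset[OF u(1)] clusters_subset[OF image_cluster[OF t(1)]] clusters_subset[OF image_cluster[OF assms(2)]]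
  have "(c ^^ m) ` (c ^^ n) ` t \<subset> (c ^^ m) ` u" "(c ^^ m) ` u \<subset> (c ^^ m) ` (c ^^ n) ` s"
    using u image_subset_iff sub' by (simp_all add: less_le_not_le)
  then have "t \<subset> (c ^^ m) ` u" "(c ^^ m) ` u \<subset> s" using m sub by simp_all
  then show False using assms(1) image_cluster[OF u(1)] unfolding is_child_def by blast
qed

text \<open>A power of \<open>c\<close> that fixes a child also fixes its unique parent.\<close>

lemma child_e_dvd:
  assumes "is_child \<Sigma> t s" "s \<in> \<Sigma>"
  shows "e s dvd e t"
proof -
  have t: "t \<in> \<Sigma>" "t \<subset> s" using assms is_childD by auto
  have "(c ^^ e t) ` t = t" using fixed_iff[OF clusters_subset[OF t(1)], of "e t"] by simp
  then have "is_child \<Sigma> t ((c ^^ e t) ` s)" using image_child[OF assms, of "e t"] by simp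
  then have "(c ^^ e t) ` s = s" using parent_unique[OF _ assms(1) image_cluster assms(2)] assms by blast
  then show ?thesis using fixed_iff[OF clusters_subset[OF assms(2)]] by simp
qed

lemma subset_e_dvd: "t \<in> \<Sigma> \<Longrightarrow> s \<in> \<Sigma> \<Longrightarrow> t \<subseteq> s \<Longrightarrow> e s dvd e t"
proof (induction "card s - card t" arbitrary: t rule: less_induct)
  case less
  show ?case
  proof (cases "t = s")
    case False
    then have "t \<noteq> \<X>" using less clusters_subset by blast
    then obtain u where u: "u \<in> \<Sigma>" "is_child \<Sigma> t u" using parent_exists less by blast
    have us: "u \<subseteq> s" using parent_subset[OF u(2,1)] less False by blast
    have "card t < card u" using u is_childD finite_cluster psubset_card_mono by metis
    moreover have "card u \<le> card s" using us less finite_cluster card_mono by blast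
    ultimately have "card s - card u < card s - card t" by simp
    then have "e s dvd e u" using less u us by blast
    then show ?thesis using child_e_dvd[OF u(2,1)] by (rule dvd_trans)
  qed simp
qed

abbreviation fixed_children :: "'x set \<Rightarrow> 'x set set" where
  "fixed_children s \<equiv> {u. is_child \<Sigma> u s \<and> e u = e s}"

text \<open>The generator \<open>c ^^ e s\<close> of the stabiliser fixes a child exactly when the
  period of the child divides, and hence equals, that of \<open>s\<close>.\<close>

lemma is_orphan_iff:
  assumes "s \<in> \<Sigma>"
  shows "is_orphan (cyclic_group \<X> c) \<Sigma> t s \<longleftrightarrow> fixed_children s = {t}"
proof -
  have "(\<forall>g\<in>cluster_stab (cyclic_group \<X> c) s. g ` u = u) \<longleftrightarrow> e u = e s" if u: "is_child \<Sigma> u s" for u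
  proof -
    have us: "u \<subseteq> \<X>" using clusters_subset u is_childD by blast
    have "(\<forall>g\<in>cluster_stab (cyclic_group \<X> c) s. g ` u = u) \<longleftrightarrow> (\<forall>n. (c ^^ (e s * n)) ` u = u)"
      unfolding cluster_stab_eq[OF clusters_subset[OF assms]] using restrict_image[OF us] by auto
    also have "\<dots> \<longleftrightarrow> e u dvd e s" unfolding fixed_iff[OF us] by (metis dvd_mult2 mult_1_right)
    also have "\<dots> \<longleftrightarrow> e u = e s" using child_e_dvd[OF u assms] by (auto intro: dvd_antisym)
    finally show ?thesis .
  qed
  then have "{u. is_child \<Sigma> u s \<and> (\<forall>g\<in>cluster_stab (cyclic_group \<X> c) s. g ` u = u)} = fixed_children s" by blast
  then show ?thesis unfolding is_orphan_def by simp
qed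

text \<open>Condition (1) of Hypothesis H in terms of periods: the orbit of \<open>t\<close> under
  the stabiliser of \<open>s\<close> has length \<open>e t div e s\<close>. Condition (2) is
  recovered by \<open>index_formula\<close>.\<close>

definition tame :: bool where
  "tame \<longleftrightarrow> (\<forall>s\<in>\<Sigma>. \<forall>t. is_child \<Sigma> t s \<longrightarrow>
     fixed_children s \<noteq> {t} \<longrightarrow> e t = e s * denom (d s * of_nat (e s)))"

lemma e_top: "e \<X> = 1"
proof -
  have "c ` \<X> = \<X>" using c_bij bij_betw_imp_surj_on by blast
  then show ?thesis using fixed_iff[of \<X> 1] by simp
qed

text \<open>The formula for the indices follows from the orbit lengths by climbing down from the top
  cluster.\<close>

lemma index_formula:
  assumes tame and "s \<in> \<Sigma>"
  shows "e s = Lcm {denom (depth_star (cyclic_group \<X> c) \<Sigma> d s s') | s'. s' \<in> \<Sigma> \<and> s \<subset> s'}"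
  using assms(2)
proof (induction "card \<X> - card s" arbitrary: s rule: less_induct)
  case less
  let ?D = "depth_star (cyclic_group \<X> c) \<Sigma> d"
  show ?case
  proof (cases "s = \<X>")
    case True
    then have empty: "{denom (?D s s') | s'. s' \<in> \<Sigma> \<and> s \<subset> s'} = {}" using clusters_subset by blast
    show ?thesis unfolding empty using True e_top by simp
  next
    case False
    then obtain u where u: "u \<in> \<Sigma>" "is_child \<Sigma> s u" using parent_exists less by blast
    have su: "s \<subset> u" using u is_childD by blast
    have "card s < card u" "card u \<le> card \<X>"
      using su u finite_cluster psubset_card_mono card_mono[OF finite_X clusters_subset] by auto
    then have IH: "e u = Lcm {denom (?D u s') | s'. s' \<in> \<Sigma> \<and> u \<subset> s'}"
      using less.hyps u(1) by simp
    have the: "(THE t. is_child \<Sigma> t s' \<and> w \<subseteq> t) = t"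
      if "is_child \<Sigma> t s'" "w \<subseteq> t" "w \<in> \<Sigma>" for t s' w
    proof (rule the_equality)
      fix t' assume "is_child \<Sigma> t' s' \<and> w \<subseteq> t'"
      then show "t' = t" using children_disjoint[of t' s' t] that clusters_nonempty[of w] by blast
    qed (use that in simp)
    \<comment> \<open>In a cluster strictly above the parent \<open>u\<close>, both \<open>s\<close>
      and \<open>u\<close> lie in the same child, so the entries agree; only the entry of
      \<open>u\<close> itself is new.\<close>
    have above: "?D s s' = ?D u s'" if s': "s' \<in> \<Sigma>" "u \<subset> s'" for s'
    proof -
      obtain t where t: "is_child \<Sigma> t s'" "u \<subseteq> t" using child_exists u s' by blast
      then have "s \<subseteq> t" using su by blast
      then show ?thesis unfolding depth_star_def using the t less.prems u by simp
    qed
    have "{denom (?D s s') | s'. s' \<in> \<Sigma> \<and> s \<subset> s'}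
        = insert (denom (?D s u)) {denom (?D u s') | s'. s' \<in> \<Sigma> \<and> u \<subset> s'}"
    proof (intro equalityI subsetI)
      fix n assume "n \<in> {denom (?D s s') | s'. s' \<in> \<Sigma> \<and> s \<subset> s'}"
      then obtain s' where s': "n = denom (?D s s')" "s' \<in> \<Sigma>" "s \<subset> s'" by blast
      show "n \<in> insert (denom (?D s u)) {denom (?D u s') | s'. s' \<in> \<Sigma> \<and> u \<subset> s'}"
      proof (cases "s' = u")
        case False
        then have us': "u \<subset> s'" using parent_subset[OF u(2,1) s'(2,3)] by blast
        then have "n = denom (?D u s')" using above s' by simp
        then show ?thesis using s'(2) us' by blast
      qed (use s' in simp)
    next
      fix n assume n: "n \<in> insert (denom (?D s u)) {denom (?D u s') | s'. s' \<in> \<Sigma> \<and> u \<subset> s'}"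
      show "n \<in> {denom (?D s s') | s'. s' \<in> \<Sigma> \<and> s \<subset> s'}"
      proof (cases "n = denom (?D s u)")
        case False
        then obtain s' where s': "n = denom (?D u s')" "s' \<in> \<Sigma>" "u \<subset> s'" using n by blast
        then have "n = denom (?D s s')" "s \<subset> s'" using above su by auto
        then show ?thesis using s' by blast
      qed (use u su in blast)
    qed
    then have L: "Lcm {denom (?D s s') | s'. s' \<in> \<Sigma> \<and> s \<subset> s'} = lcm (denom (?D s u)) (e u)"
      unfolding IH by simp
    have Dsu: "?D s u = (if fixed_children u = {s} then 1 else d u)"
      unfolding depth_star_def using the[OF u(2) order_refl less.prems] is_orphan_iff[OF u(1)] by simp
    show ?thesis
    proof (cases "fixed_children u = {s}")
      case True
      then have "e s = e u" by blast
      then show ?thesis unfolding L using Dsu True denom_one by simp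
    next
      case False
      then have "e s = e u * denom (d u * of_nat (e u))" using assms(1) u unfolding tame_def by blast
      also have "\<dots> = lcm (e u) (denom (d u))"
        using lcm_denom[OF e_pos[OF clusters_subset[OF u(1)]]] by simp
      finally show ?thesis unfolding L using Dsu False by (simp add: lcm.commute)
    qed
  qed
qed

lemma condition_iff:
  "(let C = cyclic_group \<X> c in
      (\<forall>s\<in>\<Sigma>. card s > 1 \<longrightarrow>
         (\<forall>t. is_child \<Sigma> t s \<and> \<not> is_orphan C \<Sigma> t s \<longrightarrow>
            card (orbit (C\<lparr>carrier := cluster_stab C s\<rparr>) image t)
              = denom (d s * of_nat (stab_index C s)))) \<and>
      (\<forall>s\<in>\<Sigma>. stab_index C s
         = Lcm {denom (depth_star C \<Sigma> d s s') | s'. s' \<in> \<Sigma> \<and> s \<subset> s'})) \<longleftrightarrow> tame"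
proof -
  let ?C = "cyclic_group \<X> c"
  have "card (orbit (?C\<lparr>carrier := cluster_stab ?C s\<rparr>) image t) = denom (d s * of_nat (stab_index ?C s))
     \<longleftrightarrow> e t = e s * denom (d s * of_nat (e s))"
    if "s \<in> \<Sigma>" "is_child \<Sigma> t s" for s t
  proof -
    have sub: "s \<subseteq> \<X>" "t \<subseteq> \<X>" using that is_childD clusters_subset by blast+
    have "e s dvd e t" using child_e_dvd that by blast
    then obtain q where q: "e t = e s * q" by (auto elim: dvdE)
    then show ?thesis
      unfolding orbit_card[OF sub child_e_dvd[OF that(2,1)]] stab_index_eq[OF sub(1)]
      using e_pos[OF sub(1)] by simp
  qed
  then have "(\<forall>s\<in>\<Sigma>. card s > 1 \<longrightarrow>
         (\<forall>t. is_child \<Sigma> t s \<and> \<not> is_orphan ?C \<Sigma> t s \<longrightarrow>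
            card (orbit (?C\<lparr>carrier := cluster_stab ?C s\<rparr>) image t)
              = denom (d s * of_nat (stab_index ?C s)))) \<longleftrightarrow> tame"
    unfolding tame_def by (metis (no_types, lifting) is_orphan_iff card_gt_1_if_child)
  moreover have "\<forall>s\<in>\<Sigma>. stab_index ?C s = Lcm {denom (depth_star ?C \<Sigma> d s s') | s'. s' \<in> \<Sigma> \<and> s \<subset> s'}" if tame
    using index_formula[OF that] stab_index_eq clusters_subset by simp
  ultimately show ?thesis unfolding Let_def by blast
qed

end

lemma hypothesis_H_iff:
  assumes "cluster_picture \<X> \<Sigma> d"
  shows "hypothesis_H \<X> \<Sigma> d \<longleftrightarrow> (\<exists>c. cluster_perm \<X> \<Sigma> d c \<and> cluster_perm.tame \<Sigma> d c)"
proof -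
  interpret cluster_picture \<X> \<Sigma> d by (rule assms)
  have iff: "cluster_perm \<X> \<Sigma> d c \<longleftrightarrow> c \<in> carrier (BijGroup \<X>) \<and> cluster_iso_by c \<X> \<Sigma> d \<X> \<Sigma> d" for c
    using cluster_picture_axioms by (auto simp: cluster_perm_def cluster_perm_axioms_def)
  show ?thesis
    unfolding hypothesis_H_def
  proof (intro iffI; elim bexE exE conjE)
    fix c assume "c \<in> carrier (BijGroup \<X>)" "cluster_iso_by c \<X> \<Sigma> d \<X> \<Sigma> d"
    then have c: "cluster_perm \<X> \<Sigma> d c" using iff by blast
    assume "let C = cyclic_group \<X> c in
        (\<forall>s\<in>\<Sigma>. card s > 1 \<longrightarrow>
           (\<forall>t. is_child \<Sigma> t s \<and> \<not> is_orphan C \<Sigma> t s \<longrightarrow>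
              card (orbit (C\<lparr>carrier := cluster_stab C s\<rparr>) image t)
                = denom (d s * of_nat (stab_index C s)))) \<and>
        (\<forall>s\<in>\<Sigma>. stab_index C s
           = Lcm {denom (depth_star C \<Sigma> d s s') | s'. s' \<in> \<Sigma> \<and> s \<subset> s'})"
    then show "\<exists>c. cluster_perm \<X> \<Sigma> d c \<and> cluster_perm.tame \<Sigma> d c"
      unfolding cluster_perm.condition_iff[OF c] using c by blast
  next
    fix c assume c: "cluster_perm \<X> \<Sigma> d c" "cluster_perm.tame \<Sigma> d c"
    show "\<exists>c\<in>carrier (BijGroup \<X>). cluster_iso_by c \<X> \<Sigma> d \<X> \<Sigma> d \<and>
        (let C = cyclic_group \<X> c in
          (\<forall>s\<in>\<Sigma>. card s > 1 \<longrightarrow>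
             (\<forall>t. is_child \<Sigma> t s \<and> \<not> is_orphan C \<Sigma> t s \<longrightarrow>
                card (orbit (C\<lparr>carrier := cluster_stab C s\<rparr>) image t)
                  = denom (d s * of_nat (stab_index C s)))) \<and>
          (\<forall>s\<in>\<Sigma>. stab_index C s
             = Lcm {denom (depth_star C \<Sigma> d s s') | s'. s' \<in> \<Sigma> \<and> s \<subset> s'}))"
      by (rule bexI[of _ c], rule conjI, use c iff in blast, subst cluster_perm.condition_iff[OF c(1)])
        (use c iff in blast)+
  qed
qed

section \<open>From polynomials to tame automorphisms\<close>

lemma powi_eq_1_iff:
  fixes \<zeta> :: "'a::field"
  assumes "\<And>j::nat. \<zeta> ^ j = 1 \<longleftrightarrow> N dvd j"
  shows "\<zeta> powi j = 1 \<longleftrightarrow> int N dvd j"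
proof (cases "j \<ge> 0")
  case True
  then show ?thesis
    using assms[of "nat j"] by (simp add: power_int_def int_dvd_int_iff[symmetric] del: int_dvd_int_iff)
next
  case False
  then show ?thesis
    using assms[of "nat (- j)"]
    by (simp add: power_int_def power_inverse int_dvd_int_iff[symmetric] del: int_dvd_int_iff)
qed

lemma map_poly_to_ac_mult: "map_poly to_ac (P * Q) = map_poly to_ac P * map_poly to_ac Q"
  by (rule poly_eqI) (simp add: coeff_map_poly coeff_mult to_ac_sum)

lemma map_poly_to_ac_inject: "map_poly to_ac P = map_poly to_ac Q \<longleftrightarrow> P = Q"
  by (auto simp: poly_eq_iff coeff_map_poly)

lemma degree_map_poly_to_ac [simp]: "degree (map_poly to_ac P) = degree P"
  by (rule degree_map_poly) simp

lemma cf_range_to_ac: "cf (range to_ac) P \<longleftrightarrow> (\<exists>P0. P = map_poly to_ac P0)"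
proof
  assume P: "cf (range to_ac) P"
  have "P = map_poly to_ac (map_poly of_ac P)"
    by (rule poly_eqI) (use P in \<open>simp add: coeff_map_poly cf_def to_ac_of_ac\<close>)
  then show "\<exists>P0. P = map_poly to_ac P0" by blast
qed (auto simp: cf_def coeff_map_poly)

lemma poly_in_E:
  assumes "sub_ring E" "cf K P" "K \<subseteq> E" "x \<in> E"
  shows "poly P x \<in> E"
  using poly_in[OF assms(1) cf_subset[OF assms(3,2)] assms(4)] .

text \<open>The minimal polynomial \<open>g\<close> of a double root divides \<open>f\<close> with
  quotient \<open>q\<close>. As the derivative of \<open>g\<close> does not vanish there in
  characteristic zero, \<open>q\<close> must vanish, so \<open>g\<close> divides \<open>q\<close> as
  well and its square divides \<open>f\<close>.\<close>

lemma squarefree_simple_roots: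
  fixes f :: "'k::field poly" and v :: "'k alg_closure \<Rightarrow> rat"
  assumes "local_closure v (range to_ac) p" and f: "squarefree f"
    and b: "poly (map_poly to_ac f) \<beta> = 0"
  shows "poly (pderiv (map_poly to_ac f)) \<beta> \<noteq> 0"
proof
  interpret local_closure v "range to_ac" p by (rule assms(1))
  let ?K = "range (to_ac :: 'k \<Rightarrow> 'k alg_closure)"
  have Kr: "sub_ring ?K" using K by (simp add: sub_field_def)
  assume der: "poly (pderiv (map_poly to_ac f)) \<beta> = 0"
  obtain g where g: "min_poly ?K \<beta> g" using min_poly_exists[OF K alg] by blast
  have dg: "degree g > 0" using min_poly_degree_pos[OF g] .
  obtain g0 where g0: "g = map_poly to_ac g0" using g cf_range_to_ac by (auto simp: min_poly_def)
  have divide: "\<exists>Q0. P0 = Q0 * g0" if P0: "poly (map_poly to_ac P0) \<beta> = 0" for P0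
  proof -
    obtain q r where qr: "cf ?K q" "cf ?K r" "map_poly to_ac P0 = q * g + r" "degree r < degree g"
      using monic_division[OF Kr, of g "map_poly to_ac P0"] g dg cf_range_to_ac by (auto simp: min_poly_def)
    have "poly r \<beta> = 0" using qr(3) P0 g by (metis (no_types, lifting) add_0 min_poly_def mult_zero_right poly_add poly_mult)
    then have "r = 0" using qr g by (auto simp: min_poly_def)
    moreover obtain q0 where "q = map_poly to_ac q0" using qr(1) cf_range_to_ac by blast
    ultimately show ?thesis using qr(3) g0 by (metis add.right_neutral map_poly_to_ac_inject map_poly_to_ac_mult)
  qed
  obtain q where q: "f = q * g0" using divide[OF b] by blast
  have F: "map_poly to_ac f = map_poly to_ac q * g" unfolding q g0 by (rule map_poly_to_ac_mult)
  have g': "poly (pderiv g) \<beta> \<noteq> 0"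
  proof
    assume z: "poly (pderiv g) \<beta> = 0"
    have "cf ?K (pderiv g)" using g cf_pderiv[OF Kr] by (simp add: min_poly_def)
    moreover have lead: "coeff (pderiv g) (degree g - 1) = of_nat (degree g)"
      using dg g by (cases "degree g") (auto simp: coeff_pderiv min_poly_def)
    moreover from this have "pderiv g \<noteq> 0" using char0[OF dg] by auto
    ultimately have "degree g \<le> degree (pderiv g)" using g z by (simp add: min_poly_def)
    moreover have "degree (pderiv g) \<le> degree g - 1"
      by (rule degree_le) (auto simp: coeff_pderiv coeff_eq_0)
    ultimately show False using dg by simp
  qed
  have "poly (map_poly to_ac q) \<beta> * poly (pderiv g) \<beta> = 0"
    using der g unfolding F by (simp add: pderiv_mult min_poly_def)
  then have "poly (map_poly to_ac q) \<beta> = 0" using g' by simp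
  then obtain q2 where "q = q2 * g0" using divide by blast
  then have "g0\<^sup>2 dvd f" using q by (simp add: power2_eq_square mult.assoc)
  then have "g0 dvd 1" using f by (simp add: squarefree_def)
  then have "degree g0 = 0" by (metis degree_1 dvd_imp_degree_le le_zero_eq zero_neq_one)
  then show False using dg g0 by simp
qed

lemma card_simple_roots:
  fixes F :: "'a::alg_closed_field poly"
  assumes "F \<noteq> 0" and simple: "\<And>x. poly F x = 0 \<Longrightarrow> poly (pderiv F) x \<noteq> 0"
  shows "degree F = card {x. poly F x = 0}"
proof -
  obtain A where A: "size A = degree F" "F = smult (lead_coeff F) (\<Prod>x\<in>#A. [:- x, 1:])"
    using alg_closed_imp_factorization[OF assms(1)] by blast
  have roots: "{x. poly F x = 0} = set_mset A"
  proof -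
    have "poly F x = lead_coeff F * (\<Prod>y\<in>#A. x - y)" for x
      by (subst A(2)) (simp add: poly_prod_mset image_mset.compositionality o_def)
    then show ?thesis using assms(1) by (auto simp: prod_mset_zero_iff)
  qed
  have "count A x \<le> 1" for x
  proof (rule ccontr)
    assume c: "\<not> count A x \<le> 1"
    then have "x \<in># A" by (metis count_inI zero_le)
    then obtain B where B: "A = add_mset x B" by (metis insert_DiffM)
    then have "x \<in># B" using c by (simp add: count_greater_zero_iff[symmetric] del: count_greater_zero_iff)
    then obtain D where D: "B = add_mset x D" by (metis insert_DiffM)
    have "F = [:- x, 1:] * ([:- x, 1:] * smult (lead_coeff F) (\<Prod>x\<in>#D. [:- x, 1:]))"
      by (subst A(2)) (simp add: B D del: mult_pCons_left)
    then have "pderiv F = [:- x, 1:] * pderiv ([:- x, 1:] * smult (lead_coeff F) (\<Prod>x\<in>#D. [:- x, 1:]))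
        + [:- x, 1:] * smult (lead_coeff F) (\<Prod>x\<in>#D. [:- x, 1:]) * pderiv [:- x, 1:]"
      by (metis pderiv_mult)
    then have "poly (pderiv F) x = 0" by simp
    then show False using simple \<open>x \<in># A\<close> roots by blast
  qed
  then have "A = mset_set (set_mset A)"
    by (intro multiset_eqI) (simp add: count_mset_set' le_Suc_eq count_eq_zero_iff)
  then show ?thesis using A(1) roots by (metis size_mset_set)
qed

text \<open>An isomorphism with the picture of a set of roots, stated through \<open>\<phi>\<close>
  alone. Discs are centred at roots, since every point of an ultrametric disc is a centre, and the
  minimum in the depth becomes a bound that is attained.\<close>

locale root_picture = cluster_picture \<X> \<Sigma> d + valued_field v
  for \<X> :: "'x set" and \<Sigma> :: "'x set set" and d :: "'x set \<Rightarrow> rat" and v :: "'a::field \<Rightarrow> rat" +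
  fixes \<phi> :: "'x \<Rightarrow> 'a"
  assumes inj_\<phi>: "inj_on \<phi> \<X>"
    and cluster_iff: "s \<in> \<Sigma> \<longleftrightarrow> (\<exists>r\<in>\<X>. \<exists>q. s = {x\<in>\<X>. vge q (\<phi> x - \<phi> r)})"
    and depth_le: "s \<in> \<Sigma> \<Longrightarrow> x \<in> s \<Longrightarrow> y \<in> s \<Longrightarrow> x \<noteq> y \<Longrightarrow> d s \<le> v (\<phi> x - \<phi> y)"
    and depth_attained: "s \<in> \<Sigma> \<Longrightarrow> card s > 1 \<Longrightarrow> \<exists>x\<in>s. \<exists>y\<in>s. x \<noteq> y \<and> v (\<phi> x - \<phi> y) = d s"
begin

lemma \<phi>_eq: "x \<in> \<X> \<Longrightarrow> y \<in> \<X> \<Longrightarrow> \<phi> x - \<phi> y = 0 \<longleftrightarrow> x = y"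
  using inj_onD[OF inj_\<phi>, of x y] by auto

lemma vge_depth: "s \<in> \<Sigma> \<Longrightarrow> x \<in> s \<Longrightarrow> y \<in> s \<Longrightarrow> vge (d s) (\<phi> x - \<phi> y)"
  using depth_le[of s x y] by (cases "x = y") (auto simp: vge_def)

text \<open>The children are the residue classes inside \<open>s\<close>: if two points differ by a
  value above \<open>d s\<close>, the disc of that radius is a cluster missing some point of
  \<open>s\<close>, so it lies in one child.\<close>

lemma same_child_iff:
  assumes s: "s \<in> \<Sigma>" and t: "is_child \<Sigma> t s" and x: "x \<in> t" and y: "y \<in> s"
  shows "y \<in> t \<longleftrightarrow> vgt (d s) (\<phi> x - \<phi> y)"
proof
  have tS: "t \<in> \<Sigma>" "t \<subset> s" using t is_childD by auto
  have xX: "x \<in> \<X>" "y \<in> \<X>" "x \<in> s" using clusters_subset s x y tS by auto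
  {
    assume yt: "y \<in> t"
    show "vgt (d s) (\<phi> x - \<phi> y)"
    proof (cases "x = y")
      case False
      have "card t > 1"
        using card_mono[OF finite_cluster[OF tS(1)], of "{x, y}"] x yt False by auto
      then have "d s < d t" using depth_less s tS by blast
      also have "d t \<le> v (\<phi> x - \<phi> y)" using depth_le tS x yt False by blast
      finally show ?thesis by (simp add: vgt_def)
    qed simp
  next
    assume g: "vgt (d s) (\<phi> x - \<phi> y)"
    show "y \<in> t"
    proof (cases "x = y")
      case False
      let ?q = "v (\<phi> x - \<phi> y)"
      have q: "d s < ?q" using g \<phi>_eq[OF xX(1,2)] False by (simp add: vgt_def)
      define u where "u = {w\<in>\<X>. vge ?q (\<phi> w - \<phi> x)}"
      have u: "u \<in> \<Sigma>" unfolding u_def cluster_iff using xX by blast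
      have xyu: "x \<in> u" "y \<in> u" using xX v_diff_commute[of "\<phi> x" "\<phi> y"] by (auto simp: u_def vge_def)
      obtain a b where ab: "a \<in> s" "b \<in> s" "a \<noteq> b" "v (\<phi> a - \<phi> b) = d s"
        using depth_attained[OF s card_gt_1_if_child[OF t s]] by blast
      have "\<not> s \<subseteq> u"
      proof
        assume "s \<subseteq> u"
        then have "vge ?q (\<phi> a - \<phi> x)" "vge ?q (\<phi> b - \<phi> x)" using ab by (auto simp: u_def)
        from vge_diff[OF this] have "vge ?q (\<phi> a - \<phi> b)" by simp
        moreover have "\<phi> a - \<phi> b \<noteq> 0" using \<phi>_eq[of a b] ab clusters_subset s by blast
        ultimately show False using q ab by (simp add: vge_def)
      qed
      then have us: "u \<subset> s" using disjoint_or_nested[OF u s] xyu xX by blast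
      have "t \<subseteq> u \<or> u \<subseteq> t" using disjoint_or_nested[OF u tS(1)] xyu x by blast
      then show ?thesis using xyu t us u unfolding is_child_def by blast
    qed (use x in simp)
  }
qed

end

lemma root_picture_if_iso:
  assumes "cluster_picture \<X> \<Sigma> d" and val: "valuation v" and R: "finite R"
    and iso: "cluster_iso_by \<phi> \<X> \<Sigma> d R (clusters_of v R) (depth_of v)"
  shows "root_picture \<X> \<Sigma> d v \<phi>"
proof -
  interpret cluster_picture \<X> \<Sigma> d by (rule assms(1))
  interpret valued_field v by unfold_locales (rule val)
  have inj: "inj_on \<phi> \<X>" and im: "\<phi> ` \<X> = R" using iso by (auto simp: cluster_iso_by_def bij_betw_def)
  have bij: "bij_betw (image \<phi>) \<Sigma> (clusters_of v R)" using iso by (simp add: cluster_iso_by_def)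
  have ball: "x = z \<or> q \<le> v (x - z) \<longleftrightarrow> vge q (x - z)" for x z q by (auto simp: vge_def)
  have depth: "d s = Min {v (r - r') | r r'. r \<in> \<phi> ` s \<and> r' \<in> \<phi> ` s \<and> r \<noteq> r'}" if "s \<in> \<Sigma>" "card s > 1" for s
    using iso that by (simp add: cluster_iso_by_def depth_of_def)
  have fin: "finite {v (r - r') | r r'. r \<in> \<phi> ` s \<and> r' \<in> \<phi> ` s \<and> r \<noteq> r'}" if "s \<in> \<Sigma>" for s
  proof -
    have "{v (r - r') | r r'. r \<in> \<phi> ` s \<and> r' \<in> \<phi> ` s \<and> r \<noteq> r'} \<subseteq> (\<lambda>(x, y). v (\<phi> x - \<phi> y)) ` (s \<times> s)"
      by auto
    then show ?thesis using finite_cluster[OF that] finite_subset by fastforce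
  qed
  show ?thesis
  proof unfold_locales
    show "inj_on \<phi> \<X>" by (rule inj)
  next
    fix s show "s \<in> \<Sigma> \<longleftrightarrow> (\<exists>r\<in>\<X>. \<exists>q. s = {x\<in>\<X>. vge q (\<phi> x - \<phi> r)})"
    proof
      assume s: "s \<in> \<Sigma>"
      then have "\<phi> ` s \<in> clusters_of v R" using bij bij_betwE by blast
      then obtain z q where zq: "\<phi> ` s = R \<inter> {x. vge q (x - z)}" unfolding clusters_of_def ball by blast
      obtain r where r: "r \<in> s" using clusters_nonempty s by blast
      have sX: "s \<subseteq> \<X>" using clusters_subset s .
      have rz: "vge q (\<phi> r - z)" using zq r by blast
      have "vge q (\<phi> x - z) \<longleftrightarrow> vge q (\<phi> x - \<phi> r)" for x
        using vge_diff[OF _ rz, of "\<phi> x - z"] vge_add[OF _ rz, of "\<phi> x - \<phi> r"] by auto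
      moreover have "x \<in> s \<longleftrightarrow> vge q (\<phi> x - z)" if "x \<in> \<X>" for x
        using zq im that inj_on_image_mem_iff[OF inj that sX] by blast
      ultimately have "s = {x\<in>\<X>. vge q (\<phi> x - \<phi> r)}" using sX by blast
      then show "\<exists>r\<in>\<X>. \<exists>q. s = {x\<in>\<X>. vge q (\<phi> x - \<phi> r)}" using r sX by blast
    next
      assume "\<exists>r\<in>\<X>. \<exists>q. s = {x\<in>\<X>. vge q (\<phi> x - \<phi> r)}"
      then obtain r q where s: "r \<in> \<X>" "s = {x\<in>\<X>. vge q (\<phi> x - \<phi> r)}" by blast
      have "\<phi> ` s = R \<inter> {x. vge q (x - \<phi> r)}" unfolding s im[symmetric] by auto
      moreover have "r \<in> s" using s by simp
      ultimately have "\<phi> ` s \<in> clusters_of v R" unfolding clusters_of_def ball by blast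
      then obtain s' where s': "s' \<in> \<Sigma>" "\<phi> ` s = \<phi> ` s'" using bij by (metis bij_betw_iff_bijections)
      moreover have "s \<subseteq> \<X>" using s by blast
      ultimately have "s = s'" using inj_on_image_eq_iff[OF inj _ clusters_subset[OF s'(1)]] by blast
      then show "s \<in> \<Sigma>" using s' by simp
    qed
  next
    fix s x y assume s: "s \<in> \<Sigma>" and xy: "x \<in> s" "y \<in> s" "x \<noteq> y"
    have "card s > 1" using card_mono[OF finite_cluster[OF s], of "{x, y}"] xy by auto
    moreover have "\<phi> x \<noteq> \<phi> y" using inj_onD[OF inj] xy clusters_subset[OF s] by blast
    ultimately show "d s \<le> v (\<phi> x - \<phi> y)"
      using depth[OF s] fin[OF s] xy by (auto intro!: Min_le)
  next
    fix s assume s: "s \<in> \<Sigma>" "card s > 1"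
    obtain x y where xy: "x \<in> s" "y \<in> s" "x \<noteq> y"
      using s(2) by (metis One_nat_def card_le_Suc0_iff_eq finite_cluster linorder_not_less s(1))
    have "\<phi> x \<noteq> \<phi> y" using inj_onD[OF inj] xy clusters_subset[OF s(1)] by blast
    then have "{v (r - r') | r r'. r \<in> \<phi> ` s \<and> r' \<in> \<phi> ` s \<and> r \<noteq> r'} \<noteq> {}" using xy by blast
    then have "d s \<in> {v (r - r') | r r'. r \<in> \<phi> ` s \<and> r' \<in> \<phi> ` s \<and> r \<noteq> r'}"
      unfolding depth[OF s] using fin[OF s(1)] by (rule Min_in[rotated])
    then obtain a b where "a \<in> s" "b \<in> s" "\<phi> a \<noteq> \<phi> b" "d s = v (\<phi> a - \<phi> b)" by auto
    then show "\<exists>x\<in>s. \<exists>y\<in>s. x \<noteq> y \<and> v (\<phi> x - \<phi> y) = d s"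
      by (intro bexI[of _ a] bexI[of _ b]) auto
  qed
qed

section \<open>The permutation of the roots induced by tame inertia\<close>

locale tame_action = root_picture \<X> \<Sigma> d v \<phi> + local_closure v K p
  for \<X> :: "'x set" and \<Sigma> and d and v :: "'a::alg_closed_field \<Rightarrow> rat" and \<phi> :: "'x \<Rightarrow> 'a" and K :: "'a set" and p :: nat +
  fixes E :: "'a set" and \<tau> :: "'a \<Rightarrow> 'a" and N :: nat and \<zeta> :: 'a
  assumes p_card: "card \<X> < p"
    and N: "\<not> p dvd N" and \<zeta>: "\<zeta> ^ j = 1 \<longleftrightarrow> N dvd j"
    and E: "sub_field E" and K_E: "K \<subseteq> E" and \<phi>_E: "r \<in> \<X> \<Longrightarrow> \<phi> r \<in> E"
    and \<tau>_E: "x \<in> E \<Longrightarrow> \<tau> x \<in> E" and \<tau>_K: "x \<in> K \<Longrightarrow> \<tau> x = x"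
    and \<tau>_add: "x \<in> E \<Longrightarrow> y \<in> E \<Longrightarrow> \<tau> (x + y) = \<tau> x + \<tau> y"
    and \<tau>_mult: "x \<in> E \<Longrightarrow> y \<in> E \<Longrightarrow> \<tau> (x * y) = \<tau> x * \<tau> y"
    and \<tau>_lead: "x \<in> E \<Longrightarrow> x \<noteq> 0 \<Longrightarrow> \<exists>k. of_nat N * v x = of_int k \<and> vgt (v x) (\<tau> x - \<zeta> powi k * x)"
    and \<tau>_roots: "\<tau> ` \<phi> ` \<X> \<subseteq> \<phi> ` \<X>"
begin

lemma Er: "sub_ring E" using E by (simp add: sub_field_def)

lemma N_pos: "N > 0" using N by (intro Nat.gr0I) auto

lemma \<zeta>_unit: "\<zeta> \<noteq> 0" "v \<zeta> = 0"
  using \<zeta>[of N] N_pos v_root_of_unity[of \<zeta> N] by (auto simp: zero_power)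

lemma v_\<tau>:
  assumes "x \<in> E" "x \<noteq> 0"
  shows "\<tau> x \<noteq> 0" "v (\<tau> x) = v x"
proof -
  obtain k where k: "vgt (v x) (\<tau> x - \<zeta> powi k * x)" using \<tau>_lead assms by blast
  have z: "\<zeta> powi k * x \<noteq> 0" "v (\<zeta> powi k * x) = v x"
    using \<zeta>_unit assms by (auto simp: v_mult v_powi)
  show "\<tau> x \<noteq> 0" "v (\<tau> x) = v x"
    using dominant_add[OF z(1), of "\<tau> x - \<zeta> powi k * x"] k z(2) by auto
qed

lemma \<tau>_0: "\<tau> 0 = 0"
  using \<tau>_K sub_ringD(2)[OF sub_field_imp_sub_ring[OF K]] by blast

lemma \<tau>_diff: "x \<in> E \<Longrightarrow> y \<in> E \<Longrightarrow> \<tau> (x - y) = \<tau> x - \<tau> y"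
  using \<tau>_add[of "x - y" y] sub_ringD(3)[OF Er, of x y] by simp

lemma funpow_E: "x \<in> E \<Longrightarrow> (\<tau> ^^ n) x \<in> E"
  by (induction n) (auto intro: \<tau>_E)

lemma funpow_diff: "x \<in> E \<Longrightarrow> y \<in> E \<Longrightarrow> (\<tau> ^^ n) (x - y) = (\<tau> ^^ n) x - (\<tau> ^^ n) y"
  by (induction n) (auto simp: \<tau>_diff funpow_E)

lemma funpow_mult: "x \<in> E \<Longrightarrow> y \<in> E \<Longrightarrow> (\<tau> ^^ n) (x * y) = (\<tau> ^^ n) x * (\<tau> ^^ n) y"
  by (induction n) (auto simp: \<tau>_mult funpow_E)

lemma funpow_K: "x \<in> K \<Longrightarrow> (\<tau> ^^ n) x = x"
  by (induction n) (auto simp: \<tau>_K)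

lemma funpow_sum:
  fixes f :: "'i \<Rightarrow> 'a"
  shows "(\<And>i. i \<in> A \<Longrightarrow> f i \<in> E) \<Longrightarrow> (\<tau> ^^ n) (\<Sum>i\<in>A. f i) = (\<Sum>i\<in>A. (\<tau> ^^ n) (f i))"
proof (induction n)
  case (Suc n)
  have "\<tau> (\<Sum>i\<in>A. g i) = (\<Sum>i\<in>A. \<tau> (g i))" if "\<And>i. i \<in> A \<Longrightarrow> g i \<in> E" for g :: "'i \<Rightarrow> 'a"
    using that
    by (induction A rule: infinite_finite_induct) (auto simp: \<tau>_0 \<tau>_add sub_ring_sum[OF Er])
  then show ?case using Suc by (simp add: funpow_E)
qed simp

lemma v_funpow: "x \<in> E \<Longrightarrow> x \<noteq> 0 \<Longrightarrow> (\<tau> ^^ n) x \<noteq> 0 \<and> v ((\<tau> ^^ n) x) = v x"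
  by (induction n) (auto simp: v_\<tau> funpow_E)

text \<open>Iterates keep the value of \<open>x\<close>, and the root of unity in
  \<open>\<tau>_lead\<close> depends only on that value, so each step contributes the same
  factor.\<close>

lemma lead_funpow:
  assumes x: "x \<in> E" "x \<noteq> 0" and k: "of_nat N * v x = of_int k"
  shows "vgt (v x) ((\<tau> ^^ n) x - (\<zeta> powi k) ^ n * x)"
proof (induction n)
  case (Suc n)
  let ?y = "(\<tau> ^^ n) x" and ?z = "\<zeta> powi k"
  have y: "?y \<in> E" "?y \<noteq> 0" "v ?y = v x" using v_funpow funpow_E x by auto
  obtain j where j: "of_nat N * v ?y = of_int j" "vgt (v ?y) (\<tau> ?y - \<zeta> powi j * ?y)"
    using \<tau>_lead y by blast
  have "(of_int j :: rat) = of_int k" using j(1) k y by simp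
  then have "j = k" by simp
  then have "vgt (v x) (\<tau> ?y - ?z * ?y)" using j y by simp
  moreover have "vgt (v x) (?z * (?y - ?z ^ n * x))"
    by (rule vgt_mult_0[OF _ Suc]) (use \<zeta>_unit in \<open>simp add: vge_def v_powi\<close>)
  ultimately have "vgt (v x) ((\<tau> ?y - ?z * ?y) + ?z * (?y - ?z ^ n * x))" by (rule vgt_add)
  then show ?case by (simp add: algebra_simps)
qed simp

definition c :: "'x \<Rightarrow> 'x" where
  "c = restrict (\<lambda>x. inv_into \<X> \<phi> (\<tau> (\<phi> x))) \<X>"

lemma c_in: "x \<in> \<X> \<Longrightarrow> c x \<in> \<X>" and \<phi>_c: "x \<in> \<X> \<Longrightarrow> \<phi> (c x) = \<tau> (\<phi> x)"
proof -
  assume x: "x \<in> \<X>"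
  then have "\<tau> (\<phi> x) \<in> \<phi> ` \<X>" using \<tau>_roots by blast
  then show "c x \<in> \<X>" "\<phi> (c x) = \<tau> (\<phi> x)"
    using x by (auto simp: c_def inv_into_into f_inv_into_f)
qed

lemma v_c: "x \<in> \<X> \<Longrightarrow> y \<in> \<X> \<Longrightarrow> v (\<phi> (c x) - \<phi> (c y)) = v (\<phi> x - \<phi> y)"
  and c_inj: "x \<in> \<X> \<Longrightarrow> y \<in> \<X> \<Longrightarrow> c x = c y \<longleftrightarrow> x = y"
proof -
  assume xy: "x \<in> \<X>" "y \<in> \<X>"
  have d: "\<phi> (c x) - \<phi> (c y) = \<tau> (\<phi> x - \<phi> y)" "\<phi> x - \<phi> y \<in> E"
    using xy \<phi>_E sub_ringD(3)[OF Er] by (auto simp: \<phi>_c \<tau>_diff)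
  show 1: "v (\<phi> (c x) - \<phi> (c y)) = v (\<phi> x - \<phi> y)"
    using d v_\<tau>[OF d(2)] \<tau>_0 by (cases "\<phi> x - \<phi> y = 0") auto
  show "c x = c y \<longleftrightarrow> x = y"
    using d v_\<tau>[OF d(2)] \<phi>_eq[OF xy] by auto
qed

lemma c_bij: "bij_betw c \<X> \<X>"
proof -
  have "inj_on c \<X>" using c_inj by (auto intro: inj_onI)
  moreover have "c ` \<X> \<subseteq> \<X>" using c_in by blast
  ultimately show ?thesis using finite_X by (simp add: bij_betw_def endo_inj_surj)
qed

lemma c_cluster:
  assumes "s \<in> \<Sigma>"
  shows "c ` s \<in> \<Sigma>"
proof -
  obtain r q where r: "r \<in> \<X>" "s = {x\<in>\<X>. vge q (\<phi> x - \<phi> r)}" using assms cluster_iff by blast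
  have iff: "vge q (\<phi> (c x) - \<phi> (c r)) \<longleftrightarrow> vge q (\<phi> x - \<phi> r)" if "x \<in> \<X>" for x
    using that r v_c[of x r] c_inj[of x r] \<phi>_eq[of x r] \<phi>_eq[of "c x" "c r"] c_in by (simp add: vge_def)
  have "c ` s = {x\<in>\<X>. vge q (\<phi> x - \<phi> (c r))}"
  proof (intro equalityI subsetI)
    fix y assume "y \<in> {x\<in>\<X>. vge q (\<phi> x - \<phi> (c r))}"
    moreover from this obtain x where "x \<in> \<X>" "y = c x" using c_bij by (auto simp: bij_betw_def)
    ultimately show "y \<in> c ` s" using iff r by auto
  qed (use iff r c_in in auto)
  then show ?thesis unfolding cluster_iff using c_in r by blast
qed

lemma c_perm: "cluster_perm \<X> \<Sigma> d c"
proof unfold_locales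
  show "c \<in> carrier (BijGroup \<X>)" using c_bij by (auto simp: BijGroup_def Bij_def c_def)
  have inj: "inj_on (image c) \<Sigma>"
  proof (rule inj_onI)
    fix s t assume "s \<in> \<Sigma>" "t \<in> \<Sigma>" "c ` s = c ` t"
    then show "s = t"
      using inj_on_image_eq_iff[OF bij_betw_imp_inj_on[OF c_bij] clusters_subset clusters_subset] by blast
  qed
  have "image c ` \<Sigma> \<subseteq> \<Sigma>" using c_cluster by blast
  then have "bij_betw (image c) \<Sigma> \<Sigma>" using inj finite_clusters by (simp add: bij_betw_def endo_inj_surj)
  moreover have "d (c ` s) = d s" if s: "s \<in> \<Sigma>" "card s > 1" for s
  proof (rule antisym)
    have sX: "s \<subseteq> \<X>" using clusters_subset s by blast
    have "inj_on c s" using c_bij sX bij_betw_imp_inj_on inj_on_subset by blast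
    then have card: "card (c ` s) > 1" using s by (simp add: card_image)
    obtain x y where xy: "x \<in> s" "y \<in> s" "x \<noteq> y" "v (\<phi> x - \<phi> y) = d s" using depth_attained s by blast
    then have "d (c ` s) \<le> v (\<phi> (c x) - \<phi> (c y))"
      using c_inj sX by (intro depth_le c_cluster s) auto
    moreover have "x \<in> \<X>" "y \<in> \<X>" using xy sX by auto
    ultimately show "d (c ` s) \<le> d s" using v_c[of x y] xy by simp
    obtain x' y' where xy': "x' \<in> c ` s" "y' \<in> c ` s" "x' \<noteq> y'" "v (\<phi> x' - \<phi> y') = d (c ` s)"
      using depth_attained[OF c_cluster[OF s(1)] card] by blast
    then obtain x y where x: "x \<in> s" "y \<in> s" "x' = c x" "y' = c y" by blast
    moreover from this have "x \<in> \<X>" "y \<in> \<X>" using sX by auto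
    ultimately show "d s \<le> d (c ` s)" using depth_le[OF s(1), of x y] xy' v_c[of x y] by auto
  qed
  ultimately show "cluster_iso_by c \<X> \<Sigma> d \<X> \<Sigma> d" unfolding cluster_iso_by_def using c_bij by blast
qed

sublocale cp: cluster_perm \<X> \<Sigma> d c by (rule c_perm)

lemma \<phi>_funpow: "x \<in> \<X> \<Longrightarrow> \<phi> ((c ^^ n) x) = (\<tau> ^^ n) (\<phi> x)"
  by (induction n) (auto simp: \<phi>_c cp.funpow_in)

text \<open>The points of \<open>s\<close> are measured from their centre of mass, which is fixed by the stabiliser
  and is an integral combination since \<open>card s < p\<close>.\<close>

lemma child_period:
  assumes s: "s \<in> \<Sigma>" and t: "is_child \<Sigma> t s"
  obtains "cp.e t = cp.e s * denom (d s * of_nat (cp.e s))"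
  | "cp.e t = cp.e s" "\<And>u. is_child \<Sigma> u s \<Longrightarrow> u \<noteq> t \<Longrightarrow> cp.e u = cp.e s * denom (d s * of_nat (cp.e s))"
proof -
  define e where "e = cp.e s"
  define D where "D = denom (d s * of_nat e)"
  have sX: "s \<subseteq> \<X>" using clusters_subset s .
  have fs: "finite s" using finite_cluster s .
  have s0: "card s > 0" "card s < p"
    using card_gt_1_if_child[OF t s] card_mono[OF finite_X sX] p_card by auto
  then have ps: "\<not> p dvd card s" by (auto dest: dvd_imp_le)
  define m where "m = (of_nat (card s) :: 'a)"
  have m: "m \<noteq> 0" "v m = 0" "m \<in> K" "m \<in> E"
    using char0 s0 v_of_nat[OF ps] sub_ring_of_nat[OF sub_field_imp_sub_ring[OF K]] K_E by (auto simp: m_def)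
  define z where "z = (\<Sum>x\<in>s. \<phi> x) / m"
  have sumE: "(\<Sum>x\<in>s. \<phi> x) \<in> E" using sub_ring_sum[OF Er] \<phi>_E sX by blast
  have zE: "z \<in> E" unfolding z_def using sub_field_divide[OF E sumE m(4)] .
  have cs: "bij_betw (c ^^ (e * n)) s s" for n
  proof -
    have "(c ^^ (e * n)) ` s = s" using cp.fixed_iff[OF sX] by (simp add: e_def)
    moreover have "inj_on (c ^^ (e * n)) s"
      using inj_on_subset[OF bij_betw_imp_inj_on[OF cp.funpow_bij] sX] .
    ultimately show ?thesis by (simp add: bij_betw_def)
  qed
  have z_fix: "(\<tau> ^^ (e * n)) z = z" for n
  proof -
    have "(\<tau> ^^ (e * n)) z * m = (\<tau> ^^ (e * n)) (z * m)"
      using funpow_mult[OF zE m(4)] funpow_K[OF m(3)] by simp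
    also have "z * m = (\<Sum>x\<in>s. \<phi> x)" using m by (simp add: z_def)
    also have "(\<tau> ^^ (e * n)) (\<Sum>x\<in>s. \<phi> x) = (\<Sum>x\<in>s. \<phi> ((c ^^ (e * n)) x))"
      using \<phi>_E \<phi>_funpow sX by (subst funpow_sum) (auto intro!: sum.cong)
    also have "\<dots> = (\<Sum>x\<in>s. \<phi> x)" by (rule sum.reindex_bij_betw[OF cs])
    also have "\<dots> = z * m" using m by (simp add: z_def)
    finally show ?thesis using m by simp
  qed
  define w where "w = (\<lambda>x. \<phi> x - z)"
  have wE: "w x \<in> E" if "x \<in> s" for x
    unfolding w_def using sub_ringD(3)[OF Er] \<phi>_E zE sX that by blast
  have w_fun: "w ((c ^^ (e * n)) x) = (\<tau> ^^ (e * n)) (w x)" if "x \<in> s" for x n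
  proof -
    have "x \<in> \<X>" using that sX by blast
    then show ?thesis unfolding w_def using funpow_diff[OF \<phi>_E zE] z_fix \<phi>_funpow by simp
  qed
  \<comment> \<open>\<open>w x\<close> is the mean of the differences from \<open>x\<close> to the
    points of \<open>s\<close>, and the number of points is a unit.\<close>
  have w_ge: "vge (d s) (w x)" if "x \<in> s" for x
  proof -
    have "w x * m = (\<Sum>y\<in>s. \<phi> x - \<phi> y)"
      using m by (simp add: w_def z_def sum_subtractf m_def algebra_simps)
    then have "w x = inverse m * (\<Sum>y\<in>s. \<phi> x - \<phi> y)" using m by (simp add: field_simps)
    moreover have "vge (d s) (\<Sum>y\<in>s. \<phi> x - \<phi> y)" using vge_depth[OF s that] by (intro vge_sum)
    moreover have "vge 0 (inverse m)" using m by (simp add: vge_def v_inverse)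
    ultimately show ?thesis using vge_mult_0 by simp
  qed
  have same: "y \<in> u \<longleftrightarrow> vgt (d s) (w y - w x)" if "is_child \<Sigma> u s" "x \<in> u" "y \<in> s" for u x y
    using same_child_iff[OF s that] vgt_diff_commute[of "d s" "\<phi> x" "\<phi> y"] by (simp add: w_def)
  have fixed: "cp.e u dvd e * n \<longleftrightarrow> (c ^^ (e * n)) x \<in> u" if u: "is_child \<Sigma> u s" "x \<in> u" for u x n
  proof -
    have uS: "u \<in> \<Sigma>" "u \<subset> s" using u is_childD by auto
    have "is_child \<Sigma> ((c ^^ (e * n)) ` u) ((c ^^ (e * n)) ` s)" using cp.image_child u s by blast
    then have ch: "is_child \<Sigma> ((c ^^ (e * n)) ` u) s" using cs by (simp add: bij_betw_def)
    have "(c ^^ (e * n)) ` u = u \<longleftrightarrow> (c ^^ (e * n)) x \<in> u"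
      using children_disjoint[OF ch u(1)] u(2) by blast
    then show ?thesis using cp.fixed_iff[OF clusters_subset[OF uS(1)]] by blast
  qed
  \<comment> \<open>A point close to the centre of mass stays close to it under the stabiliser,
    hence stays in its child; so this child is fixed.\<close>
  have near: "cp.e u = e" if u: "is_child \<Sigma> u s" "x \<in> u" "vgt (d s) (w x)" for u x
  proof -
    have xs: "x \<in> s" using u is_childD by blast
    have "vgt (d s) (w ((c ^^ (e * 1)) x))"
      unfolding w_fun[OF xs] using u(3) v_funpow[OF wE[OF xs]] funpow_K[of 0] sub_ringD(2)[OF sub_field_imp_sub_ring[OF K]]
      by (cases "w x = 0") (auto simp: vgt_def)
    then have "vgt (d s) (w ((c ^^ (e * 1)) x) - w x)" using u(3) by (rule vgt_diff)
    moreover have "(c ^^ (e * 1)) x \<in> s" using cs[of 1] xs by (meson bij_betwE)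
    ultimately have "cp.e u dvd e * 1" using fixed[OF u(1,2), of 1] same[OF u(1,2)] by blast
    then show ?thesis using cp.child_e_dvd[OF u(1) s] by (auto simp: e_def intro: dvd_antisym)
  qed
  \<comment> \<open>Away from the centre, \<open>w x\<close> has value exactly \<open>d s\<close>
    and its leading term rotates by a fixed root of unity. The child recurs exactly when the
    rotation is trivial, because distinct roots of unity of order prime to \<open>p\<close> differ
    by units; and \<open>k = N * d s\<close> turns this into a statement on denominators.\<close>
  have far: "cp.e u = e * D" if u: "is_child \<Sigma> u s" "x \<in> u" "\<not> vgt (d s) (w x)" for u x
  proof -
    have xs: "x \<in> s" using u is_childD by blast
    have w0: "w x \<noteq> 0" "v (w x) = d s" using u(3) w_ge[OF xs] by (auto simp: vge_def vgt_def)
    obtain k where k: "of_nat N * v (w x) = of_int k" using \<tau>_lead[OF wE[OF xs] w0(1)] by blast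
    have "cp.e u dvd e * n \<longleftrightarrow> D dvd n" for n
    proof -
      let ?z = "(\<zeta> powi k) ^ (e * n)"
      have lead: "vgt (d s) ((\<tau> ^^ (e * n)) (w x) - ?z * w x)"
        using lead_funpow[OF wE[OF xs] w0(1) k] w0 by simp
      have "(c ^^ (e * n)) x \<in> s" using cs[of n] xs by (meson bij_betwE)
      then have "cp.e u dvd e * n \<longleftrightarrow> vgt (d s) ((\<tau> ^^ (e * n)) (w x) - w x)"
        using fixed[OF u(1,2)] same[OF u(1,2)] w_fun[OF xs] by simp
      also have "\<dots> \<longleftrightarrow> vgt (d s) ((?z - 1) * w x)"
        using vgt_diff[OF _ lead, of "(\<tau> ^^ (e * n)) (w x) - w x"] vgt_add[OF _ lead, of "(?z - 1) * w x"]
        by (auto simp: algebra_simps)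
      also have "\<dots> \<longleftrightarrow> ?z = 1"
      proof
        assume a: "vgt (d s) ((?z - 1) * w x)"
        show "?z = 1"
        proof (rule ccontr)
          assume z1: "?z \<noteq> 1"
          have "?z ^ N = ((\<zeta> powi k) powi int (e * n)) powi int N" by (simp only: power_int_of_nat)
          also have "\<dots> = (\<zeta> powi int N) powi (k * int (e * n))"
            by (simp only: power_int_mult[symmetric]) (simp only: mult_ac)
          also have "\<dots> = 1" using \<zeta>[of N] by (simp only: power_int_of_nat) simp
          finally have "?z ^ N = 1" .
          then have "v (?z - 1) = 0" using root_of_unity_separated N z1 by blast
          then have "v ((?z - 1) * w x) = d s" using z1 w0 by (simp add: v_mult)
          then show False using a z1 w0 by (simp add: vgt_def)
        qed
      qed simp
      also have "\<dots> \<longleftrightarrow> int N dvd k * int (e * n)"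
      proof -
        define j where "j = k * int (e * n)"
        have "?z = \<zeta> powi j" by (simp only: j_def power_int_mult power_int_of_nat)
        moreover have "\<zeta> powi j = 1 \<longleftrightarrow> int N dvd j" using powi_eq_1_iff \<zeta> by blast
        ultimately show ?thesis by (simp add: j_def)
      qed
      also have "\<dots> \<longleftrightarrow> of_nat n * (d s * of_nat e) \<in> \<int>"
      proof
        assume "int N dvd k * int (e * n)"
        then obtain l where "k * int (e * n) = int N * l" by (auto elim: dvdE)
        then have "(of_int (k * int (e * n)) :: rat) = of_int (int N * l)" by (simp only:)
        moreover have "of_nat N * (of_nat n * (d s * of_nat e)) = (of_nat N * v (w x)) * of_nat (e * n)"
          using w0 by (simp add: mult_ac)
        then have "of_nat N * (of_nat n * (d s * of_nat e)) = (of_int (k * int (e * n)) :: rat)"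
          unfolding k by simp
        ultimately have "of_nat N * (of_nat n * (d s * of_nat e)) = of_nat N * of_int l"
          by (simp only:) simp
        then show "of_nat n * (d s * of_nat e) \<in> \<int>" using N_pos by simp
      next
        assume "of_nat n * (d s * of_nat e) \<in> \<int>"
        then obtain l where "of_nat n * (d s * of_nat e) = of_int l" by (auto elim: Ints_cases)
        moreover have "of_nat N * v (w x) * of_nat (e * n) = of_nat N * (of_nat n * (d s * of_nat e))"
          using w0 by (simp add: mult_ac)
        ultimately have "of_nat N * v (w x) * of_nat (e * n) = of_nat N * of_int l" by simp
        then have "(of_int (k * int (e * n)) :: rat) = of_int (int N * l)" unfolding k by simp
        then show "int N dvd k * int (e * n)" by (metis dvd_triv_left of_int_eq_iff)
      qed
      also have "\<dots> \<longleftrightarrow> D dvd n" unfolding D_def by (rule denom_dvd_iff)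
      finally show ?thesis .
    qed
    moreover have "e dvd cp.e u" using cp.child_e_dvd[OF u(1) s] by (simp add: e_def)
    then obtain q where q: "cp.e u = e * q" by (auto elim: dvdE)
    ultimately have "q dvd n \<longleftrightarrow> D dvd n" for n
      using cp.e_pos[OF sX] by (simp add: e_def[symmetric])
    then have "q = D" by (metis dvd_antisym dvd_refl)
    then show ?thesis using q by simp
  qed
  obtain x where x: "x \<in> t" using clusters_nonempty t is_childD by blast
  show ?thesis
  proof (cases "vgt (d s) (w x)")
    case True
    have "cp.e u = e * D" if u: "is_child \<Sigma> u s" "u \<noteq> t" for u
    proof -
      obtain y where y: "y \<in> u" using clusters_nonempty u is_childD by blast
      then have ys: "y \<in> s" "y \<notin> t" using u t x children_disjoint[OF u(1) t] is_childD by blast+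
      have "\<not> vgt (d s) (w y)"
        using same[OF t x ys(1)] ys(2) vgt_diff[OF _ True] by blast
      then show ?thesis using far u y by blast
    qed
    then show ?thesis using that near[OF t x True] by (simp add: e_def D_def)
  next
    case False
    then show ?thesis using that far[OF t x] by (simp add: e_def D_def)
  qed
qed

lemma c_tame: "cp.tame"
  unfolding cp.tame_def
proof (intro ballI allI impI)
  fix s t assume s: "s \<in> \<Sigma>" and t: "is_child \<Sigma> t s" and nt: "cp.fixed_children s \<noteq> {t}"
  let ?D = "denom (d s * of_nat (cp.e s))"
  show "cp.e t = cp.e s * ?D"
    using s t
  proof (cases rule: child_period)
    case 2
    \<comment> \<open>The central child \<open>t\<close> is fixed but not the only fixed child.
      Another fixed child has period \<open>e s * ?D\<close>, which must equal
      \<open>e s\<close>.\<close>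
    have "?D = 1"
    proof (rule ccontr)
      assume D: "?D \<noteq> 1"
      have "cp.fixed_children s = {t}"
      proof (intro equalityI subsetI)
        fix u assume u: "u \<in> cp.fixed_children s"
        show "u \<in> {t}"
        proof (rule ccontr)
          assume "u \<notin> {t}"
          then have "cp.e s = cp.e s * ?D" using 2(2)[of u] u by simp
          then show False using D cp.e_pos[OF clusters_subset[OF s]] by simp
        qed
      qed (use 2 t in simp)
      then show False using nt by blast
    qed
    then show ?thesis using 2 by simp
  qed
qed

end

theorem polynomial_type_imp_tame:
  fixes v :: "'k::field alg_closure \<Rightarrow> rat"
  assumes lc: "local_closure v (range to_ac) p" and cp: "cluster_picture \<X> \<Sigma> d"
    and p: "card \<X> < p" and pt: "polynomial_type v \<X> \<Sigma> d"
  shows "\<exists>c. cluster_perm \<X> \<Sigma> d c \<and> cluster_perm.tame \<Sigma> d c"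
proof -
  interpret local_closure v "range to_ac" p by (rule lc)
  obtain f :: "'k poly" and \<phi> where f: "squarefree f"
    and iso: "cluster_iso_by \<phi> \<X> \<Sigma> d (roots_ac f) (clusters_of v (roots_ac f)) (depth_of v)"
    using pt by (auto simp: polynomial_type_def cluster_iso_def)
  let ?F = "map_poly to_ac f"
  have "f \<noteq> 0" using f not_squarefree_0 by blast
  then have F0: "?F \<noteq> 0" using map_poly_to_ac_inject[of f 0] by simp
  have cF: "cf (range to_ac) ?F" using cf_range_to_ac by blast
  have R: "roots_ac f = {x. poly ?F x = 0}" by (simp add: roots_ac_def)
  have im: "\<phi> ` \<X> = roots_ac f" "inj_on \<phi> \<X>" using iso by (auto simp: cluster_iso_by_def bij_betw_def)
  \<comment> \<open>Simple roots make the degree equal to the number of points, so the bound on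
    \<open>card \<X>\<close> becomes the degree bound of \<open>tame_inertia\<close>.\<close>
  have "degree ?F = card (roots_ac f)"
    unfolding R using card_simple_roots[OF F0 squarefree_simple_roots[OF lc f]] by blast
  also have "\<dots> = card \<X>" using im card_image by metis
  finally have deg: "degree ?F < p" using p by simp
  obtain E \<tau> N \<zeta> where inertia: "\<not> p dvd N" "\<forall>j. \<zeta> ^ j = 1 \<longleftrightarrow> N dvd j"
    "sub_field E" "range to_ac \<subseteq> E" "{x. poly ?F x = 0} \<subseteq> E"
    "\<forall>x\<in>E. \<tau> x \<in> E" "\<forall>x\<in>range to_ac. \<tau> x = x"
    "\<forall>x\<in>E. \<forall>y\<in>E. \<tau> (x + y) = \<tau> x + \<tau> y \<and> \<tau> (x * y) = \<tau> x * \<tau> y"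
    "\<forall>x\<in>E. x \<noteq> 0 \<longrightarrow> (\<exists>k. of_nat N * v x = of_int k \<and> vgt (v x) (\<tau> x - \<zeta> powi k * x))"
    using tame_inertia[OF cF F0 deg] by (elim exE conjE) (rule that)
  have Er: "sub_ring E" using inertia(3) by (simp add: sub_field_def)
  have roots: "\<tau> x \<in> roots_ac f" if x: "x \<in> roots_ac f" for x
  proof -
    have xE: "x \<in> E" using x inertia(5) R by blast
    have hom: "\<tau> (poly P x) = poly P (\<tau> x)" if "cf (range to_ac) P" for P
      using that
    proof (induction P)
      case 0
      have "\<tau> 0 = 0" using inertia(7) by (metis rangeI to_ac_0)
      then show ?case by simp
    next
      case (pCons a P)
      have a: "a \<in> range to_ac" and P: "cf (range to_ac) P"
        using pCons.prems by (auto simp: cf_def coeff_pCons split: nat.splits)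
      have "poly P x \<in> E" by (rule poly_in_E[OF Er P inertia(4) xE])
      moreover from this have "x * poly P x \<in> E" using sub_ringD(4)[OF Er xE] by blast
      moreover have "a \<in> E" using a inertia(4) by blast
      ultimately have "\<tau> (a + x * poly P x) = \<tau> a + \<tau> x * \<tau> (poly P x)"
        using inertia(8) xE by simp
      then show ?case using pCons.IH[OF P] inertia(7) a by simp
    qed
    have "\<tau> 0 = 0" using inertia(7) by (metis rangeI to_ac_0)
    then show ?thesis using hom[OF cF] x by (simp add: R)
  qed
  have "finite (roots_ac f)" unfolding R using poly_roots_finite[OF F0] .
  then interpret root_picture \<X> \<Sigma> d v \<phi>
    using root_picture_if_iso[OF cp _ _ iso] val by blast
  interpret tame_action \<X> \<Sigma> d v \<phi> "range to_ac" p E \<tau> N \<zeta>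
  proof unfold_locales
    show "\<phi> x \<in> E" if "x \<in> \<X>" for x using that im inertia(5) R by blast
    show "\<tau> ` \<phi> ` \<X> \<subseteq> \<phi> ` \<X>" using roots im by blast
  qed (use p inertia in blast)+
  show ?thesis using c_perm c_tame by blast
qed

section \<open>From tame automorphisms to polynomials\<close>

context cluster_perm
begin

lemma image_comm: "(c ^^ m) ` (c ^^ n) ` s = (c ^^ (m + n)) ` s"
  by (simp only: image_comp funpow_add)

lemma e_image:
  assumes "s \<subseteq> \<X>"
  shows "e ((c ^^ i) ` s) = e s"
proof -
  have sub: "(c ^^ i) ` s \<subseteq> \<X>" using assms funpow_in by blast
  have "e ((c ^^ i) ` s) dvd m \<longleftrightarrow> e s dvd m" for m
  proof -
    have "e ((c ^^ i) ` s) dvd m \<longleftrightarrow> (c ^^ (i + m)) ` s = (c ^^ i) ` s"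
      unfolding fixed_iff[OF sub, symmetric] image_comm by (simp only: add.commute)
    also have "\<dots> \<longleftrightarrow> [i + m = i + 0] (mod e s)" using eq_iff[OF assms, of "i + m" "i + 0"] by simp
    also have "\<dots> \<longleftrightarrow> e s dvd m" unfolding cong_add_lcancel_nat by (rule cong_0_iff)
    finally show ?thesis .
  qed
  then show ?thesis by (metis dvd_antisym dvd_refl)
qed

text \<open>Translates of a cluster have the same size, so meeting ones, being nested,
  coincide.\<close>

lemma translate_eq:
  assumes "u \<in> \<Sigma>" "(c ^^ i) ` u \<inter> (c ^^ j) ` u \<noteq> {}"
  shows "(c ^^ i) ` u = (c ^^ j) ` u"
proof -
  have "card ((c ^^ i) ` u) = card ((c ^^ j) ` u)" using card_image_cluster assms by simp
  moreover have "finite ((c ^^ i) ` u)" "finite ((c ^^ j) ` u)" using finite_cluster assms by auto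
  ultimately show ?thesis
    using disjoint_or_nested[OF image_cluster image_cluster, OF assms(1) assms(1), of i j] assms(2)
    by (metis card_subset_eq)
qed

lemma e_point_le: "x \<in> \<X> \<Longrightarrow> e {x} \<le> card \<X>"
proof -
  assume x: "x \<in> \<X>"
  have "inj_on (\<lambda>i. (c ^^ i) x) {..<e {x}}"
  proof (rule inj_onI)
    fix i j assume ij: "i \<in> {..<e {x}}" "j \<in> {..<e {x}}" "(c ^^ i) x = (c ^^ j) x"
    then have "[i = j] (mod e {x})" using eq_iff[of "{x}" i j] x by simp
    then show "i = j" using ij by (simp add: cong_def)
  qed
  then have "card {..<e {x}} \<le> card \<X>"
    by (rule card_inj_on_le) (use funpow_in x finite_X in auto)
  then show ?thesis by simp
qed

lemma point_cong: "x \<in> \<X> \<Longrightarrow> (c ^^ i) x = (c ^^ j) x \<longleftrightarrow> [i = j] (mod e {x})"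
  using eq_iff[of "{x}" i j] by simp

lemma e_dvd_point: "s \<in> \<Sigma> \<Longrightarrow> x \<in> s \<Longrightarrow> e s dvd e {x}"
  using subset_e_dvd[of "{x}" s] singletons clusters_subset by blast

text \<open>An equivariant clock: it is built one orbit at a time, synchronising a new orbit with the
  smallest cluster that it shares with the points already treated.\<close>

definition clock_on :: "'x set \<Rightarrow> ('x \<Rightarrow> nat) \<Rightarrow> bool" where
  "clock_on Y k \<longleftrightarrow> (\<forall>x\<in>Y. \<forall>i. [k ((c ^^ i) x) = k x + i] (mod e {x})) \<and>
     (\<forall>s\<in>\<Sigma>. \<forall>x\<in>s \<inter> Y. \<forall>y\<in>s \<inter> Y. [k x = k y] (mod e s))"

text \<open>The value \<kappa> at \<open>x\<close> is copied from a point of the smallest cluster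
  through \<open>x\<close> that meets \<open>Y\<close>. Every other cluster through \<open>x\<close>
  meeting \<open>Y\<close> contains that one, so its congruence follows from those on
  \<open>Y\<close>; equivariance then forces the rest of the orbit up to multiples of
  \<open>e {x}\<close>.\<close>

lemma clock_extend:
  assumes Y: "Y \<subseteq> \<X>" "\<And>i y. y \<in> Y \<Longrightarrow> (c ^^ i) y \<in> Y" and k: "clock_on Y k" and x: "x \<in> \<X>" "x \<notin> Y"
  shows "\<exists>k'. clock_on (Y \<union> range (\<lambda>i. (c ^^ i) x)) k'"
proof -
  define O' where "O' = range (\<lambda>i. (c ^^ i) x)"
  have disj: "z \<notin> Y" if zO: "z \<in> O'" for z
  proof
    assume "z \<in> Y"
    obtain i where i: "z = (c ^^ i) x" using zO by (auto simp: O'_def)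
    obtain m where "(c ^^ m) ((c ^^ i) x) = x" using inverse_power x by blast
    then show False using Y(2)[OF \<open>z \<in> Y\<close>, of m] i x by simp
  qed
  have "\<exists>\<kappa>. \<forall>u\<in>\<Sigma>. x \<in> u \<longrightarrow> (\<forall>y\<in>u \<inter> Y. [\<kappa> = k y] (mod e u))"
  proof (cases "Y = {}")
    case False
    let ?A = "{u \<in> \<Sigma>. x \<in> u \<and> u \<inter> Y \<noteq> {}}"
    have "finite ?A" "\<X> \<in> ?A" using finite_clusters X_cluster x Y False by auto
    then obtain s where s: "s \<in> ?A" "\<forall>u\<in>?A. u \<subseteq> s \<longrightarrow> s = u"
      using finite_has_minimal2 by (metis (no_types, lifting))
    then obtain y where y: "y \<in> s \<inter> Y" by blast
    have "[k y = k y'] (mod e u)" if u: "u \<in> \<Sigma>" "x \<in> u" "y' \<in> u \<inter> Y" for u y'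
    proof -
      have "u \<in> ?A" using u by blast
      then have "s \<subseteq> u" using disjoint_or_nested[of s u] s u by blast
      then show ?thesis using k u y unfolding clock_on_def by blast
    qed
    then show ?thesis by blast
  qed auto
  then obtain \<kappa> where \<kappa>: "\<And>u y. u \<in> \<Sigma> \<Longrightarrow> x \<in> u \<Longrightarrow> y \<in> u \<inter> Y \<Longrightarrow> [\<kappa> = k y] (mod e u)" by blast
  define \<iota> where "\<iota> = (\<lambda>z. SOME i. (c ^^ i) x = z)"
  have \<iota>: "(c ^^ \<iota> z) x = z" if "z \<in> O'" for z
    unfolding \<iota>_def by (rule someI_ex) (use that in \<open>auto simp: O'_def\<close>)
  have \<iota>_cong: "[\<iota> ((c ^^ i) x) = i] (mod e {x})" for i
    using \<iota>[of "(c ^^ i) x"] point_cong[OF x(1)] by (auto simp: O'_def)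
  define k' where "k' = (\<lambda>z. if z \<in> Y then k z else \<kappa> + \<iota> z)"
  have kO: "k' z = \<kappa> + \<iota> z" if "z \<in> O'" for z using disj[OF that] by (simp add: k'_def)
  have kY: "k' z = k z" if "z \<in> Y" for z using that by (simp add: k'_def)
  \<comment> \<open>A cluster meeting the orbit is a translate of one through \<open>x\<close> with
    the same period, so all compatibilities reduce to clusters containing \<open>x\<close>.\<close>
  have pull: "\<exists>u\<in>\<Sigma>. x \<in> u \<and> s = (c ^^ i) ` u \<and> e u = e s" if s: "s \<in> \<Sigma>" "(c ^^ i) x \<in> s" for s i
  proof -
    obtain m where m0: "\<forall>u. u \<subseteq> \<X> \<longrightarrow> (c ^^ m) ` (c ^^ i) ` u = u \<and> (c ^^ i) ` (c ^^ m) ` u = u"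
    using inverse_power_image[of i] by (rule exE)
  have m: "u \<subseteq> \<X> \<Longrightarrow> (c ^^ m) ` (c ^^ i) ` u = u" "u \<subseteq> \<X> \<Longrightarrow> (c ^^ i) ` (c ^^ m) ` u = u" for u
    using m0 by simp_all
    have "(c ^^ m) ((c ^^ i) x) = x" using m(1)[of "{x}"] x by simp
    then have "x \<in> (c ^^ m) ` s" using imageI[OF s(2), of "c ^^ m"] by simp
    then show ?thesis
      using m[OF clusters_subset[OF s(1)]] image_cluster[OF s(1)] e_image[OF clusters_subset[OF s(1)]] by metis
  qed
  have mixed: "[k' z = k' y] (mod e s)" if s: "s \<in> \<Sigma>" and z: "z \<in> s" "z \<in> O'" and y: "y \<in> s" "y \<in> Y" for s z y
  proof -
    obtain i where i: "z = (c ^^ i) x" using z by (auto simp: O'_def)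
    obtain u where u: "u \<in> \<Sigma>" "x \<in> u" "s = (c ^^ i) ` u" "e u = e s"
        using pull[OF s, of i] z unfolding i by blast
    obtain y' where y': "y' \<in> u" "y = (c ^^ i) y'" using y u by blast
    have yX: "y' \<in> \<X>" using y' u clusters_subset by blast
    obtain m where "(c ^^ m) ((c ^^ i) y') = y'" using inverse_power yX by blast
    then have yY: "y' \<in> Y" using Y(2)[OF y(2), of m] y' by simp
    have "[k y = k y' + i] (mod e s)"
      using k yY e_dvd_point[OF u(1) y'(1)] u(4) y' unfolding clock_on_def by (metis cong_dvd_modulus_nat)
    moreover have "[k' z = \<kappa> + i] (mod e s)"
      using cong_add_lcancel_nat[of \<kappa>] \<iota>_cong[of i] e_dvd_point[OF u(1,2)] u(4) kO[OF z(2)] i by (metis cong_dvd_modulus_nat)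
    moreover have "[\<kappa> + i = k y' + i] (mod e s)"
      using \<kappa>[OF u(1,2), of y'] y' yY u(4) by (simp add: cong_add_rcancel_nat)
    ultimately show ?thesis unfolding kY[OF y(2)] using cong_trans cong_sym by meson
  qed
  have "clock_on (Y \<union> O') k'"
    unfolding clock_on_def
  proof (intro conjI ballI allI)
    fix z i assume "z \<in> Y \<union> O'"
    then consider "z \<in> Y" | "z \<in> O'" by blast
    then show "[k' ((c ^^ i) z) = k' z + i] (mod e {z})"
    proof cases
      case 1
      then show ?thesis using k Y(2)[OF 1] unfolding clock_on_def by (simp add: kY)
    next
      case 2
      obtain j where j: "z = (c ^^ j) x" using 2 by (auto simp: O'_def)
      have ez: "e {z} = e {x}" using e_image[of "{x}" j] x j by simp
      have cz: "(c ^^ i) z = (c ^^ (i + j)) x" unfolding j by (simp add: funpow_add)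
      have "(c ^^ i) z \<in> O'" unfolding cz O'_def by blast
      then have "k' ((c ^^ i) z) = \<kappa> + \<iota> ((c ^^ (i + j)) x)" using kO cz by simp
      moreover have "[\<iota> ((c ^^ (i + j)) x) = i + j] (mod e {x})" by (rule \<iota>_cong)
      moreover have "[\<iota> z = j] (mod e {x})" unfolding j by (rule \<iota>_cong)
      ultimately have "[k' ((c ^^ i) z) = \<kappa> + (i + j)] (mod e {x})" "[\<kappa> + \<iota> z + i = \<kappa> + j + i] (mod e {x})"
        by (auto intro!: cong_add)
      then show ?thesis unfolding ez kO[OF 2] by (metis add.assoc add.commute cong_sym cong_trans)
    qed
  next
    fix s z z' assume s: "s \<in> \<Sigma>" and z: "z \<in> s \<inter> (Y \<union> O')" and z': "z' \<in> s \<inter> (Y \<union> O')"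
    consider "z \<in> Y" "z' \<in> Y" | "z \<in> O'" "z' \<in> Y" | "z \<in> Y" "z' \<in> O'" | "z \<in> O'" "z' \<in> O'" using z z' by blast
    then show "[k' z = k' z'] (mod e s)"
    proof cases
      case 1
      then show ?thesis using k s z z' unfolding clock_on_def by (simp add: kY)
    next
      case 2
      then show ?thesis using mixed s z z' by blast
    next
      case 3
      then show ?thesis using mixed[of s z' z] s z z' cong_sym by blast
    next
      case 4
      obtain i where i: "z = (c ^^ i) x" using 4 by (auto simp: O'_def)
      obtain j where j: "z' = (c ^^ j) x" using 4 by (auto simp: O'_def)
      obtain u where u: "u \<in> \<Sigma>" "x \<in> u" "s = (c ^^ i) ` u" "e u = e s"
        using pull[OF s, of i] z unfolding i by blast
      have "(c ^^ j) x \<in> (c ^^ i) ` u \<inter> (c ^^ j) ` u" using j z' u by auto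
      \<comment> \<open>Equal translates of \<open>u\<close> mean that the two positions in the
        orbit agree modulo the period of \<open>s\<close>, as the clock requires.\<close>
      then have "(c ^^ i) ` u = (c ^^ j) ` u" using translate_eq[OF u(1)] by blast
      then have "[i = j] (mod e s)" using eq_iff[OF clusters_subset[OF u(1)]] u(4) by simp
      moreover have "[\<iota> z = i] (mod e s)" "[\<iota> z' = j] (mod e s)"
        using \<iota>_cong[of i] \<iota>_cong[of j] e_dvd_point[OF u(1,2)] u(4) i j by (metis cong_dvd_modulus_nat)+
      ultimately have "[\<iota> z = \<iota> z'] (mod e s)" using cong_trans cong_sym by meson
      then show ?thesis using 4 by (simp add: kO cong_add_lcancel_nat)
    qed
  qed
  then show ?thesis unfolding O'_def by blast
qed

lemma clock_exists: "\<exists>k. clock_on \<X> k"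
proof -
  let ?A = "{Y. Y \<subseteq> \<X> \<and> (\<forall>i. \<forall>y\<in>Y. (c ^^ i) y \<in> Y) \<and> (\<exists>k. clock_on Y k)}"
  have "finite ?A" using finite_X by simp
  moreover have "{} \<in> ?A" by (simp add: clock_on_def)
  ultimately obtain Y where Y: "Y \<in> ?A" "\<forall>Z\<in>?A. Y \<subseteq> Z \<longrightarrow> Y = Z"
    using finite_has_maximal2 by (metis (no_types, lifting))
  have "Y = \<X>"
  proof (rule ccontr)
    assume "Y \<noteq> \<X>"
    then obtain x where x: "x \<in> \<X>" "x \<notin> Y" using Y by blast
    obtain k where "clock_on Y k" using Y by blast
    then obtain k' where k': "clock_on (Y \<union> range (\<lambda>i. (c ^^ i) x)) k'"
      using clock_extend[of Y k x] Y(1) x by blast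
    have orbit: "(c ^^ i) y \<in> range (\<lambda>i. (c ^^ i) x)" if y: "y \<in> range (\<lambda>i. (c ^^ i) x)" for i y
    proof -
      obtain j where "y = (c ^^ j) x" using y by blast
      then have "(c ^^ i) y = (c ^^ (i + j)) x" by (simp add: funpow_add)
      then show ?thesis by blast
    qed
    have "Y \<union> range (\<lambda>i. (c ^^ i) x) \<in> ?A"
    proof (intro CollectI conjI)
      have "Y \<subseteq> \<X>" using Y(1) by blast
      moreover have "range (\<lambda>i. (c ^^ i) x) \<subseteq> \<X>" using funpow_in[OF x(1)] by blast
      ultimately show "Y \<union> range (\<lambda>i. (c ^^ i) x) \<subseteq> \<X>" by (rule Un_least)
      show "\<forall>i. \<forall>y\<in>Y \<union> range (\<lambda>i. (c ^^ i) x). (c ^^ i) y \<in> Y \<union> range (\<lambda>i. (c ^^ i) x)"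
      proof (intro allI ballI)
        fix i y assume "y \<in> Y \<union> range (\<lambda>i. (c ^^ i) x)"
        then consider "y \<in> Y" | "y \<in> range (\<lambda>i. (c ^^ i) x)" by (rule UnE)
        then show "(c ^^ i) y \<in> Y \<union> range (\<lambda>i. (c ^^ i) x)"
        proof cases
          case 1
          have "\<forall>i. \<forall>y\<in>Y. (c ^^ i) y \<in> Y" using Y(1) by blast
          then show ?thesis using 1 by blast
        next
          case 2
          show ?thesis by (rule UnI2) (rule orbit[OF 2])
        qed
      qed
      show "\<exists>k. clock_on (Y \<union> range (\<lambda>i. (c ^^ i) x)) k" by (rule exI[of _ k']) (rule k')
    qed
    then have "Y \<subseteq> Y \<union> range (\<lambda>i. (c ^^ i) x) \<longrightarrow> Y = Y \<union> range (\<lambda>i. (c ^^ i) x)"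
      by (rule bspec[OF Y(2)])
    then have "Y = Y \<union> range (\<lambda>i. (c ^^ i) x)" using Un_upper1 by (rule mp)
    moreover have "x \<in> range (\<lambda>i. (c ^^ i) x)" by (rule range_eqI[of _ _ 0]) simp
    ultimately show False using x by blast
  qed
  then show ?thesis using Y by blast
qed

definition ch :: "'x set \<Rightarrow> 'x \<Rightarrow> 'x set" where
  "ch s x = (THE t. is_child \<Sigma> t s \<and> x \<in> t)"

lemma ch_eq: "is_child \<Sigma> t s \<Longrightarrow> x \<in> t \<Longrightarrow> ch s x = t"
  unfolding ch_def by (rule the_equality) (use children_disjoint in blast)+

lemma ch:
  assumes "s \<in> \<Sigma>" "card s > 1" "x \<in> s"
  shows "is_child \<Sigma> (ch s x) s" "x \<in> ch s x"
  using proper_child_of_point[OF assms] ch_eq by metis+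

lemma ch_image:
  assumes "s \<in> \<Sigma>" "card s > 1" "x \<in> s"
  shows "ch ((c ^^ i) ` s) ((c ^^ i) x) = (c ^^ i) ` ch s x"
  by (rule ch_eq) (use image_child[OF ch(1)[OF assms]] assms ch(2)[OF assms] in auto)

lemma fixed_children_image:
  assumes s: "s \<in> \<Sigma>" and t: "is_child \<Sigma> t s"
  shows "fixed_children ((c ^^ i) ` s) = {(c ^^ i) ` t} \<longleftrightarrow> fixed_children s = {t}"
proof -
  have sX: "s \<subseteq> \<X>" using clusters_subset s .
  obtain m where m0: "\<forall>u. u \<subseteq> \<X> \<longrightarrow> (c ^^ m) ` (c ^^ i) ` u = u \<and> (c ^^ i) ` (c ^^ m) ` u = u"
    using inverse_power_image[of i] by (rule exE)
  have m: "u \<subseteq> \<X> \<Longrightarrow> (c ^^ m) ` (c ^^ i) ` u = u" "u \<subseteq> \<X> \<Longrightarrow> (c ^^ i) ` (c ^^ m) ` u = u" for u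
    using m0 by simp_all
  have sub: "u \<subseteq> \<X>" if "is_child \<Sigma> u w" for u w using that is_childD clusters_subset by blast
  have 1: "(c ^^ j) ` u \<in> fixed_children ((c ^^ j) ` w)" if "u \<in> fixed_children w" "w \<in> \<Sigma>" for u w j
    using that image_child e_image sub clusters_subset by auto
  have "fixed_children ((c ^^ i) ` s) = (\<lambda>u. (c ^^ i) ` u) ` fixed_children s"
  proof (intro equalityI subsetI)
    fix u assume u: "u \<in> fixed_children ((c ^^ i) ` s)"
    have "(c ^^ m) ` u \<in> fixed_children s" using 1[OF u image_cluster[OF s], of m] m(1)[OF sX] by simp
    moreover have "u = (c ^^ i) ` (c ^^ m) ` u" using m(2)[of u] sub[of u] u by blast
    ultimately show "u \<in> (\<lambda>u. (c ^^ i) ` u) ` fixed_children s" by blast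
  qed (use 1 s in blast)
  moreover have "inj_on (\<lambda>u. (c ^^ i) ` u) (insert t (fixed_children s))"
  proof (rule inj_on_inverseI[of _ "\<lambda>u. (c ^^ m) ` u"])
    fix u assume "u \<in> insert t (fixed_children s)"
    then have "u \<subseteq> \<X>" using sub t by blast
    then show "(c ^^ m) ` (c ^^ i) ` u = u" by (rule m(1))
  qed
  then have "(\<lambda>u. (c ^^ i) ` u) ` fixed_children s = (\<lambda>u. (c ^^ i) ` u) ` {t} \<longleftrightarrow> fixed_children s = {t}"
    by (rule inj_on_image_eq_iff) auto
  ultimately show ?thesis by simp
qed

definition orb :: "'x set \<Rightarrow> 'x set set" where
  "orb t = range (\<lambda>i. (c ^^ i) ` t)"

lemma orb_self: "t \<in> orb t"
  unfolding orb_def by (rule range_eqI[of _ _ 0]) simp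

lemma orb_image:
  assumes "t \<subseteq> \<X>"
  shows "orb ((c ^^ i) ` t) = orb t"
proof (intro equalityI subsetI)
  fix u assume "u \<in> orb t"
  then obtain j where j: "u = (c ^^ j) ` t" by (auto simp: orb_def)
  obtain m where m0: "\<forall>u. u \<subseteq> \<X> \<longrightarrow> (c ^^ m) ` (c ^^ i) ` u = u \<and> (c ^^ i) ` (c ^^ m) ` u = u"
    using inverse_power_image[of i] by (rule exE)
  then have m1: "(c ^^ m) ` (c ^^ i) ` t = t" using assms by simp
  have "u = (c ^^ (j + m)) ` (c ^^ i) ` t" unfolding image_comm[symmetric, of j m] m1 j by (rule refl)
  then show "u \<in> orb ((c ^^ i) ` t)" by (auto simp: orb_def)
next
  fix u assume "u \<in> orb ((c ^^ i) ` t)"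
  then show "u \<in> orb t" by (auto simp: orb_def image_comm simp del: image_image)
qed

text \<open>Full orbits under \<open>c\<close>, not under the stabiliser of \<open>s\<close>, are
  collected: then \<open>s\<close> and its translates have literally the same \<open>orbs\<close>,
  and labels chosen from it are constant on \<open>c\<close>-orbits.\<close>

definition orbs :: "'x set \<Rightarrow> 'x set set set" where
  "orbs s = orb ` {t. is_child \<Sigma> t s \<and> fixed_children s \<noteq> {t}}"

lemma orbs_image:
  assumes s: "s \<in> \<Sigma>"
  shows "orbs ((c ^^ i) ` s) = orbs s"
proof -
  have sub: "orbs w \<subseteq> orbs ((c ^^ j) ` w)" if w: "w \<in> \<Sigma>" for w j
  proof
    fix o' assume "o' \<in> orbs w"
    then obtain t where t: "is_child \<Sigma> t w" "fixed_children w \<noteq> {t}" "o' = orb t" by (auto simp: orbs_def)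
    have "o' = orb ((c ^^ j) ` t)" using orb_image t clusters_subset is_childD by metis
    moreover have "fixed_children ((c ^^ j) ` w) \<noteq> {(c ^^ j) ` t}"
      using fixed_children_image[OF w t(1), of j] t(2) by simp
    ultimately show "o' \<in> orbs ((c ^^ j) ` w)"
      unfolding orbs_def using image_child[OF t(1) w, of j] by (metis (mono_tags, lifting) image_eqI mem_Collect_eq)
  qed
  obtain m where m0: "\<forall>u. u \<subseteq> \<X> \<longrightarrow> (c ^^ m) ` (c ^^ i) ` u = u \<and> (c ^^ i) ` (c ^^ m) ` u = u"
    using inverse_power_image[of i] by (rule exE)
  then have m1: "(c ^^ m) ` (c ^^ i) ` s = s" using clusters_subset[OF s] by simp
  show ?thesis using sub[OF s, of i] sub[OF image_cluster[OF s, of i], of m] unfolding m1 by (rule equalityI[rotated])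
qed

end

text \<open>The converse of \<open>root_picture_if_iso\<close>: a disc of arbitrary centre that
  meets the roots is recentred at a root.\<close>

lemma (in root_picture) iso_if_root_picture:
  "cluster_iso_by \<phi> \<X> \<Sigma> d (\<phi> ` \<X>) (clusters_of v (\<phi> ` \<X>)) (depth_of v)"
  unfolding cluster_iso_by_def
proof (intro conjI ballI impI)
  have ball: "x = z \<or> q \<le> v (x - z) \<longleftrightarrow> vge q (x - z)" for x z q by (auto simp: vge_def)
  show "bij_betw \<phi> \<X> (\<phi> ` \<X>)" using inj_\<phi> by (rule inj_on_imp_bij_betw)
  have inj: "inj_on (image \<phi>) \<Sigma>"
  proof (rule inj_onI)
    fix s t assume "s \<in> \<Sigma>" "t \<in> \<Sigma>" "\<phi> ` s = \<phi> ` t"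
    then show "s = t" using inj_on_image_eq_iff[OF inj_\<phi> clusters_subset clusters_subset] by blast
  qed
  have "image \<phi> ` \<Sigma> = clusters_of v (\<phi> ` \<X>)"
  proof (intro equalityI subsetI)
    fix S assume "S \<in> image \<phi> ` \<Sigma>"
    then obtain s where s: "s \<in> \<Sigma>" "S = \<phi> ` s" by blast
    then obtain t q where tq: "s = {x\<in>\<X>. vge q (\<phi> x - \<phi> t)}" using cluster_iff by blast
    have "S = \<phi> ` \<X> \<inter> {x. vge q (x - \<phi> t)}" unfolding s(2) tq by auto
    moreover have "S \<noteq> {}" using s clusters_nonempty by blast
    ultimately show "S \<in> clusters_of v (\<phi> ` \<X>)" unfolding clusters_of_def ball by blast
  next
    fix S assume "S \<in> clusters_of v (\<phi> ` \<X>)"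
    then obtain z q where z: "S \<noteq> {}" "S = \<phi> ` \<X> \<inter> {x. vge q (x - z)}" unfolding clusters_of_def ball by blast
    then obtain x where x: "x \<in> \<X>" "vge q (\<phi> x - z)" by blast
    have "vge q (w - z) \<longleftrightarrow> vge q (w - \<phi> x)" for w
      using vge_diff[OF _ x(2), of "w - z"] vge_add[OF _ x(2), of "w - \<phi> x"] by auto
    then have "S = \<phi> ` {y\<in>\<X>. vge q (\<phi> y - \<phi> x)}" unfolding z(2) by auto
    moreover have "{y\<in>\<X>. vge q (\<phi> y - \<phi> x)} \<in> \<Sigma>" unfolding cluster_iff using x by blast
    ultimately show "S \<in> image \<phi> ` \<Sigma>" by blast
  qed
  then show "bij_betw (image \<phi>) \<Sigma> (clusters_of v (\<phi> ` \<X>))" using inj by (simp add: bij_betw_def)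
next
  fix s assume s: "s \<in> \<Sigma>" "card s > 1"
  let ?V = "{v (r - r') | r r'. r \<in> \<phi> ` s \<and> r' \<in> \<phi> ` s \<and> r \<noteq> r'}"
  have "?V \<subseteq> (\<lambda>(x, y). v (\<phi> x - \<phi> y)) ` (s \<times> s)" by auto
  then have fin: "finite ?V" by (rule finite_subset) (use finite_cluster[OF s(1)] in simp)
  have "Min ?V = d s"
  proof (rule Min_eqI[OF fin])
    fix q assume "q \<in> ?V"
    then obtain x y where "x \<in> s" "y \<in> s" "\<phi> x \<noteq> \<phi> y" "q = v (\<phi> x - \<phi> y)" by auto
    then show "d s \<le> q" using depth_le[OF s(1), of x y] by auto
  next
    obtain x y where xy: "x \<in> s" "y \<in> s" "x \<noteq> y" "v (\<phi> x - \<phi> y) = d s" using depth_attained s by blast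
    moreover have "\<phi> x \<noteq> \<phi> y" using inj_onD[OF inj_\<phi>, of x y] xy clusters_subset[OF s(1)] by blast
    ultimately show "d s \<in> ?V" by (metis (mono_tags, lifting) image_eqI mem_Collect_eq)
  qed
  then show "depth_of v (\<phi> ` s) = d s" by (simp add: depth_of_def)
qed

text \<open>The \<open>D + 1\<close> first powers of \<open>Q\<close> are linearly dependent modulo \<open>Y ^ D - \<pi>\<close>.\<close>

lemma relation_of_degree:
  fixes K :: "'a::field set"
  assumes K: "sub_field K" and Q: "cf K Q" and pi: "\<pi> \<in> K" and D: "D > 0"
  shows "\<exists>m. cf K m \<and> m \<noteq> 0 \<and> degree m \<le> D \<and> (\<forall>\<rho>. \<rho> ^ D = \<pi> \<longrightarrow> poly m (poly Q \<rho>) = 0)"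
proof -
  have Kr: "sub_ring K" using K by (simp add: sub_field_def)
  let ?g = "monom 1 D - [:\<pi>:]"
  have cg: "cf K ?g" using Kr pi by (intro cf_diff cf_monom cf_pCons cf_0 sub_ringD) auto
  have dg: "degree ?g = D"
  proof (rule antisym)
    show "degree ?g \<le> D" by (intro degree_diff_le degree_monom_le) simp
    show "D \<le> degree ?g" using D by (intro le_degree) (auto simp: coeff_pCons split: nat.splits)
  qed
  then have lg: "lead_coeff ?g = 1" using D by (auto simp: coeff_pCons split: nat.splits)
  have "\<exists>R. cf K R \<and> degree R < D \<and> (\<forall>\<rho>. \<rho> ^ D = \<pi> \<longrightarrow> poly Q \<rho> ^ i = poly R \<rho>)" for i
  proof -
    obtain q R where qR: "cf K q" "cf K R" "Q ^ i = q * ?g + R" "degree R < degree ?g"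
      using monic_division[OF Kr cg lg _ cf_power[OF Kr Q], of i] D dg by auto
    have "poly Q \<rho> ^ i = poly R \<rho>" if "\<rho> ^ D = \<pi>" for \<rho>
      using arg_cong[OF qR(3), of "\<lambda>P. poly P \<rho>"] that by (simp add: poly_monom poly_power)
    then show ?thesis using qR dg by auto
  qed
  then have "\<forall>i. \<exists>R. cf K R \<and> degree R < D \<and> (\<forall>\<rho>. \<rho> ^ D = \<pi> \<longrightarrow> poly Q \<rho> ^ i = poly R \<rho>)" by blast
  from choice[OF this] obtain R where R: "\<And>i. cf K (R i)" "\<And>i. degree (R i) < D"
    "\<And>i \<rho>. \<rho> ^ D = \<pi> \<Longrightarrow> poly Q \<rho> ^ i = poly (R i) \<rho>" by blast
  have "\<exists>c. (\<forall>i. c i \<in> K) \<and> (\<exists>i\<in>{..D}. c i \<noteq> 0) \<and> (\<forall>j\<in>{..<D}. (\<Sum>i\<in>{..D}. c i * coeff (R i) j) = 0)"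
    by (rule linear_dependence[OF K]) (use R(1) in \<open>auto simp: cf_def\<close>)
  then obtain c where c: "\<And>i. c i \<in> K" "\<exists>i\<in>{..D}. c i \<noteq> 0" "\<And>j. j < D \<Longrightarrow> (\<Sum>i\<in>{..D}. c i * coeff (R i) j) = 0"
    by blast
  define m where "m = (\<Sum>i\<in>{..D}. monom (c i) i)"
  have cm: "coeff m i = (if i \<le> D then c i else 0)" for i by (simp add: m_def coeff_sum)
  have "m \<noteq> 0" using c(2) cm by (metis atMost_iff coeff_0)
  moreover have "cf K m" using c(1) sub_ringD(2)[OF Kr] by (simp add: cf_def cm)
  moreover have "degree m \<le> D" by (rule degree_le) (simp add: cm)
  moreover have "poly m (poly Q \<rho>) = 0" if \<rho>: "\<rho> ^ D = \<pi>" for \<rho>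
  proof -
    have "poly (R i) \<rho> = (\<Sum>j<D. coeff (R i) j * \<rho> ^ j)" for i
      unfolding poly_altdef using R(2)[of i] by (intro sum.mono_neutral_left) (auto simp: coeff_eq_0)
    then have "poly m (poly Q \<rho>) = (\<Sum>i\<in>{..D}. \<Sum>j<D. c i * coeff (R i) j * \<rho> ^ j)"
      unfolding m_def poly_sum poly_monom R(3)[OF \<rho>] by (simp add: sum_distrib_left mult.assoc)
    also have "\<dots> = (\<Sum>j<D. \<Sum>i\<in>{..D}. c i * coeff (R i) j * \<rho> ^ j)" by (rule sum.swap)
    also have "\<dots> = (\<Sum>j<D. (\<Sum>i\<in>{..D}. c i * coeff (R i) j) * \<rho> ^ j)" by (simp only: sum_distrib_right)
    also have "\<dots> = 0" using c(3) by simp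
    finally show ?thesis .
  qed
  ultimately show ?thesis by blast
qed

text \<open>The index \<open>(p - 1)!\<close> is prime to \<open>p\<close> and divisible by every
  orbit length, because orbits have at most \<open>card \<X>\<close> points. The primitive root
  \<gamma> supplies the labels, the clock \<open>k\<close> the twists.\<close>

locale tame_cluster = cluster_perm \<X> \<Sigma> d c + local_closure v K p
  for \<X> :: "'x set" and \<Sigma> :: "'x set set" and d :: "'x set \<Rightarrow> rat" and c :: "'x \<Rightarrow> 'x"
    and v :: "'a::alg_closed_field \<Rightarrow> rat" and K :: "'a set" and p :: nat +
  fixes \<pi> \<omega> \<zeta> :: 'a and k :: "'x \<Rightarrow> nat" and \<gamma> N :: nat
  assumes tame: tame and card_p: "card \<X> < p"
    and \<pi>: "\<pi> \<in> K" "\<pi> \<noteq> 0" "v \<pi> = 1"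
    and N: "N = fact (p - 1)"
    and \<omega>: "\<omega> ^ N = \<pi>" and \<zeta>: "\<zeta> ^ j = 1 \<longleftrightarrow> N dvd j"
    and clock: "clock_on \<X> k" and \<gamma>: "residue_primroot p \<gamma>"
begin

lemma N_pos: "N > 0" by (simp add: N)

lemma p_N: "\<not> p dvd N"
  unfolding N prime_dvd_fact_iff[OF prime_p] using prime_gt_0_nat[OF prime_p] by simp

lemma e_dvd_N: "t \<in> \<Sigma> \<Longrightarrow> e t dvd N"
proof -
  assume t: "t \<in> \<Sigma>"
  obtain x where x: "x \<in> t" using clusters_nonempty t by blast
  then have xX: "x \<in> \<X>" using clusters_subset t by blast
  have "e {x} \<le> p - 1" using e_point_le[OF xX] card_p by simp
  then have "e {x} dvd N" unfolding N using e_pos[of "{x}"] xX by (intro dvd_fact) auto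
  then show "e t dvd N" using e_dvd_point[OF t x] by (rule dvd_trans[rotated])
qed

text \<open>The common orbit length of the non-orphan children of \<open>s\<close> under the
  stabiliser of \<open>s\<close>.\<close>

definition n :: "'x set \<Rightarrow> nat" where "n s = denom (d s * of_nat (e s))"

lemma e_child: "s \<in> \<Sigma> \<Longrightarrow> is_child \<Sigma> t s \<Longrightarrow> fixed_children s \<noteq> {t} \<Longrightarrow> e t = e s * n s"
  using tame unfolding tame_def n_def by blast

text \<open>A proper cluster has two different children, and they cannot both be its only fixed
  child.\<close>

lemma nonorphan_exists:
  assumes s: "s \<in> \<Sigma>" "card s > 1"
  shows "\<exists>t. is_child \<Sigma> t s \<and> fixed_children s \<noteq> {t}"
proof -
  obtain x where x: "x \<in> s" using clusters_nonempty s by blast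
  then obtain y where y: "y \<in> s" "y \<notin> ch s x" using is_childD(2)[OF ch(1)[OF s x]] by blast
  have "ch s x \<noteq> ch s y" using ch(2)[OF s y(1)] y(2) by auto
  then show ?thesis using ch(1)[OF s x] ch(1)[OF s y(1)] by (metis singleton_inject)
qed

text \<open>The period \<open>e s * n s\<close> of a non-orphan child is the lcm of
  \<open>e s\<close> and the denominator of \<open>d s\<close>.\<close>

lemma child_depth_int:
  assumes "s \<in> \<Sigma>" "is_child \<Sigma> t s" "fixed_children s \<noteq> {t}"
  shows "of_nat (e t) * d s \<in> \<int>"
proof -
  have "e t = lcm (e s) (denom (d s))"
    using e_child[OF assms] lcm_denom[OF e_pos[OF clusters_subset[OF assms(1)]]] by (simp add: n_def)
  then show ?thesis unfolding denom_dvd_iff by simp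
qed

lemma multiple_int: "(of_nat a * q :: rat) \<in> \<int> \<Longrightarrow> a dvd b \<Longrightarrow> of_nat b * q \<in> \<int>"
  unfolding denom_dvd_iff by (rule dvd_trans)

text \<open>The exponent that gives an \<open>N\<close>-th root of \<open>\<pi>\<close> the value
  \<open>d s\<close>. The floor is exact: the period of a non-orphan child clears the denominator of
  \<open>d s\<close> and divides \<open>N\<close>.\<close>

definition nd :: "'x set \<Rightarrow> int" where "nd s = \<lfloor>of_nat N * d s\<rfloor>"

lemma nd: "s \<in> \<Sigma> \<Longrightarrow> card s > 1 \<Longrightarrow> of_int (nd s) = of_nat N * d s"
proof -
  assume s: "s \<in> \<Sigma>" "card s > 1"
  obtain t where t: "is_child \<Sigma> t s" "fixed_children s \<noteq> {t}" using nonorphan_exists s by blast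
  have "of_nat N * d s \<in> \<int>"
    by (rule multiple_int[OF child_depth_int[OF s(1) t] e_dvd_N[OF is_childD(1)[OF t(1)]]])
  then show "of_int (nd s) = of_nat N * d s" by (simp add: nd_def)
qed

text \<open>Turning the clock by \<open>z\<close> multiplies the power \<open>nd s\<close> of
  \<open>\<theta>\<close> by a root of unity; this is the criterion for that root of unity to be
  1.\<close>

lemma N_dvd_iff:
  assumes s: "s \<in> \<Sigma>" "card s > 1"
  shows "int N dvd z * nd s \<longleftrightarrow> of_int z * d s \<in> \<int>"
proof
  assume "int N dvd z * nd s"
  then obtain l where "z * nd s = int N * l" by (auto elim: dvdE)
  then have "of_int (z * nd s) = (of_int (int N * l) :: rat)" by (simp only:)
  then have "of_nat N * (of_int z * d s) = of_nat N * of_int l" using nd[OF s] by (simp add: mult_ac)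
  then have "of_int z * d s = of_int l" using N_pos by (subst (asm) mult_cancel_left) simp
  then show "of_int z * d s \<in> \<int>" by simp
next
  assume "of_int z * d s \<in> \<int>"
  then obtain l where "of_int z * d s = of_int l" by (auto elim: Ints_cases)
  then have "of_int z * of_int (nd s) = (of_nat N * of_int l :: rat)" using nd[OF s] by (simp add: mult.left_commute)
  then have "of_int (z * nd s) = (of_int (int N * l) :: rat)" by simp
  then have "z * nd s = int N * l" by (simp only: of_int_eq_iff)
  then show "int N dvd z * nd s" by simp
qed

lemma \<omega>_nonzero: "\<omega> \<noteq> 0" and v_\<omega>: "v \<omega> = 1 / of_nat N"
proof -
  show nz: "\<omega> \<noteq> 0" using \<omega> \<pi> N_pos by (auto simp: zero_power)
  have "of_nat N * v \<omega> = 1" using v_power[OF nz, of N] \<omega> \<pi> by simp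
  then show "v \<omega> = 1 / of_nat N" using N_pos by (simp add: nonzero_eq_divide_eq mult.commute)
qed

lemma \<zeta>_unit: "\<zeta> \<noteq> 0" "v \<zeta> = 0"
  using \<zeta>[of N] N_pos v_root_of_unity[of \<zeta> N] by (auto simp: zero_power)

definition \<theta> :: "'x \<Rightarrow> 'a" where "\<theta> x = \<zeta> ^ k x * \<omega>"

lemma \<theta>_nonzero: "\<theta> x \<noteq> 0" using \<omega>_nonzero \<zeta>_unit by (simp add: \<theta>_def)

lemma \<theta>_power: "\<theta> x ^ N = \<pi>"
proof -
  have "(\<zeta> ^ k x) ^ N = 1" using \<zeta>[of "k x * N"] by (simp add: power_mult)
  then show ?thesis using \<omega> by (simp add: \<theta>_def power_mult_distrib)
qed

lemma v_\<theta>: "v (\<theta> x) = 1 / of_nat N"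
  using v_\<omega> \<zeta>_unit \<omega>_nonzero by (simp add: \<theta>_def v_mult v_power)

lemma v_\<theta>_nd: "s \<in> \<Sigma> \<Longrightarrow> card s > 1 \<Longrightarrow> v (\<theta> x powi nd s) = d s"
  using v_powi[OF \<theta>_nonzero] v_\<theta> nd N_pos by simp

lemma \<theta>_ratio: "\<theta> y powi j = \<zeta> powi ((int (k y) - int (k x)) * j) * \<theta> x powi j"
proof -
  have "\<theta> y = \<zeta> powi (int (k y) - int (k x)) * \<theta> x"
    using \<zeta>_unit by (simp add: \<theta>_def power_int_diff)
  then show ?thesis by (simp add: power_int_mult_distrib power_int_mult)
qed

lemma clock_same:
  assumes "s \<in> \<Sigma>" "x \<in> s" "y \<in> s"
  shows "int (e s) dvd int (k y) - int (k x)"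
proof -
  have "[k y = k x] (mod e s)" using clock assms clusters_subset unfolding clock_on_def by blast
  then show ?thesis by (metis cong_iff_dvd_diff cong_int_iff)
qed

lemma clock_power: "x \<in> \<X> \<Longrightarrow> [k ((c ^^ i) x) = k x + i] (mod e {x})"
  using clock unfolding clock_on_def by blast

text \<open>The chosen enumeration depends only on the set \<open>A\<close>, so translates of a
  cluster, which share \<open>orbs\<close>, also share the labels of their children.\<close>

definition num :: "'x set set set \<Rightarrow> 'x set set \<Rightarrow> nat" where
  "num A = (SOME h. bij_betw h A {0..<card A})"

lemma finite_orbs: "finite (orbs s)"
proof -
  have "{t. is_child \<Sigma> t s \<and> fixed_children s \<noteq> {t}} \<subseteq> \<Sigma>" using is_childD by blast
  then show ?thesis unfolding orbs_def using finite_clusters finite_subset by blast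
qed

lemma num: "bij_betw (num (orbs s)) (orbs s) {0..<card (orbs s)}"
  unfolding num_def
  by (rule someI_ex[of "\<lambda>h. bij_betw h (orbs s) {0..<card (orbs s)}"])
    (rule ex_bij_betw_finite_nat[OF finite_orbs])

text \<open>Each orbit of non-orphan children of \<open>s\<close> has \<open>n s\<close> members inside \<open>s\<close>, and these are disjoint.\<close>

lemma card_orbs:
  assumes s: "s \<in> \<Sigma>"
  shows "n s * card (orbs s) \<le> card \<X>"
proof -
  define rep where "rep = (\<lambda>A. SOME t. is_child \<Sigma> t s \<and> fixed_children s \<noteq> {t} \<and> orb t = A)"
  have rep: "is_child \<Sigma> (rep A) s" "fixed_children s \<noteq> {rep A}" "orb (rep A) = A" if "A \<in> orbs s" for A
  proof -
    have "\<exists>t. is_child \<Sigma> t s \<and> fixed_children s \<noteq> {t} \<and> orb t = A" using that by (auto simp: orbs_def)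
    from someI_ex[OF this] show "is_child \<Sigma> (rep A) s" "fixed_children s \<noteq> {rep A}" "orb (rep A) = A"
      by (auto simp: rep_def)
  qed
  define T where "T = (\<lambda>(A, i). (c ^^ (e s * i)) ` rep A)"
  define pt where "pt = (\<lambda>Ai. SOME x. x \<in> T Ai)"
  have T: "is_child \<Sigma> (T Ai) s" if Ai: "Ai \<in> orbs s \<times> {..<n s}" for Ai
  proof -
    obtain A i where A: "Ai = (A, i)" "A \<in> orbs s" using Ai by auto
    have "is_child \<Sigma> ((c ^^ (e s * i)) ` rep A) ((c ^^ (e s * i)) ` s)"
      using image_child[OF rep(1)[OF A(2)] s] .
    moreover have "(c ^^ (e s * i)) ` s = s" using fixed_iff[OF clusters_subset[OF s]] by simp
    ultimately show ?thesis using A by (simp add: T_def)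
  qed
  have pt: "pt Ai \<in> T Ai" if "Ai \<in> orbs s \<times> {..<n s}" for Ai
    unfolding pt_def using T[OF that] is_childD(1) clusters_nonempty by (metis some_in_eq)
  have "inj_on pt (orbs s \<times> {..<n s})"
  proof (rule inj_onI)
    fix Ai Bj assume a: "Ai \<in> orbs s \<times> {..<n s}" "Bj \<in> orbs s \<times> {..<n s}" "pt Ai = pt Bj"
    obtain A i B j where AB: "Ai = (A, i)" "Bj = (B, j)" "A \<in> orbs s" "B \<in> orbs s" "i < n s" "j < n s"
      using a by auto
    have "T Ai = T Bj" using children_disjoint[OF T[OF a(1)] T[OF a(2)]] pt[OF a(1)] pt[OF a(2)] a(3) by auto
    then have eq: "(c ^^ (e s * i)) ` rep A = (c ^^ (e s * j)) ` rep B" using AB by (simp add: T_def)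
    have sub: "rep A \<subseteq> \<X>" "rep B \<subseteq> \<X>" using rep(1) AB is_childD(1) clusters_subset by blast+
    have "A = B" using orb_image[OF sub(1), of "e s * i"] orb_image[OF sub(2), of "e s * j"] rep(3) AB eq by simp
    then have "[e s * i = e s * j] (mod e s * n s)"
      using eq eq_iff[OF sub(1)] e_child[OF s rep(1,2)[OF AB(3)]] by simp
    then have "e s * (i mod n s) = e s * (j mod n s)" unfolding cong_def mult_mod_right .
    then have "i = j" using AB e_pos[OF clusters_subset[OF s]] by simp
    then show "Ai = Bj" using AB \<open>A = B\<close> by simp
  qed
  moreover have "pt ` (orbs s \<times> {..<n s}) \<subseteq> \<X>"
    using pt T is_childD(1) clusters_subset by blast
  ultimately have "card (orbs s \<times> {..<n s}) \<le> card \<X>" using finite_X by (rule card_inj_on_le)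
  then show ?thesis by (simp add: card_cartesian_product mult.commute)
qed

text \<open>Labels of the children: powers of a primitive root, so that the \<open>n s\<close>-th powers of distinct
  labels stay incongruent modulo \<open>p\<close>.\<close>

definition L :: "'x set \<Rightarrow> 'x set \<Rightarrow> 'a" where
  "L s t = (if fixed_children s = {t} then 0 else of_nat (\<gamma> ^ num (orbs s) (orb t)))"

lemma \<gamma>_coprime: "coprime p \<gamma>" and ord_\<gamma>: "ord p \<gamma> = p - 1"
  using \<gamma> prime_p by (auto simp: residue_primroot_def totient_prime)

lemma L_nonorphan:
  assumes "fixed_children s \<noteq> {t}"
  shows "L s t \<noteq> 0" "v (L s t) = 0"
proof -
  have "\<not> p dvd \<gamma> ^ i" for i
    using \<gamma>_coprime prime_p by (metis coprime_absorb_left coprime_power_right_iff not_prime_unit)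
  then have np: "\<not> p dvd \<gamma> ^ num (orbs s) (orb t)" .
  then have "\<gamma> ^ num (orbs s) (orb t) > 0" by (intro Nat.gr0I) simp
  then have "of_nat (\<gamma> ^ num (orbs s) (orb t)) \<noteq> (0::'a)" by (rule char0)
  then show "L s t \<noteq> 0" "v (L s t) = 0"
    unfolding L_def if_not_P[OF assms] using v_of_nat[OF np] by blast+
qed

lemma L_in_K: "L s t \<in> K"
  using sub_ring_of_nat[OF sub_field_imp_sub_ring[OF K], of "\<gamma> ^ num (orbs s) (orb t)"]
    sub_ringD(2)[OF sub_field_imp_sub_ring[OF K]] by (auto simp: L_def simp del: of_nat_power)

section \<open>The roots attached to the points and their mutual distances\<close>

definition summand :: "'x set \<Rightarrow> 'x \<Rightarrow> 'a" where
  "summand s x = L s (ch s x) * \<theta> x powi nd s"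

definition r :: "'x \<Rightarrow> 'a" where
  "r x = (\<Sum>s\<in>{s\<in>\<Sigma>. card s > 1}. if x \<in> s then summand s x else 0)"

lemma vge_summand: "s \<in> \<Sigma> \<Longrightarrow> card s > 1 \<Longrightarrow> vge (d s) (summand s x)"
  using L_nonorphan[of s "ch s x"] v_\<theta>_nd[of s x] \<theta>_nonzero[of x]
  by (cases "fixed_children s = {ch s x}") (auto simp: summand_def L_def vge_def v_mult)

text \<open>Within a child the clock changes by a multiple of its period, and the period times
  \<open>d s\<close> is an integer, so the twist is trivial. For an orphan the label is
  zero.\<close>

lemma summand_same:
  assumes s: "s \<in> \<Sigma>" "card s > 1" and xy: "x \<in> s" "y \<in> s" "ch s x = ch s y"
  shows "summand s x = summand s y"
proof (cases "fixed_children s = {ch s x}")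
  case False
  let ?t = "ch s x"
  have t: "is_child \<Sigma> ?t s" "x \<in> ?t" "y \<in> ?t" using ch[OF s xy(1)] ch[OF s xy(2)] xy(3) by auto
  have "int (e ?t) dvd int (k y) - int (k x)" using clock_same is_childD(1) t by blast
  then obtain l where l: "int (k y) - int (k x) = int (e ?t) * l" by (auto elim: dvdE)
  have "of_nat (e ?t) * d s \<in> \<int>" using child_depth_int[OF s(1) t(1) False] .
  then have "of_int l * (of_nat (e ?t) * d s) \<in> \<int>" by simp
  then have "of_int (int (k y) - int (k x)) * d s \<in> \<int>" unfolding l by (simp add: mult_ac)
  then have "\<zeta> powi ((int (k y) - int (k x)) * nd s) = 1"
    using N_dvd_iff[OF s] powi_eq_1_iff[of \<zeta> N] \<zeta> by blast
  then show ?thesis unfolding summand_def using \<theta>_ratio[of y "nd s" x] xy(3) by simp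
qed (use xy in \<open>simp add: summand_def L_def\<close>)

text \<open>A small difference of integral elements would stay small after taking
  \<open>m\<close>-th powers.\<close>

lemma unit_difference:
  assumes u: "vge 0 a" "vge 0 b" and pow: "v (a ^ m - b ^ m) = 0" "a ^ m - b ^ m \<noteq> 0"
  shows "a - b \<noteq> 0 \<and> v (a - b) = 0"
proof -
  have "\<not> vgt 0 (a ^ m - b ^ m)" using pow by (simp add: vgt_def)
  then have "\<not> vgt 0 (a - b)" using vgt_power_diff[OF u] by blast
  moreover have "vge 0 (a - b)" using u by (rule vge_diff)
  ultimately show ?thesis by (auto simp: vge_def vgt_def)
qed

text \<open>After division by a power of \<open>\<theta> x\<close>, three cases remain. If one child
  is the orphan, a single unit is left. For children in the same orbit the labels agree and the
  twist \<open>\<eta>\<close> is a nontrivial root of unity. For different orbits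
  \<open>\<eta>\<close> is an \<open>n s\<close>-th root of unity, so taking \<open>n s\<close>-th
  powers removes it and leaves powers of the primitive root that are incongruent modulo
  \<open>p\<close>.\<close>

lemma summand_distinct:
  assumes s: "s \<in> \<Sigma>" "card s > 1" and xy: "x \<in> s" "y \<in> s" "ch s x \<noteq> ch s y"
  shows "summand s x - summand s y \<noteq> 0 \<and> v (summand s x - summand s y) = d s"
proof -
  let ?t = "ch s x" and ?t' = "ch s y"
  have t: "is_child \<Sigma> ?t s" "x \<in> ?t" using ch[OF s xy(1)] by auto
  have t': "is_child \<Sigma> ?t' s" "y \<in> ?t'" using ch[OF s xy(2)] by auto
  define \<eta> where "\<eta> = \<zeta> powi ((int (k y) - int (k x)) * nd s)"
  have diff: "summand s x - summand s y = (L s ?t - L s ?t' * \<eta>) * \<theta> x powi nd s"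
    unfolding summand_def \<theta>_ratio[of y "nd s" x] \<eta>_def by (simp add: algebra_simps)
  have \<eta>: "\<eta> \<noteq> 0" "v \<eta> = 0" using \<zeta>_unit by (auto simp: \<eta>_def v_powi)
  have "L s ?t - L s ?t' * \<eta> \<noteq> 0 \<and> v (L s ?t - L s ?t' * \<eta>) = 0"
  proof (cases "fixed_children s = {?t} \<or> fixed_children s = {?t'}")
    case True
    then show ?thesis
    proof
      assume o': "fixed_children s = {?t}"
      then have "fixed_children s \<noteq> {?t'}" using xy by auto
      then show ?thesis using L_nonorphan[of s ?t'] \<eta> o' by (simp add: L_def[of s ?t] v_mult)
    next
      assume o': "fixed_children s = {?t'}"
      then have "fixed_children s \<noteq> {?t}" using xy by auto
      then show ?thesis using L_nonorphan[of s ?t] o' by (simp add: L_def[of s ?t'])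
    qed
  next
    case False
    then have no: "fixed_children s \<noteq> {?t}" "fixed_children s \<noteq> {?t'}" by auto
    define i where "i = num (orbs s) (orb ?t)"
    define j where "j = num (orbs s) (orb ?t')"
    have Li: "L s ?t = of_nat (\<gamma> ^ i)" "L s ?t' = of_nat (\<gamma> ^ j)" using no by (auto simp: L_def i_def j_def)
    have memb: "orb ?t \<in> orbs s" "orb ?t' \<in> orbs s" using t t' no by (auto simp: orbs_def)
    have unit: "vge 0 (L s ?t)" "vge 0 (L s ?t' * \<eta>)"
      using L_nonorphan no \<eta> by (auto simp: vge_def v_mult)
    have \<eta>n: "\<eta> ^ n s = 1"
    proof -
      have "int (e s) dvd int (k y) - int (k x)" using clock_same[OF s(1) xy(1,2)] .
      then obtain l where l: "int (k y) - int (k x) = int (e s) * l" by (auto elim: dvdE)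
      have "of_nat (e s * n s) * d s \<in> \<int>" using child_depth_int[OF s(1) t(1) no(1)] e_child[OF s(1) t(1) no(1)] by simp
      then have "of_int l * (of_nat (e s * n s) * d s) \<in> \<int>" by simp
      then have "of_int ((int (k y) - int (k x)) * int (n s)) * d s \<in> \<int>" unfolding l by (simp add: mult_ac)
      then have "int N dvd ((int (k y) - int (k x)) * int (n s)) * nd s" using N_dvd_iff[OF s] by blast
      then have "\<zeta> powi (((int (k y) - int (k x)) * int (n s)) * nd s) = 1" using powi_eq_1_iff[of \<zeta> N] \<zeta> by blast
      moreover have "\<eta> powi int (n s) = \<zeta> powi (((int (k y) - int (k x)) * int (n s)) * nd s)"
        unfolding \<eta>_def power_int_mult[symmetric] by (simp only: mult_ac)
      ultimately show ?thesis by (simp only: power_int_of_nat)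
    qed
    show ?thesis
    proof (cases "i = j")
      case True
      then have "orb ?t = orb ?t'"
        using memb bij_betw_imp_inj_on[OF num[of s]] by (simp add: i_def j_def inj_on_def)
      then have "?t' \<in> orb ?t" using orb_self by simp
      then obtain q where q: "?t' = (c ^^ q) ` ?t" by (auto simp: orb_def)
      have "is_child \<Sigma> ?t' ((c ^^ q) ` s)" using image_child[OF t(1) s(1), of q] q by simp
      then have "(c ^^ q) ` s = s" using parent_unique[OF _ t'(1) image_cluster[OF s(1)] s(1)] by blast
      then have "e s dvd q" using fixed_iff[OF clusters_subset[OF s(1)]] by simp
      then obtain l where l: "q = e s * l" by (auto elim: dvdE)
      have tX: "?t \<subseteq> \<X>" using t is_childD(1) clusters_subset by blast
      have xX: "x \<in> \<X>" using tX t by blast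
      have et: "e ?t' = e ?t" using e_image[OF tX] q by simp
      \<comment> \<open>The clocks of \<open>y\<close> and \<open>x\<close> differ by
        \<open>q\<close> up to a multiple of the period of the child. A trivial twist would make
        \<open>q * d s\<close> an integer; then the period of the child would divide
        \<open>q\<close>, and \<open>c ^^ q\<close> would fix the child instead of moving it to
        \<open>?t'\<close>.\<close>
      have "\<eta> \<noteq> 1"
      proof
        assume "\<eta> = 1"
        then have "of_int (int (k y) - int (k x)) * d s \<in> \<int>"
          unfolding \<eta>_def using powi_eq_1_iff[of \<zeta> N] \<zeta> N_dvd_iff[OF s] by blast
        moreover have "int (e ?t) dvd int (k y) - int (k x) - int q"
        proof -
          have 1: "int (e ?t) dvd int (k y) - int (k ((c ^^ q) x))"
            using clock_same[OF is_childD(1)[OF t'(1)], of "(c ^^ q) x" y] t t' q et by auto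
          have "[int (k ((c ^^ q) x)) = int (k x + q)] (mod int (e {x}))"
            using clock_power[OF xX, of q] by (simp only: cong_int_iff)
          then have "int (e {x}) dvd int (k ((c ^^ q) x)) - int (k x + q)" by (simp only: cong_iff_dvd_diff)
          moreover have "int (e ?t) dvd int (e {x})"
            using e_dvd_point[OF is_childD(1)[OF t(1)] t(2)] by simp
          ultimately have "int (e ?t) dvd int (k ((c ^^ q) x)) - int (k x + q)" by (rule dvd_trans[rotated])
          from dvd_add[OF 1 this] show ?thesis by (simp add: algebra_simps)
        qed
        then obtain l' where l': "int (k y) - int (k x) - int q = int (e ?t) * l'" by (auto elim: dvdE)
        have "of_int l' * (of_nat (e ?t) * d s) \<in> \<int>" using child_depth_int[OF s(1) t(1) no(1)] by simp
        ultimately have "of_int (int (k y) - int (k x)) * d s - of_int l' * (of_nat (e ?t) * d s) \<in> \<int>"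
          by (rule Ints_diff)
        moreover have "of_int (int (k y) - int (k x)) * d s - of_int l' * (of_nat (e ?t) * d s) = of_nat q * d s"
        proof -
          have "int (k y) - int (k x) = int q + int (e ?t) * l'" using l' by simp
          have "of_int (int (k y) - int (k x)) * d s = of_int (int q + int (e ?t) * l') * d s"
            by (simp only: \<open>int (k y) - int (k x) = int q + int (e ?t) * l'\<close>)
          also have "\<dots> = of_nat q * d s + of_int l' * (of_nat (e ?t) * d s)"
            by (simp add: algebra_simps)
          finally show ?thesis by (simp only: add_diff_cancel_right')
        qed
        ultimately have "of_nat l * (d s * of_nat (e s)) \<in> \<int>" unfolding l by (simp add: mult_ac)
        then have "n s dvd l" unfolding n_def denom_dvd_iff .
        then have "e ?t dvd q" unfolding l e_child[OF s(1) t(1) no(1)] by simp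
        then have "(c ^^ q) ` ?t = ?t" using fixed_iff[OF tX] by simp
        then show False using q xy by simp
      qed
      moreover have "\<eta> ^ N = 1"
      proof -
        have "n s dvd N" using e_dvd_N[OF is_childD(1)[OF t(1)]] e_child[OF s(1) t(1) no(1)] by (metis dvd_mult_right)
        then obtain l where "N = n s * l" by (auto elim: dvdE)
        then show ?thesis using \<eta>n by (simp add: power_mult)
      qed
      ultimately have v1: "v (\<eta> - 1) = 0" "\<eta> - 1 \<noteq> 0" using root_of_unity_separated p_N by auto
      have "L s ?t - L s ?t' * \<eta> = - (L s ?t * (\<eta> - 1))" using Li True by (simp add: algebra_simps)
      then show ?thesis using v1 L_nonorphan[OF no(1)] by (simp add: v_mult)
    next
      case False
      \<comment> \<open>By \<open>card_orbs\<close> the exponents \<open>n s * i\<close> and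
        \<open>n s * j\<close> stay below \<open>p - 1\<close>, the order of \<gamma>, so distinct
        exponents give incongruent powers.\<close>
      have bound: "n s * i < p - 1 \<and> n s * j < p - 1"
      proof -
        have "i < card (orbs s)" "j < card (orbs s)"
          using memb bij_betwE[OF num[of s]] by (auto simp: i_def j_def)
        moreover have "n s > 0" using denom_pos by (simp add: n_def)
        ultimately have "n s * i < n s * card (orbs s)" "n s * j < n s * card (orbs s)"
          by (simp_all only: mult_strict_left_mono)
        moreover have "n s * card (orbs s) \<le> p - 1" using card_orbs[OF s(1)] card_p by linarith
        ultimately show ?thesis by linarith
      qed
      have "\<not> [\<gamma> ^ (n s * i) = \<gamma> ^ (n s * j)] (mod p)"
      proof
        assume "[\<gamma> ^ (n s * i) = \<gamma> ^ (n s * j)] (mod p)"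
        then have "[n s * i = n s * j] (mod p - 1)" using order_divides_expdiff[OF \<gamma>_coprime] ord_\<gamma> by simp
        then have "n s * i = n s * j" using bound by (simp add: cong_def)
        then show False using False denom_pos[of "d s * of_nat (e s)"] by (simp add: n_def)
      qed
      then have np: "\<not> int p dvd int (\<gamma> ^ (n s * i)) - int (\<gamma> ^ (n s * j))"
        by (metis cong_iff_dvd_diff cong_int_iff)
      have pow: "(L s ?t) ^ n s - (L s ?t' * \<eta>) ^ n s = of_int (int (\<gamma> ^ (n s * i)) - int (\<gamma> ^ (n s * j)))"
        unfolding Li by (simp add: power_mult_distrib \<eta>n power_mult[symmetric] mult.commute)
      show ?thesis
        by (rule unit_difference[OF unit, of "n s"]) (use v_of_int[OF np] pow in simp_all)
    qed
  qed
  then show ?thesis unfolding diff using \<theta>_nonzero[of x] v_\<theta>_nd[OF s] by (simp add: v_mult)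
qed

text \<open>The smallest cluster containing both points has them in different children.\<close>

lemma meet_exists:
  assumes xy: "x \<in> \<X>" "y \<in> \<X>" "x \<noteq> y"
  obtains s where "s \<in> \<Sigma>" "card s > 1" "x \<in> s" "y \<in> s" "ch s x \<noteq> ch s y"
proof -
  let ?A = "{s\<in>\<Sigma>. x \<in> s \<and> y \<in> s}"
  have "finite ?A" "\<X> \<in> ?A" using finite_clusters X_cluster xy by auto
  then obtain s where s: "s \<in> ?A" "\<forall>u\<in>?A. u \<subseteq> s \<longrightarrow> s = u"
    using finite_has_minimal2 by (metis (no_types, lifting))
  then have s': "s \<in> \<Sigma>" "x \<in> s" "y \<in> s" by auto
  have card: "card s > 1" using card_mono[OF finite_cluster[OF s'(1)], of "{x, y}"] s' xy by auto
  have "ch s x \<noteq> ch s y"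
  proof
    assume eq: "ch s x = ch s y"
    have "is_child \<Sigma> (ch s x) s" "x \<in> ch s x" "y \<in> ch s x"
      using ch[OF s'(1) card s'(2)] ch[OF s'(1) card s'(3)] eq by auto
    then have "ch s x \<in> ?A" "ch s x \<subset> s" using is_childD by auto
    moreover from this have "ch s x \<subseteq> s \<longrightarrow> s = ch s x" by (intro bspec[OF s(2)])
    ultimately show False by blast
  qed
  then show ?thesis using that s' card by blast
qed

text \<open>The summand of \<open>s\<close> dominates: clusters above \<open>s\<close> contribute
  equally to both points, clusters strictly inside \<open>s\<close> contribute values above
  \<open>d s\<close>, and disjoint ones nothing.\<close>

lemma v_r_diff:
  assumes s: "s \<in> \<Sigma>" "card s > 1" and xy: "x \<in> s" "y \<in> s" "ch s x \<noteq> ch s y"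
  shows "r x - r y \<noteq> 0 \<and> v (r x - r y) = d s"
proof -
  let ?S = "{s\<in>\<Sigma>. card s > 1}"
  let ?f = "\<lambda>u. (if x \<in> u then summand u x else 0) - (if y \<in> u then summand u y else 0)"
  have fs: "?f s = summand s x - summand s y" using xy by simp
  have other: "vgt (v (?f s)) (?f u)" if u: "u \<in> ?S" "u \<noteq> s" for u
  proof -
    have ds: "v (?f s) = d s" using summand_distinct[OF s xy] fs by simp
    have uS: "u \<in> \<Sigma>" "card u > 1" using u by auto
    consider "x \<notin> u" "y \<notin> u" | "x \<in> u \<or> y \<in> u" "u \<subset> s" | "s \<subset> u"
      using disjoint_or_nested[OF uS(1) s(1)] xy u(2) by blast
    then show ?thesis
    proof cases
      case 2
      then have "d s < d u" using depth_less s uS by blast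
      then have "vgt (d s) (summand u w)" for w using vge_summand[OF uS] vge_imp_vgt by blast
      then show ?thesis unfolding ds using vgt_diff by auto
    next
      case 3
      then obtain t where t: "is_child \<Sigma> t u" "s \<subseteq> t" using child_exists[OF s(1) uS(1)] by blast
      then have "ch u x = t" "ch u y = t" using ch_eq[OF t(1)] xy by blast+
      then have "ch u x = ch u y" by simp
      then have "summand u x = summand u y" using summand_same[OF uS] 3 xy by blast
      then show ?thesis using 3 xy by auto
    qed simp
  qed
  have sS: "s \<in> ?S" using s by simp
  have "r x - r y = (\<Sum>u\<in>?S. ?f u)" by (simp only: r_def sum_subtractf)
  moreover have "?f s \<noteq> 0" "v (?f s) = d s" using summand_distinct[OF s xy] fs by simp_all
  moreover have "finite ?S" using finite_clusters by simp
  ultimately show ?thesis using dominant_sum[of ?S s ?f, OF _ sS _ other] by simp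
qed

lemma r_picture: "root_picture \<X> \<Sigma> d v r"
proof unfold_locales
  show inj: "inj_on r \<X>"
  proof (rule inj_onI, rule ccontr)
    fix x y assume xy: "x \<in> \<X>" "y \<in> \<X>" "r x = r y" "x \<noteq> y"
    obtain s where "s \<in> \<Sigma>" "card s > 1" "x \<in> s" "y \<in> s" "ch s x \<noteq> ch s y"
      using meet_exists[OF xy(1,2,4)] .
    then show False using v_r_diff xy(3) by fastforce
  qed
  have le: "d s \<le> v (r x - r y)" if s: "s \<in> \<Sigma>" and x: "x \<in> s" "y \<in> s" "x \<noteq> y" for s x y
  proof -
    have xX: "x \<in> \<X>" "y \<in> \<X>" using clusters_subset[OF s] x by auto
    obtain u where u: "u \<in> \<Sigma>" "card u > 1" "x \<in> u" "y \<in> u" "ch u x \<noteq> ch u y" using meet_exists[OF xX x(3)] .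
    have "u \<subseteq> s"
    proof (rule ccontr)
      assume "\<not> u \<subseteq> s"
      then have "s \<subset> u" using disjoint_or_nested[OF u(1) s] u x by blast
      then obtain t where "is_child \<Sigma> t u" "s \<subseteq> t" using child_exists[OF s u(1)] by blast
      then have "ch u x = t" "ch u y = t" using ch_eq x by blast+
      then show False using u by simp
    qed
    then have "u = s \<or> u \<subset> s" by blast
    then have "d s \<le> d u" using depth_less[OF s u(1,2)] by (metis order_le_less)
    then show ?thesis using v_r_diff[OF u] by simp
  qed
  then show "\<And>s x y. s \<in> \<Sigma> \<Longrightarrow> x \<in> s \<Longrightarrow> y \<in> s \<Longrightarrow> x \<noteq> y \<Longrightarrow> d s \<le> v (r x - r y)" .
  have attained: "\<exists>y\<in>s. x \<noteq> y \<and> v (r x - r y) = d s" if s: "s \<in> \<Sigma>" "card s > 1" and x: "x \<in> s" for s x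
  proof -
    obtain y where y: "y \<in> s" "y \<notin> ch s x" using is_childD(2)[OF ch(1)[OF s x]] by blast
    have "ch s x \<noteq> ch s y" using ch(2)[OF s y(1)] y(2) by auto
    then have "v (r x - r y) = d s" using v_r_diff[OF s x y(1)] by blast
    moreover have "x \<noteq> y" using ch(2)[OF s x] y by auto
    ultimately show ?thesis using y by blast
  qed
  show "\<exists>x\<in>s. \<exists>y\<in>s. x \<noteq> y \<and> v (r x - r y) = d s" if s: "s \<in> \<Sigma>" "card s > 1" for s
    using attained[OF s] clusters_nonempty[OF s(1)] by blast
  have r_eq: "r x - r y = 0 \<longleftrightarrow> x = y" if "x \<in> \<X>" "y \<in> \<X>" for x y using inj that by (auto dest: inj_onD)
  fix s show "s \<in> \<Sigma> \<longleftrightarrow> (\<exists>t\<in>\<X>. \<exists>q. s = {x\<in>\<X>. vge q (r x - r t)})"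
  proof
    assume s: "s \<in> \<Sigma>"
    obtain t where t: "t \<in> s" using clusters_nonempty s by blast
    have sX: "s \<subseteq> \<X>" using clusters_subset s .
    show "\<exists>t\<in>\<X>. \<exists>q. s = {x\<in>\<X>. vge q (r x - r t)}"
    proof (cases "card s > 1")
      case True
      have "s = {x\<in>\<X>. vge (d s) (r x - r t)}"
      proof (intro equalityI subsetI)
        fix x assume "x \<in> s"
        then show "x \<in> {x\<in>\<X>. vge (d s) (r x - r t)}"
          using le[OF s, of x t] t sX by (cases "x = t") (auto simp: vge_def)
      next
        fix x assume x: "x \<in> {x\<in>\<X>. vge (d s) (r x - r t)}"
        show "x \<in> s"
        proof (cases "x = t")
          case False
          have xX: "x \<in> \<X>" "t \<in> \<X>" using x t sX by auto
          obtain u where u: "u \<in> \<Sigma>" "card u > 1" "x \<in> u" "t \<in> u" "ch u x \<noteq> ch u t" using meet_exists[OF xX False] .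
          have "d s \<le> d u" using x v_r_diff[OF u] by (auto simp: vge_def)
          then have "\<not> s \<subset> u" using depth_less[OF u(1) s True] by auto
          then show ?thesis using disjoint_or_nested[OF u(1) s] u t by blast
        qed (use t in simp)
      qed
      then show ?thesis using t sX by blast
    next
      case False
      then have st: "s = {t}" using t finite_cluster[OF s] by (metis card_le_Suc0_iff_eq One_nat_def not_less singleton_iff subsetI subset_antisym)
      \<comment> \<open>A radius beyond all distances from \<open>t\<close>, so that the disc
        contains \<open>t\<close> alone.\<close>
      define q where "q = Max (insert 0 ((\<lambda>x. v (r x - r t)) ` \<X>)) + 1"
      have "\<not> vge q (r x - r t)" if "x \<in> \<X>" "x \<noteq> t" for x
      proof -
        have "v (r x - r t) \<le> Max (insert 0 ((\<lambda>x. v (r x - r t)) ` \<X>))" using finite_X that by (intro Max_ge) auto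
        moreover have "r x - r t \<noteq> 0" using r_eq[OF that(1), of t] that t sX by blast
        ultimately show ?thesis by (simp add: vge_def q_def)
      qed
      then have "s = {x\<in>\<X>. vge q (r x - r t)}" unfolding st using t sX by auto
      then show ?thesis using t sX by blast
    qed
  next
    assume "\<exists>t\<in>\<X>. \<exists>q. s = {x\<in>\<X>. vge q (r x - r t)}"
    then obtain t q where t: "t \<in> \<X>" "s = {x\<in>\<X>. vge q (r x - r t)}" by blast
    have ts: "t \<in> s" using t by simp
    show "s \<in> \<Sigma>"
    proof (cases "s = {t}")
      case False
      \<comment> \<open>The disc of radius \<open>q\<close> around \<open>t\<close> is the largest
        cluster through \<open>t\<close> of depth at least \<open>q\<close>.\<close>
      let ?A = "{u\<in>\<Sigma>. card u > 1 \<and> t \<in> u \<and> q \<le> d u}"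
      have inA: "\<exists>u\<in>?A. x \<in> u" if x: "x \<in> s" "x \<noteq> t" for x
      proof -
        have xX: "x \<in> \<X>" using x t by blast
        obtain u where u: "u \<in> \<Sigma>" "card u > 1" "x \<in> u" "t \<in> u" "ch u x \<noteq> ch u t" using meet_exists[OF xX t(1) x(2)] .
        have "q \<le> d u" using x t v_r_diff[OF u] by (auto simp: vge_def)
        then show ?thesis using u by blast
      qed
      obtain x where "x \<in> s" "x \<noteq> t" using False ts by blast
      then obtain u0 where "u0 \<in> ?A" using inA by blast
      moreover have "finite ?A" using finite_clusters by simp
      ultimately obtain u where u: "u \<in> ?A" "\<forall>w\<in>?A. u \<subseteq> w \<longrightarrow> u = w"
        using finite_has_maximal2 by (metis (no_types, lifting))
      have "s = u"
      proof (intro equalityI subsetI)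
        fix x assume x: "x \<in> s"
        show "x \<in> u"
        proof (cases "x = t")
          case False
          then obtain w where w: "w \<in> ?A" "x \<in> w" using inA x by blast
          have "u \<subseteq> w \<or> w \<subseteq> u" using disjoint_or_nested[of u w] u w by blast
          then show ?thesis using u w by blast
        qed (use u in simp)
      next
        fix x assume x: "x \<in> u"
        then have "q \<le> v (r x - r t)" if "x \<noteq> t" using le[of u x t] that u by force
        moreover have "x \<in> \<X>" using x u clusters_subset by blast
        ultimately show "x \<in> s" unfolding t(2) by (auto simp: vge_def)
      qed
      then show ?thesis using u by simp
    qed (use singletons t in simp)
  qed
qed

text \<open>Applying \<open>c\<close> permutes the clusters around \<open>x\<close> while depths and
  labels stay the same, so along the orbit only the root of \<open>\<pi>\<close> varies. The power
  \<open>N / D\<close> of \<open>\<theta>\<close> suffices for orbit length \<open>D\<close>,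
  because \<open>D * d s\<close> is an integer whenever the label of \<open>s\<close> at
  \<open>x\<close> is nonzero.\<close>

lemma r_orbit_polynomial:
  assumes x: "x \<in> \<X>"
  shows "\<exists>Q. cf K Q \<and> (\<forall>i. \<exists>\<rho>. \<rho> ^ e {x} = \<pi> \<and> r ((c ^^ i) x) = poly Q \<rho>)"
proof -
  define D where "D = e {x}"
  have D: "D > 0" unfolding D_def using e_pos[of "{x}"] x by simp
  have "D dvd N" unfolding D_def using e_dvd_N singletons x by blast
  then obtain M where M: "N = D * M" by (auto elim: dvdE)
  let ?S = "{s\<in>\<Sigma>. card s > 1}"
  define q where "q = (\<lambda>s. \<lfloor>of_nat D * d s\<rfloor>)"
  \<comment> \<open>The exponent \<open>D * d s\<close> may be negative or exceed \<open>D\<close>;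
    its quotient by \<open>D\<close> goes into the coefficient as a power of \<open>\<pi>\<close>,
    leaving a monomial over \<open>K\<close>. Where the floor in \<open>q\<close> is not exact, the
    label is zero.\<close>
  define Q where "Q = (\<Sum>s\<in>?S. if x \<in> s then monom (L s (ch s x) * \<pi> powi (q s div int D)) (nat (q s mod int D)) else 0)"
  have Kr: "sub_ring K" using K by (simp add: sub_field_def)
  have cfQ: "cf K Q"
    unfolding Q_def
  proof (rule cf_sum[OF Kr])
    fix s
    show "cf K (if x \<in> s then monom (L s (ch s x) * \<pi> powi (q s div int D)) (nat (q s mod int D)) else 0)"
      using cf_monom[OF Kr] sub_ringD(4)[OF Kr L_in_K sub_field_powi[OF K \<pi>(1)]] cf_0[OF Kr] by simp
  qed
  have bij: "(\<lambda>s. (c ^^ i) ` s) ` ?S = ?S" "inj_on (\<lambda>s. (c ^^ i) ` s) ?S" for i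
  proof -
    show inj: "inj_on (\<lambda>s. (c ^^ i) ` s) ?S"
    proof (rule inj_onI)
      fix s t assume st: "s \<in> ?S" "t \<in> ?S" "(c ^^ i) ` s = (c ^^ i) ` t"
      then have "s \<subseteq> \<X>" "t \<subseteq> \<X>" using clusters_subset by auto
      then show "s = t" using inj_on_image_eq_iff[OF bij_betw_imp_inj_on[OF funpow_bij]] st(3) by blast
    qed
    have "(\<lambda>s. (c ^^ i) ` s) ` ?S \<subseteq> ?S" using image_cluster card_image_cluster by auto
    then show "(\<lambda>s. (c ^^ i) ` s) ` ?S = ?S" using inj finite_clusters by (intro endo_inj_surj) auto
  qed
  have "\<exists>\<rho>. \<rho> ^ D = \<pi> \<and> r ((c ^^ i) x) = poly Q \<rho>" for i
  proof -
    let ?y = "(c ^^ i) x"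
    define \<rho> where "\<rho> = \<theta> ?y ^ M"
    have \<rho>: "\<rho> ^ D = \<pi>" using \<theta>_power[of ?y] M by (simp add: \<rho>_def power_mult[symmetric] mult.commute)
    have \<rho>0: "\<rho> \<noteq> 0" using \<theta>_nonzero by (simp add: \<rho>_def)
    have mem: "?y \<in> (c ^^ i) ` s \<longleftrightarrow> x \<in> s" if "s \<in> ?S" for s
      using inj_on_image_mem_iff[OF bij_betw_imp_inj_on[OF funpow_bij] x] clusters_subset that by blast
    have "r ?y = (\<Sum>s\<in>(\<lambda>s. (c ^^ i) ` s) ` ?S. if ?y \<in> s then summand s ?y else 0)" unfolding r_def bij(1) ..
    also have "\<dots> = (\<Sum>s\<in>?S. if ?y \<in> (c ^^ i) ` s then summand ((c ^^ i) ` s) ?y else 0)"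
      using sum.reindex[OF bij(2)] by (simp add: o_def)
    also have "\<dots> = (\<Sum>s\<in>?S. if x \<in> s then L s (ch s x) * \<rho> powi q s else 0)"
    proof (rule sum.cong)
      fix s assume s: "s \<in> ?S"
      show "(if ?y \<in> (c ^^ i) ` s then summand ((c ^^ i) ` s) ?y else 0) = (if x \<in> s then L s (ch s x) * \<rho> powi q s else 0)"
      proof (cases "x \<in> s")
        case True
        have sS: "s \<in> \<Sigma>" "card s > 1" using s by auto
        let ?t = "ch s x"
        have t: "is_child \<Sigma> ?t s" "x \<in> ?t" using ch[OF sS True] by auto
        have tX: "?t \<subseteq> \<X>" using t is_childD(1) clusters_subset by blast
        have nd': "nd ((c ^^ i) ` s) = nd s" using depth_image[OF sS] by (simp add: nd_def)
        have L': "L ((c ^^ i) ` s) ((c ^^ i) ` ?t) = L s ?t"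
          using fixed_children_image[OF sS(1) t(1)] orbs_image[OF sS(1)] orb_image[OF tX] by (simp add: L_def)
        have tm: "summand ((c ^^ i) ` s) ?y = L s ?t * \<theta> ?y powi nd s"
          unfolding summand_def ch_image[OF sS True] L' nd' ..
        have "L s ?t * \<theta> ?y powi nd s = L s ?t * \<rho> powi q s"
        proof (cases "fixed_children s = {?t}")
          case False
          have "of_nat D * d s \<in> \<int>" unfolding D_def
            by (rule multiple_int[OF child_depth_int[OF sS(1) t(1) False] e_dvd_point[OF is_childD(1)[OF t(1)] t(2)]])
          then have "of_int (q s) = of_nat D * d s" by (simp add: q_def)
          then have "of_int (nd s) = (of_int (int M * q s) :: rat)" using nd[OF sS] M by (simp add: mult_ac)
          then have "nd s = int M * q s" by (simp only: of_int_eq_iff)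
          then show ?thesis by (simp add: \<rho>_def power_int_mult)
        qed (simp add: L_def)
        then show ?thesis using True mem[OF s] tm by simp
      qed (use mem[OF s] in simp)
    qed simp
    also have "\<dots> = poly Q \<rho>"
      unfolding Q_def poly_sum
    proof (rule sum.cong)
      fix s
      have "\<rho> powi q s = \<rho> powi (int D * (q s div int D) + q s mod int D)" by simp
      also have "\<dots> = \<rho> powi (int D * (q s div int D)) * \<rho> powi (q s mod int D)"
        using \<rho>0 by (intro power_int_add) simp
      also have "\<dots> = \<pi> powi (q s div int D) * \<rho> ^ nat (q s mod int D)"
        using \<rho> D by (simp add: power_int_mult power_int_def[of \<rho> "q s mod int D"])
      finally show "(if x \<in> s then L s (ch s x) * \<rho> powi q s else 0)
        = poly (if x \<in> s then monom (L s (ch s x) * \<pi> powi (q s div int D)) (nat (q s mod int D)) else 0) \<rho>"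
        by (simp add: poly_monom mult.assoc)
    qed simp
    finally show ?thesis using \<rho> by blast
  qed
  then show ?thesis using cfQ unfolding D_def by blast
qed

text \<open>One factor per orbit, of degree at most the orbit length. The degree bound is the point:
  a nonzero polynomial of degree at most \<open>card \<X>\<close> vanishing at that many distinct
  elements has no further and no multiple roots.\<close>

lemma invariant_polynomial:
  assumes "Y \<subseteq> \<X>" "\<And>i y. y \<in> Y \<Longrightarrow> (c ^^ i) y \<in> Y"
  shows "\<exists>F. cf K F \<and> F \<noteq> 0 \<and> degree F \<le> card Y \<and> (\<forall>y\<in>Y. poly F (r y) = 0)"
  using assms
proof (induction "card Y" arbitrary: Y rule: less_induct)
  case less
  have Kr: "sub_ring K" using K by (simp add: sub_field_def)
  have finY: "finite Y" using less.prems finite_X finite_subset by blast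
  show ?case
  proof (cases "Y = {}")
    case True
    then show ?thesis using cf_1[OF Kr] by (intro exI[of _ 1]) auto
  next
    case False
    then obtain x where x: "x \<in> Y" by blast
    then have xX: "x \<in> \<X>" using less.prems by blast
    define O' where "O' = range (\<lambda>i. (c ^^ i) x)"
    have O'Y: "O' \<subseteq> Y" using less.prems(2) x by (auto simp: O'_def)
    have cardO: "e {x} \<le> card O'"
    proof -
      have "inj_on (\<lambda>i. (c ^^ i) x) {..<e {x}}"
        by (rule inj_onI) (use point_cong[OF xX] in \<open>auto simp: cong_def\<close>)
      then have "card {..<e {x}} \<le> card O'"
        by (rule card_inj_on_le) (use O'Y finY finite_subset in \<open>auto simp: O'_def\<close>)
      then show ?thesis by simp
    qed
    have ex: "e {x} > 0" using e_pos[of "{x}"] xX by simp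
    obtain Q where Q: "cf K Q" "\<And>i. \<exists>\<rho>. \<rho> ^ e {x} = \<pi> \<and> r ((c ^^ i) x) = poly Q \<rho>"
      using r_orbit_polynomial[OF xX] by blast
    obtain m where m: "cf K m" "m \<noteq> 0" "degree m \<le> e {x}" "\<And>\<rho>. \<rho> ^ e {x} = \<pi> \<Longrightarrow> poly m (poly Q \<rho>) = 0"
      using relation_of_degree[OF K Q(1) \<pi>(1) ex] by blast
    have mO: "poly m (r y) = 0" if y: "y \<in> O'" for y
    proof -
      obtain i where "y = (c ^^ i) x" using y by (auto simp: O'_def)
      then obtain \<rho> where "\<rho> ^ e {x} = \<pi>" "r y = poly Q \<rho>" using Q(2)[of i] by blast
      then show ?thesis using m(4) by simp
    qed
    have cardYO: "card (Y - O') + card O' = card Y"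
      using O'Y finY by (metis add.commute card_Diff_subset card_mono finite_subset le_add_diff_inverse2 add_diff_inverse_nat not_less)
    have inv: "(c ^^ i) y \<in> Y - O'" if y: "y \<in> Y - O'" for i y
    proof
      show "(c ^^ i) y \<in> Y" using less.prems(2) y by blast
      show "(c ^^ i) y \<notin> O'"
      proof
        assume "(c ^^ i) y \<in> O'"
        then obtain j where j: "(c ^^ i) y = (c ^^ j) x" by (auto simp: O'_def)
        obtain l where l: "\<forall>x\<in>\<X>. (c ^^ l) ((c ^^ i) x) = x \<and> (c ^^ i) ((c ^^ l) x) = x" using inverse_power by blast
        have "y \<in> \<X>" using y less.prems by blast
        then have "y = (c ^^ l) ((c ^^ j) x)" using l j by metis
        then have "y = (c ^^ (l + j)) x" by (simp add: funpow_add)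
        then show False using y by (auto simp: O'_def)
      qed
    qed
    have "card (Y - O') < card Y" using cardYO cardO ex by linarith
    then have "\<exists>F. cf K F \<and> F \<noteq> 0 \<and> degree F \<le> card (Y - O') \<and> (\<forall>y\<in>Y - O'. poly F (r y) = 0)"
      using less.hyps[of "Y - O'"] less.prems(1) inv by blast
    then obtain F where F: "cf K F" "F \<noteq> 0" "degree F \<le> card (Y - O')" "\<forall>y\<in>Y - O'. poly F (r y) = 0" by blast
    have "degree (F * m) \<le> card Y" using F m cardO cardYO by (simp add: degree_mult_eq)
    moreover have "\<forall>y\<in>Y. poly (F * m) (r y) = 0" using F(4) mO by auto
    moreover have "cf K (F * m)" "F * m \<noteq> 0" using F m cf_mult[OF Kr] by auto
    ultimately show ?thesis by blast
  qed
qed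

end

theorem tame_imp_polynomial_type:
  fixes v :: "'k::field alg_closure \<Rightarrow> rat"
  assumes lc: "local_closure v (range to_ac) p" and cp: "cluster_perm \<X> \<Sigma> d c"
    and tame: "cluster_perm.tame \<Sigma> d c" and p: "card \<X> < p"
  shows "polynomial_type v \<X> \<Sigma> d"
proof -
  interpret local_closure v "range to_ac" p by (rule lc)
  interpret cluster_perm \<X> \<Sigma> d c by (rule cp)
  have "(1::rat) \<in> v ` (range to_ac - {0})" using v_K by simp
  then obtain \<pi> where "1 = v \<pi>" "\<pi> \<in> range to_ac - {0}" by (rule imageE)
  then have \<pi>: "\<pi> \<in> range to_ac" "\<pi> \<noteq> 0" "v \<pi> = 1" by auto
  have Npos: "(fact (p - 1) :: nat) > 0" by simp
  obtain \<omega> where \<omega>: "\<omega> ^ fact (p - 1) = \<pi>" using nth_root_exists[OF Npos] by blast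
  obtain \<zeta> :: "'k alg_closure" where \<zeta>: "\<And>j. \<zeta> ^ j = 1 \<longleftrightarrow> fact (p - 1) dvd j"
    using primitive_root_of_unity[OF char0 Npos] by blast
  obtain k where k: "clock_on \<X> k" using clock_exists by blast
  obtain \<gamma> where \<gamma>: "residue_primroot p \<gamma>" using prime_primitive_root_exists[of p] prime_p prime_gt_1_nat by blast
  interpret tame_cluster \<X> \<Sigma> d c v "range to_ac" p \<pi> \<omega> \<zeta> k \<gamma> "fact (p - 1)"
    by unfold_locales (use tame p \<pi> \<omega> \<zeta> k \<gamma> in auto)
  interpret rp: root_picture \<X> \<Sigma> d v r by (rule r_picture)
  obtain F where F: "cf (range to_ac) F" "F \<noteq> 0" "degree F \<le> card \<X>" "\<forall>y\<in>\<X>. poly F (r y) = 0"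
    using invariant_polynomial[OF order_refl funpow_in] by blast
  obtain f where f: "F = map_poly to_ac f" using F(1) cf_range_to_ac by blast
  have sub: "r ` \<X> \<subseteq> {x. poly F x = 0}" using F(4) by auto
  have fin: "finite {x. poly F x = 0}" using poly_roots_finite[OF F(2)] .
  have cardr: "card (r ` \<X>) = card \<X>" using rp.inj_\<phi> by (rule card_image)
  have bound: "card {x. poly P x = 0} \<le> degree P" if "P \<noteq> 0" for P :: "'k alg_closure poly"
    using card_poly_roots_bound[OF that] .
  have roots: "r ` \<X> = {x. poly F x = 0}"
    using card_subset_eq[OF fin sub] card_mono[OF fin sub] bound[OF F(2)] F(3) cardr by simp
  have deg: "degree F = card {x. poly F x = 0}"
    using bound[OF F(2)] F(3) cardr roots by simp
  have "squarefree f"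
    unfolding squarefree_def
  proof (intro allI impI)
    fix g assume "g\<^sup>2 dvd f"
    then obtain h where h: "f = g * g * h" by (auto simp: power2_eq_square elim: dvdE)
    have FG: "F = map_poly to_ac g * map_poly to_ac g * map_poly to_ac h"
      unfolding f h map_poly_to_ac_mult ..
    have f0: "g \<noteq> 0" "h \<noteq> 0" using FG F(2) by auto
    let ?P = "map_poly to_ac (g * h)"
    have P0: "?P \<noteq> 0" using f0 map_poly_to_ac_inject[of "g * h" 0] by simp
    \<comment> \<open>A repeated factor may be taken once without losing roots: \<open>g * h\<close>
      has as many roots as \<open>degree F\<close>, which forces
      \<open>degree g = 0\<close>.\<close>
    have "{x. poly F x = 0} \<subseteq> {x. poly ?P x = 0}"
      unfolding FG map_poly_to_ac_mult by auto
    then have "card {x. poly F x = 0} \<le> card {x. poly ?P x = 0}"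
      by (rule card_mono[OF poly_roots_finite[OF P0]])
    then have "degree F \<le> degree ?P" unfolding deg using bound[OF P0] by (rule order_trans)
    moreover have "degree F = degree g + degree (g * h)"
      unfolding f h using f0 by (simp add: degree_mult_eq)
    ultimately have "degree g = 0" by simp
    then show "g dvd 1" using f0 by (metis is_unit_iff_degree)
  qed
  moreover have "roots_ac f = r ` \<X>" unfolding roots_ac_def roots f ..
  ultimately show ?thesis
    unfolding polynomial_type_def cluster_iso_def using rp.iso_if_root_picture by metis
qed

theorem theorem2p4:
  fixes p :: nat
    and v :: "'k::field alg_closure \<Rightarrow> rat"
    and \<X> :: "'x set" and \<Sigma> :: "'x set set" and d :: "'x set \<Rightarrow> rat"
  assumes "prime p" and "odd p"
    and "finite_extension_of_Qp p TYPE('k)"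
    and "normalised_valuation v"
    and "cluster_picture \<X> \<Sigma> d"
    and "p > card \<X>"
  shows "polynomial_type v \<X> \<Sigma> d \<longleftrightarrow> hypothesis_H \<X> \<Sigma> d"
proof -
  have lc: "local_closure v (range to_ac) p"
    using local_closure_alg_closure assms by blast
  show ?thesis
    unfolding hypothesis_H_iff[OF assms(5)]
    using polynomial_type_imp_tame[OF lc assms(5,6)] tame_imp_polynomial_type[OF lc _ _ assms(6)] by blast
qed

end
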